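(* Let $\mathbb S=\{z\in\mathbb C:-\pi/2<\operatorname{Im}z<\pi/2\}$. The linear space $\operatorname{span}\{e^{i\lambda z}:\lambda\in\mathbb R\}$ is weak-star dense in $H^\infty(\mathbb S)$. Consequently, for every $p\in[1,\infty)$, $\operatorname{span}\{e^{i\lambda z}:\lambda\in\mathbb R\}$ is dense in $H^p(\mathbb S)$.
   Context: For a simply connected domain $D\subsetneq\mathbb C$ and $1\le p<\infty$, $H^p(D)$ is the Banach space of holomorphic $f$ on $D$ such that $|f|^p$ has a harmonic majorant; $H^\infty(D)$ is the space of bounded holomorphic functions. The weak-star topology of $H^\infty(\mathbb D)$ is induced by identifying it via boundary values with a subspace of $L^\infty(\partial\mathbb D)=L^1(\partial\mathbb D)^*$, and is transported to $H^\infty(D)$ via a Riemann map. *)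

theory Defs
  imports "HOL-Complex_Analysis.Complex_Analysis"
begin

definition strip :: "complex set" where
  "strip = {z. - (pi/2) < Im z \<and> Im z < pi/2}"

definition exp_span :: "(complex \<Rightarrow> complex) set" where
  "exp_span = {g. \<exists>L c. finite L \<and>
      g = (\<lambda>z. \<Sum>l\<in>L. c l * exp (\<i> * complex_of_real l * z))}"

definition harmonic_on :: "complex set \<Rightarrow> (complex \<Rightarrow> real) \<Rightarrow> bool" where
  "harmonic_on D u \<longleftrightarrow> open D \<and>
     (\<forall>z\<in>D. \<exists>r>0. ball z r \<subseteq> D \<and>
        (\<exists>h. h holomorphic_on ball z r \<and> (\<forall>w\<in>ball z r. u w = Re (h w))))"

definition harmonic_majorant :: "complex set \<Rightarrow> real \<Rightarrow> (complex \<Rightarrow> complex) \<Rightarrow> (complex \<Rightarrow> real) \<Rightarrow> bool" where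
  "harmonic_majorant D p f u \<longleftrightarrow> harmonic_on D u \<and> (\<forall>z\<in>D. norm (f z) powr p \<le> u z)"

definition Hardy :: "real \<Rightarrow> complex set \<Rightarrow> (complex \<Rightarrow> complex) set" where
  "Hardy p D = {f. f holomorphic_on D \<and> (\<exists>u. harmonic_majorant D p f u)}"

definition Hardy_norm :: "real \<Rightarrow> complex set \<Rightarrow> complex \<Rightarrow> (complex \<Rightarrow> complex) \<Rightarrow> real" where
  "Hardy_norm p D z0 f = (INF u\<in>{u. harmonic_majorant D p f u}. u z0) powr (1/p)"

definition Hardy_dense :: "real \<Rightarrow> complex set \<Rightarrow> complex \<Rightarrow> (complex \<Rightarrow> complex) set \<Rightarrow> bool" where
  "Hardy_dense p D z0 V \<longleftrightarrow>
     (\<forall>f\<in>Hardy p D. \<forall>\<epsilon>>0. \<exists>g\<in>V. Hardy_norm p D z0 (\<lambda>z. f z - g z) < \<epsilon>)"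

definition Hinf :: "complex set \<Rightarrow> (complex \<Rightarrow> complex) set" where
  "Hinf D = {f. f holomorphic_on D \<and> bounded (f ` D)}"

definition riemann_map :: "(complex \<Rightarrow> complex) \<Rightarrow> complex set \<Rightarrow> bool" where
  "riemann_map \<phi> D \<longleftrightarrow> \<phi> holomorphic_on ball 0 1 \<and> bij_betw \<phi> (ball 0 1) D"

definition bdry :: "(complex \<Rightarrow> complex) \<Rightarrow> real \<Rightarrow> complex" where
  "bdry g t = (if (\<exists>l. ((\<lambda>r. g (complex_of_real r * cis t)) \<longlongrightarrow> l) (at_left 1))
               then Lim (at_left 1) (\<lambda>r. g (complex_of_real r * cis t)) else 0)"

text \<open>Weak-star density in H^infinity(D) of a set V, where the weak-star topology
  is transported from H^infinity(disc) (identified via boundary values with a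
  subspace of L^infinity = (L^1)^* ) by the Riemann map phi.  Density: every f in
  H^infinity(D) lies in the weak-star closure of V, i.e. every basic weak-star
  neighbourhood of f (given by finitely many L^1 functions and eps) meets V.\<close>
definition weak_star_dense :: "(complex \<Rightarrow> complex) \<Rightarrow> complex set \<Rightarrow> (complex \<Rightarrow> complex) set \<Rightarrow> bool" where
  "weak_star_dense \<phi> D V \<longleftrightarrow>
     (\<forall>f\<in>Hinf D. \<forall>H :: (real \<Rightarrow> complex) set. finite H \<longrightarrow>
        (\<forall>h\<in>H. integrable (lebesgue_on {0..2*pi}) h) \<longrightarrow>
        (\<forall>\<epsilon>>0. \<exists>v\<in>V. \<forall>h\<in>H.
           norm (integral\<^sup>L (lebesgue_on {0..2*pi})
                   (\<lambda>t. (bdry (f \<circ> \<phi>) t - bdry (v \<circ> \<phi>) t) * h t)) < \<epsilon>))"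

end

theory Submission
  imports Defs "HOL-Real_Asymp.Real_Asymp"
begin

text \<open>Norm convergence in the Hardy spaces is always expressed by harmonic majorants that are small at
  one point, equivalently by means over circles. Parallelogram-type identities combined with the
  monotonicity of these means show that a function in \<open>H^p\<close> is approximated by bounded functions, and a
  bounded function by its dilations (transported from the disc), without any boundary values. The
  dilations are holomorphic on a wider strip, where after multiplication by \<open>N^2 / (N^2 + z^2)\<close> one can apply Cauchy's formula on a long
  rectangle with a periodic kernel: the vertical sides are negligible, and on the horizontal sides the
  kernel is a geometric series of exponentials. For the weak-star statement, Fatou's theorem is
  obtained by differentiating the boundary values of a primitive, which are Lipschitz, and then
  smallness in \<open>L^2\<close> of uniformly bounded boundary values gives smallness of the pairings with \<open>L^1\<close>.\<close>

section \<open>Poisson integrals and harmonic majorants\<close>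

text \<open>Two demands shape the approximation on the rectangle. The horizontal sides must stay at
  a positive distance from the strip: only then is the kernel bounded independently of its period
  and its geometric series uniformly convergent, hence the preliminary passage to a wider strip. The
  approximants must also be bounded by a constant that does not depend on the length of the
  rectangle; quadratic decay along the horizontal sides provides this, and it is the reason for the
  factor \<open>N^2 / (N^2 + z^2)\<close>. A common bound for the approximants together with
  harmonic majorants of the squared errors that are small at 0 yields both kinds of density:
  boundary values converge in L^2 under a common bound, and on a bounded range a p-th power is at
  most a small constant plus a multiple of the square. So the reduction to exponentials is carried
  out once, for an arbitrary set that contains them and is closed under such limits. It is then
  applied to two sets, the functions that are weak-star approximable and those that are approximable
  in \<open>H^p\<close>.\<close>

definition circle_mean :: "real \<Rightarrow> (complex \<Rightarrow> real) \<Rightarrow> real" where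
  "circle_mean r f = integral {0..2*pi} (\<lambda>t. f (of_real r * cis t)) / (2*pi)"

definition poisson :: "complex \<Rightarrow> real \<Rightarrow> real" where
  "poisson w t = (1 - (norm w)\<^sup>2) / (norm (cis t - w))\<^sup>2"

lemma cis_neq_if_norm_less: "norm w < 1 \<Longrightarrow> cis t \<noteq> w"
  using norm_cis[of t] by force

lemma poisson_nonneg: "norm w < 1 \<Longrightarrow> poisson w t \<ge> 0"
  by (auto simp: poisson_def power_le_one_iff abs_square_le_1)

lemma continuous_on_poisson: "norm w < 1 \<Longrightarrow> continuous_on A (poisson w)"
  unfolding poisson_def by (intro continuous_intros) (auto simp: cis_neq_if_norm_less)

text \<open>Cauchy's formula at \<open>w\<close> for
  \<open>F u * (1 - |w|^2) / (1 - cnj w * u)\<close>. The extra factor is 1 at \<open>u = w\<close>,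
  and on the circle, where \<open>1 - cnj w * u = u * cnj (u - w)\<close>, it turns the Cauchy
  kernel into the Poisson kernel.\<close>

lemma poisson_formula:
  assumes cont: "continuous_on (cball 0 1) F" and hol: "F holomorphic_on ball 0 1" and w: "norm w < 1"
  shows "((\<lambda>t. of_real (poisson w t) * F (cis t)) has_integral 2 * of_real pi * F w) {0..2*pi}"
proof -
  have nz: "1 - cnj w * u \<noteq> 0" if "norm u \<le> 1" for u
  proof
    assume "1 - cnj w * u = 0"
    hence "norm w * norm u = 1" by (metis complex_mod_cnj eq_iff_diff_eq_0 norm_mult norm_one)
    moreover have "norm w * norm u \<le> norm w * 1" using that by (intro mult_left_mono) auto
    ultimately show False using w by simp
  qed
  define f where "f = (\<lambda>u. F u * (1 - of_real ((norm w)\<^sup>2)) / (1 - cnj w * u))"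
  have "((\<lambda>u. f u/(u-w)) has_contour_integral (2 * of_real pi * \<i> * f w)) (circlepath 0 1)"
  proof (rule Cauchy_integral_circlepath)
    show "continuous_on (cball 0 1) f" unfolding f_def
      by (intro continuous_intros cont) (use nz in auto)
    show "f holomorphic_on ball 0 1" unfolding f_def
      by (intro holomorphic_intros hol) (use nz in auto)
  qed (use w in auto)
  hence "((\<lambda>t. f (cis t) / (cis t - w) * \<i> * cis t) has_integral (2 * of_real pi * \<i> * f w)) {0..2*pi}"
    by (simp add: circlepath_def has_contour_integral_part_circlepath_iff)
  moreover have "f w = F w"
  proof -
    have "of_real ((norm w)\<^sup>2) = cnj w * w" by (simp add: complex_norm_square mult.commute del: of_real_power)
    thus ?thesis using nz[of w] w by (simp add: f_def)
  qed
  moreover have "f (cis t) / (cis t - w) * \<i> * cis t = \<i> * (of_real (poisson w t) * F (cis t))" for t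
  proof -
    have c: "cis t * cnj (cis t) = 1" by (simp add: complex_norm_square[symmetric])
    have e1: "1 - cnj w * cis t = cis t * cnj (cis t - w)" using c by (simp add: algebra_simps)
    have e2: "of_real ((norm (cis t - w))\<^sup>2) = (cis t - w) * cnj (cis t - w)"
      using complex_norm_square by blast
    have nz: "cis t - w \<noteq> 0" "cis t \<noteq> 0" using cis_neq_if_norm_less[OF w] by simp_all
    have e3: "a * b / (c * cnj Z) / Z * \<i> * c = \<i> * (b / (Z * cnj Z) * a)"
      if "Z \<noteq> 0" "c \<noteq> 0" for a b c Z :: complex
      using that by (simp add: field_simps)
    show ?thesis unfolding f_def poisson_def of_real_divide e1 e2 of_real_diff of_real_1
      by (rule e3[OF nz])
  qed
  ultimately have "((\<lambda>t. \<i> * (of_real (poisson w t) * F (cis t))) has_integral (2 * of_real pi * \<i> * F w)) {0..2*pi}"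
    by simp
  from has_integral_mult_right[OF this, of "-\<i>"]
  have "((\<lambda>t. of_real (poisson w t) * F (cis t)) has_integral -\<i> * (2 * of_real pi * \<i> * F w)) {0..2*pi}"
    by simp
  also have "-\<i> * (2 * of_real pi * \<i> * F w) = 2 * of_real pi * F w"
    by (simp add: complex_eq_iff)
  finally show ?thesis .
qed

lemma poisson_integral_1: "norm w < 1 \<Longrightarrow> (poisson w has_integral 2*pi) {0..2*pi}"
  using has_integral_Re[OF poisson_formula[of "\<lambda>_. 1" w]] by simp

lemma poisson_0: "poisson 0 t = 1"
  by (simp add: poisson_def)

lemma poisson_le:
  assumes "norm w < 1" shows "poisson w t \<le> (1 + norm w) / (1 - norm w)"
proof -
  have "1 - norm w \<le> norm (cis t - w)" using norm_triangle_ineq2[of "cis t" w] by simp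
  hence "(1 - norm w)\<^sup>2 \<le> (norm (cis t - w))\<^sup>2" using assms by (intro power_mono) auto
  hence "poisson w t \<le> (1 - (norm w)\<^sup>2) / (1 - norm w)\<^sup>2" unfolding poisson_def
    using assms by (intro divide_left_mono) (auto simp: power_le_one_iff abs_square_le_1 cis_neq_if_norm_less)
  also have "1 - (norm w)\<^sup>2 = (1 + norm w) * (1 - norm w)" by (simp add: power2_eq_square algebra_simps)
  also have "(1 + norm w) * (1 - norm w) / (1 - norm w)\<^sup>2 = (1 + norm w) / (1 - norm w)" using assms by (simp add: power2_eq_square)
  finally show ?thesis .
qed

lemma holomorphic_on_dilate:
  assumes "F holomorphic_on ball 0 1" "0 < r" "r < 1"
  shows "(\<lambda>w. F (of_real r * w)) holomorphic_on ball 0 1" "continuous_on (cball 0 1) (\<lambda>w. F (of_real r * w))"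
proof -
  have "norm (of_real r * w) < 1" if "norm w \<le> 1" for w :: complex
  proof -
    have "r * norm w \<le> r * 1" using that assms by (intro mult_left_mono) auto
    hence "r * norm w < 1" using assms by linarith
    thus ?thesis using assms by (auto simp: norm_mult)
  qed
  hence i: "(\<lambda>w. of_real r * w) ` cball 0 1 \<subseteq> ball (0::complex) 1" by auto
  have "continuous_on (cball 0 1) (F \<circ> (\<lambda>w. of_real r * w))"
    by (intro continuous_on_compose continuous_intros continuous_on_subset[OF holomorphic_on_imp_continuous_on i] assms)
  thus "continuous_on (cball 0 1) (\<lambda>w. F (of_real r * w))" by (simp add: o_def)
  have "F \<circ> (\<lambda>w. of_real r * w) holomorphic_on ball 0 1"
    by (intro holomorphic_on_compose_gen[OF _ assms(1)] holomorphic_intros) (use i in \<open>auto simp: image_subset_iff\<close>)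
  thus "(\<lambda>w. F (of_real r * w)) holomorphic_on ball 0 1" by (simp add: o_def)
qed

text \<open>Convexity of \<open>x powr p\<close> enters as the tangent line at the value being estimated, so no
  general Jensen inequality is needed.\<close>

lemma powr_ge_tangent:
  fixes x y p :: real
  assumes "x \<ge> 0" "y > 0" "p \<ge> 1"
  shows "x powr p \<ge> y powr p + p * y powr (p - 1) * (x - y)"
proof (cases "x = 0")
  case True
  have "y powr (p-1) * y = y powr p" using assms by (simp add: powr_diff)
  hence "y powr p + p * y powr (p - 1) * (x - y) = (1 - p) * y powr p" using True by (simp add: algebra_simps)
  also have "\<dots> \<le> 0" using assms by (intro mult_nonpos_nonneg) auto
  finally show ?thesis using True by simp
next
  case False
  have "x powr p - y powr p \<ge> (p * y powr (p - 1)) * (x - y)"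
  proof (rule convex_on_imp_above_tangent[where A="{0<..}"])
    show "convex_on {0<..} (\<lambda>x. x powr p)" 
    proof (rule convex_on_realI)
      fix x :: real assume xy: "x \<in> {0<..}"
      show "((\<lambda>x. x powr p) has_real_derivative p * x powr (p - 1)) (at x)"
        using xy by (auto intro!: derivative_eq_intros)
    next
      fix x y :: real assume xy: "x \<in> {0<..}" "y \<in> {0<..}" "x \<le> y"
      show "p * x powr (p - 1) \<le> p * y powr (p - 1)"
        using xy assms by (intro mult_left_mono powr_mono2) auto
    qed auto
    show "((\<lambda>x. x powr p) has_real_derivative p * y powr (p - 1)) (at y within {0<..})"
      using assms by (auto intro!: derivative_eq_intros simp: )
  qed (use assms False in \<open>auto simp: interior_open\<close>)
  thus ?thesis by simp
qed

text \<open>Integrating the tangent inequality at \<open>y = norm (F w)\<close> against the Poisson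
  kernel leaves a first-order term that is nonnegative, because the Poisson formula already gives
  the case \<open>p = 1\<close>. A zero of \<open>F\<close> is treated apart since the tangent is
  taken at a positive point.\<close>

lemma norm_powr_le_poisson_integral:
  assumes cont: "continuous_on (cball 0 1) F" and hol: "F holomorphic_on ball 0 1" and w: "norm w < 1"
    and p: "p \<ge> 1"
  shows "2 * pi * norm (F w) powr p \<le> integral {0..2*pi} (\<lambda>t. poisson w t * norm (F (cis t)) powr p)"
proof -
  have cc: "continuous_on {0..2*pi} (\<lambda>t. F (cis t))"
    by (rule continuous_on_compose2[OF cont]) (auto intro!: continuous_intros)
  note ints = continuous_on_poisson[OF w] continuous_on_powr' continuous_intros cc
  show ?thesis
  proof (cases "F w = 0")
    case True
    have "integral {0..2*pi} (\<lambda>t. poisson w t * norm (F (cis t)) powr p) \<ge> 0"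
      by (intro integral_nonneg integrable_continuous_interval ints mult_nonneg_nonneg poisson_nonneg[OF w]) (use p in auto)
    thus ?thesis using True by simp
  next
    case False
    define y where "y = norm (F w)"
    have y: "y > 0" using False by (simp add: y_def)
    have "2 * pi * y = norm (integral {0..2*pi} (\<lambda>t. of_real (poisson w t) * F (cis t)))"
      using poisson_formula[OF cont hol w] by (simp add: integral_unique y_def norm_mult)
    also have "\<dots> \<le> integral {0..2*pi} (\<lambda>t. poisson w t * norm (F (cis t)))"
      by (intro integral_norm_bound_integral integrable_continuous_interval ints)
         (use poisson_nonneg[OF w] in \<open>auto simp: norm_mult\<close>)
    finally have I: "2 * pi * y \<le> integral {0..2*pi} (\<lambda>t. poisson w t * norm (F (cis t)))" .
    let ?c = "p * y powr (p - 1)"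
    have "2 * pi * y powr p \<le> (y powr p - ?c * y) * (2*pi) + ?c * integral {0..2*pi} (\<lambda>t. poisson w t * norm (F (cis t)))"
      using mult_left_mono[OF I, of ?c] p by (simp add: algebra_simps)
    also have "\<dots> = integral {0..2*pi} (\<lambda>t. (y powr p - ?c * y) * poisson w t + ?c * (poisson w t * norm (F (cis t))))"
      using poisson_integral_1[OF w]
      by (subst integral_add) (auto intro!: integrable_continuous_interval ints simp: integral_unique)
    also have "\<dots> = integral {0..2*pi} (\<lambda>t. poisson w t * (y powr p + ?c * (norm (F (cis t)) - y)))"
      by (simp add: algebra_simps)
    also have "\<dots> \<le> integral {0..2*pi} (\<lambda>t. poisson w t * norm (F (cis t)) powr p)"
      by (intro integral_le integrable_continuous_interval ints mult_left_mono poisson_nonneg[OF w] powr_ge_tangent)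
         (use y p in auto)
    finally show ?thesis by (simp add: y_def)
  qed
qed

lemma circle_mean_Re:
  assumes "h holomorphic_on ball 0 1" "0 < r" "r < 1"
  shows "circle_mean r (\<lambda>w. Re (h w)) = Re (h 0)"
  using integral_unique[OF has_integral_Re[OF poisson_formula[OF holomorphic_on_dilate(2,1)[OF assms], of 0]]]
  by (simp add: poisson_0 circle_mean_def)

text \<open>The Schwarz integral: \<open>(u + w) / (u - w)\<close> has the Poisson kernel as real part on the circle.\<close>

lemma schwarz_integral:
  fixes \<psi> :: "complex \<Rightarrow> real"
  assumes cont: "continuous_on (sphere 0 1) \<psi>" and pos: "\<And>u. norm u = 1 \<Longrightarrow> \<psi> u \<ge> 0"
  obtains h where "h holomorphic_on ball 0 1" "h 0 = of_real (circle_mean 1 \<psi>)"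
    "\<And>w. norm w < 1 \<Longrightarrow> Re (h w) = integral {0..2*pi} (\<lambda>t. poisson w t * \<psi> (cis t)) / (2*pi)"
    "\<And>w. norm w < 1 \<Longrightarrow> norm (h w) \<le> (1 + norm w) / (1 - norm w) * circle_mean 1 \<psi>"
proof -
  define k where "k = (\<lambda>w t. (cis t + w) / (cis t - w) * of_real (\<psi> (cis t)))"
  define h where "h = (\<lambda>w. integral {0..2*pi} (k w) / (2 * of_real pi))"
  have cc: "continuous_on {0..2*pi} (\<lambda>t. \<psi> (cis t))"
    by (rule continuous_on_compose2[OF cont]) (auto intro!: continuous_intros)
  have ck: "continuous_on {0..2*pi} (k w)" if "norm w < 1" for w unfolding k_def
    by (intro continuous_intros cc) (use cis_neq_if_norm_less[OF that] in auto)
  have Rek: "Re (k w t) = poisson w t * \<psi> (cis t)" if "norm w < 1" for w t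
  proof -
    have "cis t - w \<noteq> 0" using cis_neq_if_norm_less[OF that] by simp
    have "(cis t + w) / (cis t - w) = (cis t + w) * cnj (cis t - w) / of_real ((norm (cis t - w))\<^sup>2)"
      using complex_div_cnj by blast
    moreover have "Re ((cis t + w) * cnj (cis t - w)) = (norm (cis t))\<^sup>2 - (norm w)\<^sup>2"
      unfolding cmod_power2 by (simp add: power2_eq_square algebra_simps)
    ultimately have P: "Re ((cis t + w) / (cis t - w)) = poisson w t"
      by (simp add: poisson_def Re_divide_of_real del: of_real_power)
    have m: "Re (z * of_real x) = Re z * x" for z x by simp
    show ?thesis unfolding k_def m P ..
  qed
  have hol: "h holomorphic_on ball 0 1"
  proof -
    define g where "g = (\<lambda>w. contour_integral (circlepath 0 1) (\<lambda>u. of_real (\<psi> u) / (u - w)))"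
    \<comment> \<open>The exponent 1 is written out to match the rule that differentiates
      Cauchy-type integrals with an arbitrary nonzero power in the denominator.\<close>
    have int: "((\<lambda>u. of_real (\<psi> u) / (u - w)^1) has_contour_integral g w) (circlepath 0 1)" if "w \<in> ball 0 1" for w
    proof -
      have "(\<lambda>u. of_real (\<psi> u) / (u - w)) contour_integrable_on (circlepath 0 1)"
        by (intro contour_integrable_continuous_circlepath continuous_intros continuous_on_of_real)
           (use that in \<open>auto intro!: continuous_on_subset[OF cont]\<close>)
      thus ?thesis unfolding g_def by (simp add: has_contour_integral_integral)
    qed
    have "continuous_on (path_image (circlepath 0 1)) (\<lambda>u. complex_of_real (\<psi> u))"
      using cont by (auto intro!: continuous_intros)
    note cont' = this
    have "g field_differentiable at w" if w: "w \<in> ball 0 1" for w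
      using Cauchy_next_derivative_circlepath(2)[OF cont' int one_neq_zero w]
      unfolding field_differentiable_def by blast
    hence "g holomorphic_on ball 0 1"
      by (simp add: holomorphic_on_def field_differentiable_at_within)
    \<comment> \<open>Since \<open>(u + w) / (u - w) = 2 * u / (u - w) - 1\<close>, the function
      \<open>h\<close> is affine in the Cauchy-type integral \<open>g\<close> and inherits its
      holomorphy.\<close>
    moreover have "h w = - \<i> * g w / of_real pi - of_real (circle_mean 1 \<psi>)" if w: "w \<in> ball 0 1" for w
    proof -
      have g1: "((\<lambda>t. of_real (\<psi> (cis t)) / (cis t - w) * \<i> * cis t) has_integral g w) {0..2*pi}"
        using int[OF w] by (simp add: circlepath_def has_contour_integral_part_circlepath_iff)
      have g2: "((\<lambda>t. complex_of_real (\<psi> (cis t))) has_integral of_real (2 * pi * circle_mean 1 \<psi>)) {0..2*pi}"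
        using integrable_integral[OF integrable_continuous_interval[OF cc]]
        by (intro has_integral_of_real) (simp add: circle_mean_def)
      have "((\<lambda>t. 2 / \<i> * (of_real (\<psi> (cis t)) / (cis t - w) * \<i> * cis t) - complex_of_real (\<psi> (cis t)))
        has_integral 2 / \<i> * g w - of_real (2 * pi * circle_mean 1 \<psi>)) {0..2*pi}"
        by (intro has_integral_diff has_integral_mult_right g1 g2)
      moreover have "2 / \<i> * (of_real (\<psi> (cis t)) / (cis t - w) * \<i> * cis t) - complex_of_real (\<psi> (cis t)) = k w t" for t
        unfolding k_def using w cis_neq_if_norm_less[of w t] by (simp add: field_simps)
      ultimately have "integral {0..2*pi} (k w) = 2 / \<i> * g w - of_real (2 * pi * circle_mean 1 \<psi>)"
        by (simp add: integral_unique)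
      thus ?thesis unfolding h_def by (simp add: diff_divide_distrib mult.commute)
    qed
    ultimately have eq: "g holomorphic_on ball 0 1"
      "\<And>w. w \<in> ball 0 1 \<Longrightarrow> - \<i> * g w / of_real pi - of_real (circle_mean 1 \<psi>) = h w" by auto
    have "(\<lambda>w. - \<i> * g w / of_real pi - of_real (circle_mean 1 \<psi>)) holomorphic_on ball 0 1"
      by (intro holomorphic_intros eq) auto
    thus ?thesis by (rule holomorphic_transform) (rule eq)
  qed
  show ?thesis
  proof (rule that[of h])
    show "h 0 = of_real (circle_mean 1 \<psi>)"
    proof -
      have "integral {0..2*pi} (\<lambda>t. complex_of_real (\<psi> (cis t))) = of_real (integral {0..2*pi} (\<lambda>t. \<psi> (cis t)))"
        using integrable_integral[OF integrable_continuous_interval[OF cc]]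
        by (intro integral_unique has_integral_of_real)
      thus ?thesis by (simp add: h_def k_def circle_mean_def)
    qed
    fix w :: complex assume w: "norm w < 1"
    have "Re (integral {0..2*pi} (k w)) = integral {0..2*pi} (\<lambda>t. Re (k w t))"
      by (intro integral_unique[symmetric] has_integral_Re integrable_integral integrable_continuous_interval ck w)
    thus "Re (h w) = integral {0..2*pi} (\<lambda>t. poisson w t * \<psi> (cis t)) / (2*pi)"
      by (simp add: h_def Rek[OF w] Re_divide_of_real flip: of_real_mult)
    have "norm (integral {0..2*pi} (k w)) \<le> integral {0..2*pi} (\<lambda>t. (1 + norm w) / (1 - norm w) * \<psi> (cis t))"
    proof (rule integral_norm_bound_integral)
      fix t :: real assume "t \<in> {0..2*pi}"
      have "norm (cis t + w) \<le> 1 + norm w" "1 - norm w \<le> norm (cis t - w)"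
        using norm_triangle_ineq[of "cis t" w] norm_triangle_ineq2[of "cis t" w] by simp_all
      hence "norm (cis t + w) / norm (cis t - w) \<le> (1 + norm w) / (1 - norm w)"
        using w by (intro frac_le) auto
      thus "norm (k w t) \<le> (1 + norm w) / (1 - norm w) * \<psi> (cis t)"
        using mult_right_mono[OF _ pos[of "cis t"]] pos[of "cis t"] unfolding k_def norm_mult norm_divide norm_of_real
        by (metis abs_of_nonneg norm_cis)
    qed (auto intro!: integrable_continuous_interval ck w continuous_intros cc simp del: times_divide_eq_left)
    hence "norm (integral {0..2*pi} (k w)) / (2*pi) \<le>
      (1 + norm w) / (1 - norm w) * integral {0..2*pi} (\<lambda>t. \<psi> (cis t)) / (2*pi)"
      unfolding integral_mult_right by (intro divide_right_mono) auto
    thus "norm (h w) \<le> (1 + norm w) / (1 - norm w) * circle_mean 1 \<psi>"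
      by (simp add: h_def circle_mean_def norm_divide norm_mult)
  qed (rule hol)
qed

section \<open>Elementary rules for means over circles\<close>

lemma circle_mean_cong:
  assumes "\<And>w. norm w = r \<Longrightarrow> f w = g w" "r \<ge> 0"
  shows "circle_mean r f = circle_mean r g"
  unfolding circle_mean_def using assms by (simp add: norm_mult)

lemma circle_mean_mono:
  assumes "continuous_on (ball 0 1) f" "continuous_on (ball 0 1) g" "0 \<le> r" "r < 1"
    "\<And>w. norm w = r \<Longrightarrow> f w \<le> g w"
  shows "circle_mean r f \<le> circle_mean r g"
proof -
  have *: "continuous_on {0..2*pi} (\<lambda>t. f (of_real r * cis t))" if "continuous_on (ball 0 1) f" for f :: "complex \<Rightarrow> real"
    by (rule continuous_on_compose2[OF that]) (use assms in \<open>auto intro!: continuous_intros simp: norm_mult\<close>)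
  show ?thesis unfolding circle_mean_def
    by (intro divide_right_mono integral_le integrable_continuous_interval *) (use assms in \<open>auto simp: norm_mult\<close>)
qed

lemma circle_mean_dilate: "circle_mean s (\<lambda>w. f (of_real r * w)) = circle_mean (r * s) f"
  by (simp add: circle_mean_def mult.assoc)

lemma circle_mean_const: "circle_mean r (\<lambda>_. c) = c"
  by (simp add: circle_mean_def)

lemma circle_mean_add_mult:
  assumes "continuous_on (ball 0 1) f" "continuous_on (ball 0 1) g" "0 \<le> r" "r < 1"
  shows "circle_mean r (\<lambda>w. a * f w + b * g w) = a * circle_mean r f + b * circle_mean r g"
proof -
  have *: "continuous_on {0..2*pi} (\<lambda>t. f (of_real r * cis t))" if "continuous_on (ball 0 1) f" for f :: "complex \<Rightarrow> real"
    by (rule continuous_on_compose2[OF that]) (use assms in \<open>auto intro!: continuous_intros simp: norm_mult\<close>)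
  show ?thesis unfolding circle_mean_def
    by (subst integral_add) (auto intro!: integrable_continuous_interval continuous_intros * assms simp: add_divide_distrib)
qed

lemma continuous_on_norm_powr:
  assumes "F holomorphic_on S" "p > 0"
  shows "continuous_on S (\<lambda>w. norm (F w) powr p)"
  by (intro continuous_on_powr' continuous_intros holomorphic_on_imp_continuous_on assms) (use assms in auto)

section \<open>Harmonic majorants from bounded means\<close>

text \<open>The majorant is the Poisson integral of the boundary values of
  \<open>norm (F w) powr p\<close>. The last bound is uniform on compact subsets of the disc and
  later supplies the local boundedness for a normal family.\<close>

lemma holomorphic_majorant_cball:
  assumes cont: "continuous_on (cball 0 1) F" and hol: "F holomorphic_on ball 0 1" and p: "p \<ge> 1"
  obtains h where "h holomorphic_on ball 0 1" "h 0 = of_real (circle_mean 1 (\<lambda>w. norm (F w) powr p))"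
    "\<And>w. norm w < 1 \<Longrightarrow> norm (F w) powr p \<le> Re (h w)"
    "\<And>w. norm w < 1 \<Longrightarrow> norm (h w) \<le> (1 + norm w) / (1 - norm w) * circle_mean 1 (\<lambda>w. norm (F w) powr p)"
proof -
  have "continuous_on (sphere 0 1) (\<lambda>w. norm (F w) powr p)"
    by (intro continuous_on_powr' continuous_intros continuous_on_subset[OF cont]) (use p in auto)
  then obtain h where h: "h holomorphic_on ball 0 1"
    "h 0 = of_real (circle_mean 1 (\<lambda>w. norm (F w) powr p))"
    "\<And>w. norm w < 1 \<Longrightarrow> Re (h w) = integral {0..2*pi} (\<lambda>t. poisson w t * norm (F (cis t)) powr p) / (2*pi)"
    "\<And>w. norm w < 1 \<Longrightarrow> norm (h w) \<le> (1 + norm w) / (1 - norm w) * circle_mean 1 (\<lambda>w. norm (F w) powr p)"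
    by (rule schwarz_integral) auto
  show ?thesis
  proof (rule that[of h])
    fix w :: complex assume w: "norm w < 1"
    show "norm (F w) powr p \<le> Re (h w)"
      using norm_powr_le_poisson_integral[OF cont hol w p] unfolding h(3)[OF w] by (simp add: field_simps)
  qed (use h in auto)
qed

lemma circle_mean_le_majorant:
  assumes "F holomorphic_on ball 0 1" "h holomorphic_on ball 0 1" "p > 0" "0 < r" "r < 1"
    "\<And>w. norm w < 1 \<Longrightarrow> norm (F w) powr p \<le> Re (h w)"
  shows "circle_mean r (\<lambda>w. norm (F w) powr p) \<le> Re (h 0)"
proof -
  have "circle_mean r (\<lambda>w. norm (F w) powr p) \<le> circle_mean r (\<lambda>w. Re (h w))"
    by (intro circle_mean_mono continuous_on_norm_powr continuous_on_Re holomorphic_on_imp_continuous_on)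
       (use assms in auto)
  thus ?thesis using circle_mean_Re[of h r] assms by simp
qed

text \<open>The majorant built from the circle of radius \<open>r\<close> has at the centre exactly
  the mean over that circle, and by the mean value property it has the same mean over each smaller
  circle, where it dominates.\<close>

lemma circle_mean_norm_powr_mono:
  assumes hol: "F holomorphic_on ball 0 1" and p: "p \<ge> 1" and r: "0 < s" "s \<le> r" "r < 1"
  shows "circle_mean s (\<lambda>w. norm (F w) powr p) \<le> circle_mean r (\<lambda>w. norm (F w) powr p)"
proof (cases "s = r")
  case False
  have r0: "0 < r" using r by simp
  note d = holomorphic_on_dilate[OF hol r0 r(3)]
  obtain h where h: "h holomorphic_on ball 0 1" "h 0 = of_real (circle_mean 1 (\<lambda>w. norm (F (of_real r * w)) powr p))"
    "\<And>w. norm w < 1 \<Longrightarrow> norm (F (of_real r * w)) powr p \<le> Re (h w)"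
    "\<And>w. norm w < 1 \<Longrightarrow> norm (h w) \<le> (1 + norm w) / (1 - norm w) * circle_mean 1 (\<lambda>w. norm (F (of_real r * w)) powr p)"
    by (rule holomorphic_majorant_cball[OF d(2,1) p]) (use that in blast)
  have "circle_mean (s/r) (\<lambda>w. norm (F (of_real r * w)) powr p) \<le> Re (h 0)"
    using False p r by (intro circle_mean_le_majorant[OF d(1) h(1)] h(3)) auto
  thus ?thesis using r by (simp add: h(2) circle_mean_dilate[where f="\<lambda>w. norm (F w) powr p"])
qed auto

text \<open>Each dilation of \<open>F\<close> has a majorant whose value at 0 is at most
  \<open>m\<close>. Keeping holomorphic functions instead of their real parts makes Montel's theorem
  applicable, and the inequality passes to the limit by continuity of \<open>F\<close>.\<close>

lemma holomorphic_majorant_of_means: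
  assumes hol: "F holomorphic_on ball 0 1" and p: "p \<ge> 1"
    and m: "\<And>r. 0 < r \<Longrightarrow> r < 1 \<Longrightarrow> circle_mean r (\<lambda>w. norm (F w) powr p) \<le> m"
  obtains h where "h holomorphic_on ball 0 1" "Re (h 0) \<le> m"
    "\<And>w. norm w < 1 \<Longrightarrow> norm (F w) powr p \<le> Re (h w)"
proof -
  define \<rho> where "\<rho> = (\<lambda>n::nat. 1 - 1 / (real n + 2))"
  have \<rho>: "0 < \<rho> n" "\<rho> n < 1" for n by (auto simp: \<rho>_def field_simps)
  have \<rho>lim: "\<rho> \<longlonglongrightarrow> 1" unfolding \<rho>_def by real_asymp
  have "\<exists>h. h holomorphic_on ball 0 1 \<and> Re (h 0) \<le> m \<and>
     (\<forall>w. norm w < 1 \<longrightarrow> norm (F (of_real (\<rho> n) * w)) powr p \<le> Re (h w) \<and> norm (h w) \<le> (1 + norm w) / (1 - norm w) * m)" for n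
  proof -
    note d = holomorphic_on_dilate[OF hol \<rho>[of n]]
    obtain h where h: "h holomorphic_on ball 0 1" "h 0 = of_real (circle_mean 1 (\<lambda>w. norm (F (of_real (\<rho> n) * w)) powr p))"
      "\<And>w. norm w < 1 \<Longrightarrow> norm (F (of_real (\<rho> n) * w)) powr p \<le> Re (h w)"
      "\<And>w. norm w < 1 \<Longrightarrow> norm (h w) \<le> (1 + norm w) / (1 - norm w) * circle_mean 1 (\<lambda>w. norm (F (of_real (\<rho> n) * w)) powr p)"
      by (rule holomorphic_majorant_cball[OF d(2,1) p]) (use that in blast)
    have le: "circle_mean 1 (\<lambda>w. norm (F (of_real (\<rho> n) * w)) powr p) \<le> m"
      using m[OF \<rho>] by (simp add: circle_mean_dilate[where f="\<lambda>w. norm (F w) powr p"])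
    have "norm (h w) \<le> (1 + norm w) / (1 - norm w) * m" if "norm w < 1" for w
      using h(4)[OF that] by (rule order_trans) (intro mult_left_mono divide_nonneg_pos le; use that in simp)
    thus ?thesis using h le by (intro exI[of _ h]) auto
  qed
  then obtain h where h: "\<And>n. h n holomorphic_on ball 0 1" "\<And>n. Re (h n 0) \<le> m"
    "\<And>n w. norm w < 1 \<Longrightarrow> norm (F (of_real (\<rho> n) * w)) powr p \<le> Re (h n w)"
    "\<And>n w. norm w < 1 \<Longrightarrow> norm (h n w) \<le> (1 + norm w) / (1 - norm w) * m"
    by metis
  have "\<exists>B. \<forall>k\<in>range h. \<forall>z\<in>K. norm (k z) \<le> B" if K: "compact K" "K \<subseteq> ball 0 1" for K
  proof -
    have "continuous_on K (\<lambda>w. (1 + norm w) / (1 - norm w) * m)"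
      by (intro continuous_intros) (use K in auto)
    hence "bounded ((\<lambda>w. (1 + norm w) / (1 - norm w) * m) ` K)"
      using K compact_continuous_image compact_imp_bounded by blast
    then obtain B where B: "\<forall>w\<in>K. norm ((1 + norm w) / (1 - norm w) * m) \<le> B"
      unfolding bounded_iff by auto
    have "norm (h n w) \<le> B" if "w \<in> K" for n w
    proof -
      have "norm w < 1" using that K by auto
      from h(4)[OF this, of n] bspec[OF B that] show ?thesis unfolding real_norm_def by linarith
    qed
    thus ?thesis by auto
  qed
  note bd = this
  obtain g k where g: "g holomorphic_on ball 0 1" "strict_mono (k::nat\<Rightarrow>nat)"
    "\<And>x. x \<in> ball 0 1 \<Longrightarrow> (\<lambda>n. h (k n) x) \<longlonglongrightarrow> g x"
    by (rule Montel[OF open_ball _ bd, where \<F>=h]) (use h(1) that in auto)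
  show ?thesis
  proof (rule that[OF g(1)])
    have "(\<lambda>n. Re (h (k n) 0)) \<longlonglongrightarrow> Re (g 0)" using g(3)[of 0] by (intro tendsto_Re) auto
    thus "Re (g 0) \<le> m" by (rule tendsto_upperbound) (use h(2) in auto)
    fix w :: complex assume w: "norm w < 1"
    have "(\<lambda>n. Re (h (k n) w)) \<longlonglongrightarrow> Re (g w)" using g(3)[of w] w by (intro tendsto_Re) auto
    moreover have "(\<lambda>n. norm (F (of_real (\<rho> (k n)) * w)) powr p) \<longlonglongrightarrow> norm (F w) powr p"
    proof -
      have "isCont F w" using holomorphic_on_imp_continuous_on[OF hol] w
        by (auto simp: continuous_on_eq_continuous_at)
      moreover have "(\<lambda>n. of_real (\<rho> (k n)) * w) \<longlonglongrightarrow> of_real 1 * w"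
        using LIMSEQ_subseq_LIMSEQ[OF \<rho>lim g(2)] by (intro tendsto_intros) (auto simp: o_def)
      ultimately have "(\<lambda>n. F (of_real (\<rho> (k n)) * w)) \<longlonglongrightarrow> F w"
        using isCont_tendsto_compose by fastforce
      thus ?thesis by (intro tendsto_powr' tendsto_norm tendsto_const) (use p in auto)
    qed
    ultimately show "norm (F w) powr p \<le> Re (g w)"
      using LIMSEQ_le[of "\<lambda>n. norm (F (of_real (\<rho> (k n)) * w)) powr p" _ "\<lambda>n. Re (h (k n) w)"] h(3)[OF w] by blast
  qed
qed

text \<open>As \<open>h\<close> lives only on the open disc, the Poisson formula is used on the
  circle of radius halfway between \<open>norm w\<close> and 1. This yields the factor
  \<open>(1 + 3 * x) / (1 - x)\<close> with \<open>x = norm w\<close>, which is then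
  relaxed.\<close>

lemma harnack_ball:
  assumes h: "h holomorphic_on ball 0 1" "\<And>w. norm w < 1 \<Longrightarrow> Re (h w) \<ge> 0" and w: "norm w < 1"
  shows "Re (h w) \<le> (3 + norm w) / (1 - norm w) * Re (h 0)"
proof -
  define r where "r = (1 + norm w) / 2"
  have r: "0 < r" "r < 1" "norm w < r" using w norm_ge_zero[of w] by (auto simp: r_def simp del: norm_ge_zero) 
  define v where "v = w / of_real r"
  have v: "norm v < 1" "of_real r * v = w" using r by (auto simp: v_def norm_divide)
  note d = holomorphic_on_dilate[OF h(1) r(1,2)]
  have c: "continuous_on {0..2*pi} (\<lambda>t. Re (h (of_real r * cis t)))"
    by (rule continuous_on_compose2[OF continuous_on_Re[OF d(2)]]) (auto intro!: continuous_intros)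
  have n: "norm (of_real r * cis t) < 1" for t using r by (simp add: norm_mult)
  have "2 * pi * Re (h w) = integral {0..2*pi} (\<lambda>t. poisson v t * Re (h (of_real r * cis t)))"
    using integral_unique[OF has_integral_Re[OF poisson_formula[OF d(2,1) v(1)]]] v(2) by simp
  also have "\<dots> \<le> integral {0..2*pi} (\<lambda>t. (1 + norm v) / (1 - norm v) * Re (h (of_real r * cis t)))"
    by (intro integral_le integrable_continuous_interval continuous_intros c continuous_on_poisson[OF v(1)]
        mult_right_mono poisson_le[OF v(1)] h(2) n)
  also have "\<dots> = 2 * pi * ((1 + norm v) / (1 - norm v) * Re (h 0))"
  proof -
    have "integral {0..2*pi} (\<lambda>t. Re (h (of_real r * cis t))) = 2 * pi * Re (h 0)"
      using circle_mean_Re[OF h(1) r(1,2)] by (simp add: circle_mean_def field_simps)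
    thus ?thesis by (simp only: integral_mult_right) simp
  qed
  also have "(1 + norm v) / (1 - norm v) = (3 * norm w + 1) / (1 - norm w)"
  proof -
    have nv: "norm v = norm w / r" using r by (simp add: v_def norm_divide)
    have "(1 + x / ((1 + x) / 2)) / (1 - x / ((1 + x) / 2)) = (3 * x + 1) / (1 - x)" if "0 \<le> x" "x < 1" for x :: real
    proof -
      have "1 + x / ((1 + x) / 2) = (3 * x + 1) / (1 + x)" "1 - x / ((1 + x) / 2) = (1 - x) / (1 + x)"
        using that by (simp_all add: field_simps)
      thus ?thesis using that by simp
    qed
    from this[of "norm w"] show ?thesis using w unfolding nv r_def by simp
  qed
  also have "2 * pi * ((3 * norm w + 1) / (1 - norm w) * Re (h 0)) \<le> 2 * pi * ((3 + norm w) / (1 - norm w) * Re (h 0))"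
    using w h(2)[of 0] by (intro mult_left_mono mult_right_mono divide_right_mono) auto
  finally show ?thesis by (subst (asm) mult_le_cancel_left_pos) auto
qed

section \<open>Harmonic functions as real parts\<close>

text \<open>The local functions \<open>h\<close> differ by constants from each other, but their
  derivatives are determined by \<open>u\<close> and glue to a holomorphic \<open>g\<close>. A
  primitive of \<open>g\<close> on the convex set has real part \<open>u\<close> up to a
  constant.\<close>

lemma harmonic_on_convex_imp_Re:
  assumes u: "harmonic_on D u" and D: "convex D"
  obtains V where "V holomorphic_on D" "\<And>z. z \<in> D \<Longrightarrow> u z = Re (V z)"
proof (cases "D = {}")
  case False
  then obtain a where a: "a \<in> D" by blast
  have op: "open D" using u by (simp add: harmonic_on_def)
  \<comment> \<open>The real derivative of \<open>u\<close> written as \<open>Re (c * d)\<close>;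
    the number \<open>c\<close> is unique, as the directions 1 and \<open>\<i>\<close> recover its
    real and imaginary parts.\<close>
  define P where "P = (\<lambda>z c. (u has_derivative (\<lambda>d. Re (c * d))) (at z))"
  define g where "g = (\<lambda>z. THE c. P z c)"
  have uniq: "c = c'" if "P z c" "P z c'" for z c c'
  proof -
    have "Re (c * d) = Re (c' * d)" for d
      using has_derivative_unique[OF that[unfolded P_def]] by meson
    from this[of 1] this[of \<i>] show ?thesis by (simp add: complex_eq_iff)
  qed
  have loc: "\<exists>r>0. ball z r \<subseteq> D \<and> g holomorphic_on ball z r \<and> (\<forall>w\<in>ball z r. P w (g w))" if z: "z \<in> D" for z
  proof -
    obtain r h where r: "r > 0" "ball z r \<subseteq> D" "h holomorphic_on ball z r" "\<And>w. w \<in> ball z r \<Longrightarrow> u w = Re (h w)"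
      using u z unfolding harmonic_on_def by metis
    have P: "P w (deriv h w)" if w: "w \<in> ball z r" for w
    proof -
      have "(h has_field_derivative deriv h w) (at w)"
        using holomorphic_derivI[OF r(3) open_ball w] by simp
      hence "((\<lambda>w. Re (h w)) has_derivative (\<lambda>d. Re (deriv h w * d))) (at w)"
        unfolding has_field_derivative_def by (rule has_derivative_Re)
      thus ?thesis unfolding P_def
        by (rule has_derivative_transform_within_open[OF _ open_ball w]) (use r in auto)
    qed
    have ge: "g w = deriv h w" if "w \<in> ball z r" for w
      unfolding g_def using P[OF that] uniq by blast
    have "g holomorphic_on ball z r"
      using holomorphic_deriv[OF r(3) open_ball] ge by (subst holomorphic_cong[OF refl]) auto
    thus ?thesis using r P ge by (metis (no_types, lifting))
  qed
  have "g holomorphic_on D"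
  proof -
    have "g field_differentiable at z" if "z \<in> D" for z
      using loc[OF that] by (metis centre_in_ball holomorphic_on_imp_differentiable_at open_ball)
    thus ?thesis by (simp add: holomorphic_on_def field_differentiable_at_within)
  qed
  then obtain V where V: "\<And>x. x \<in> D \<Longrightarrow> (V has_field_derivative g x) (at x within D)"
    using holomorphic_convex_primitive'[OF D op] by metis
  have "((\<lambda>x. u x - Re (V x)) has_derivative (\<lambda>h. 0)) (at x within D)" if "x \<in> D" for x
  proof -
    have "P x (g x)" using loc[OF that] by (meson centre_in_ball)
    hence "(u has_derivative (\<lambda>d. Re (g x * d))) (at x within D)"
      unfolding P_def by (rule has_derivative_at_withinI)
    from has_derivative_diff[OF this has_derivative_Re[OF V[OF that, unfolded has_field_derivative_def]]]
    show ?thesis by simp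
  qed
  from has_derivative_zero_constant[OF D this]
  obtain c where c: "\<And>x. x \<in> D \<Longrightarrow> u x - Re (V x) = c" by blast
  show ?thesis
  proof (rule that[of "\<lambda>z. V z + of_real c"])
    show "(\<lambda>z. V z + of_real c) holomorphic_on D"
      using V by (intro holomorphic_intros) (auto simp: holomorphic_on_def field_differentiable_def)
  qed (use c in \<open>fastforce\<close>)
qed (use that[of "\<lambda>_. 0"] in auto)

lemma harmonic_on_Re:
  assumes "open D" "V holomorphic_on D" shows "harmonic_on D (\<lambda>z. Re (V z))"
  unfolding harmonic_on_def
proof (intro conjI ballI assms)
  fix z assume "z \<in> D"
  then obtain r where r: "r > 0" "ball z r \<subseteq> D" using assms open_contains_ball by blast
  show "\<exists>r>0. ball z r \<subseteq> D \<and> (\<exists>h. h holomorphic_on ball z r \<and> (\<forall>w\<in>ball z r. Re (V w) = Re (h w)))"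
    by (rule exI[of _ r], intro conjI exI[of _ V] r holomorphic_on_subset[OF assms(2)] ballI refl)
qed

section \<open>Means of holomorphic functions on circles\<close>

text \<open>The means of \<open>norm (R n w) powr p\<close> cannot drop below those of the limit \<open>F\<close>, so in the
  presence of the additive bound nothing is left for \<open>G n\<close>. In this way norm convergence is obtained
  without boundary values.\<close>

lemma circle_means_squeeze:
  assumes F: "F holomorphic_on ball 0 1" and p: "p \<ge> 1"
    and bdd: "\<And>r. 0 < r \<Longrightarrow> r < 1 \<Longrightarrow> circle_mean r (\<lambda>w. norm (F w) powr p) \<le> m0"
    and R: "\<And>n. R n holomorphic_on ball 0 1" and G: "\<And>n. G n holomorphic_on ball 0 1"
    and lim: "\<And>w. norm w < 1 \<Longrightarrow> (\<lambda>n::nat. R n w) \<longlonglongrightarrow> F w"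
    and dom: "continuous_on (ball 0 1) b" "\<And>n w. norm w < 1 \<Longrightarrow> norm (R n w) \<le> b w"
    and sum: "\<And>n r m. 0 < r \<Longrightarrow> r < 1 \<Longrightarrow>
        (\<And>s. 0 < s \<Longrightarrow> s < 1 \<Longrightarrow> circle_mean s (\<lambda>w. norm (F w) powr p) \<le> m) \<Longrightarrow>
        circle_mean r (\<lambda>w. norm (G n w) powr p) + circle_mean r (\<lambda>w. norm (R n w) powr p) \<le> m"
    and \<eta>: "\<eta> > 0"
  obtains N where "\<And>n r. n \<ge> N \<Longrightarrow> 0 < r \<Longrightarrow> r < 1 \<Longrightarrow> circle_mean r (\<lambda>w. norm (G n w) powr p) \<le> \<eta>"
proof -
  let ?A = "\<lambda>F r. circle_mean r (\<lambda>w. norm (F w) powr p)"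
  define S where "S = (SUP r\<in>{0<..<1}. ?A F r)"
  have bdd': "bdd_above (?A F ` {0<..<1})" by (rule bdd_aboveI2[of _ _ m0]) (use bdd in auto)
  have leS: "?A F r \<le> S" if "0 < r" "r < 1" for r
    unfolding S_def using that by (intro cSUP_upper bdd') auto
  have "S - \<eta>/2 < S" using \<eta> by simp
  then obtain r0 where r0: "0 < r0" "r0 < 1" "?A F r0 > S - \<eta>/2"
    unfolding S_def by (subst (asm) less_cSUP_iff[OF _ bdd']) auto
  have cts: "continuous_on {0..2*pi} (\<lambda>t. norm (H (of_real r0 * cis t)) powr p)"
    if "H holomorphic_on ball 0 1" for H
    by (rule continuous_on_compose2[OF continuous_on_norm_powr[OF that]])
       (use p r0 in \<open>auto intro!: continuous_intros simp: norm_mult\<close>)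
  \<comment> \<open>Convergence is needed on a single circle only, chosen so that the mean of
    \<open>F\<close> is already within \<open>\<eta>/2\<close> of its supremum.\<close>
  have "(\<lambda>n. ?A (R n) r0) \<longlonglongrightarrow> ?A F r0"
    unfolding circle_mean_def
  proof (intro tendsto_divide tendsto_const dominated_convergence(2)[where h="\<lambda>t. b (of_real r0 * cis t) powr p"])
    show "(\<lambda>t. b (of_real r0 * cis t) powr p) integrable_on {0..2*pi}"
    proof (rule integrable_continuous_interval, rule continuous_on_compose2[of "ball 0 1" "\<lambda>w. b w powr p"])
      have "b w \<ge> 0" if "norm w < 1" for w using dom(2)[OF that, of 0] norm_ge_zero order_trans by blast
      thus "continuous_on (ball 0 1) (\<lambda>w. b w powr p)"
        by (intro continuous_on_powr' dom continuous_intros) (use p in auto)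
    qed (use r0 in \<open>auto intro!: continuous_intros simp: norm_mult\<close>)
    fix k t assume "t \<in> {0..2*pi}"
    have n: "norm (of_real r0 * cis t) < 1" using r0 by (simp add: norm_mult)
    show "norm (norm (R k (of_real r0 * cis t)) powr p) \<le> b (of_real r0 * cis t) powr p"
      using dom(2)[OF n, of k] p by (auto intro!: powr_mono2)
  next
    fix t assume "t \<in> {0..2*pi}"
    have n: "norm (of_real r0 * cis t) < 1" using r0 by (simp add: norm_mult)
    show "(\<lambda>k. norm (R k (of_real r0 * cis t)) powr p) \<longlonglongrightarrow> norm (F (of_real r0 * cis t)) powr p"
      by (intro tendsto_powr' tendsto_norm lim n tendsto_const) (use p in auto)
  qed (auto intro!: integrable_continuous_interval cts R)
  hence "eventually (\<lambda>n. ?A (R n) r0 > S - \<eta>) sequentially"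
    by (rule order_tendstoD(1)) (use r0 \<eta> in auto)
  then obtain N where N: "\<And>n. n \<ge> N \<Longrightarrow> ?A (R n) r0 > S - \<eta>"
    unfolding eventually_sequentially by blast
  show ?thesis
  proof (rule that[of N])
    fix n r assume n: "n \<ge> N" and r: "0 < r" "r < (1::real)"
    \<comment> \<open>Monotonicity carries both means to this radius: the lower bound for
      \<open>R n\<close> comes from \<open>r0\<close>, the mean of \<open>G n\<close> over
      \<open>r\<close> can only grow, and there the additive bound applies.\<close>
    define r' where "r' = max r r0"
    have r': "0 < r'" "r' < 1" "r \<le> r'" "r0 \<le> r'" using r r0 by (auto simp: r'_def)
    have "?A (G n) r \<le> ?A (G n) r'" by (intro circle_mean_norm_powr_mono G p r r')
    moreover have "?A (R n) r0 \<le> ?A (R n) r'" by (intro circle_mean_norm_powr_mono R p r0 r')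
    moreover have "?A (G n) r' + ?A (R n) r' \<le> S" by (intro sum r' leS)
    ultimately show "?A (G n) r \<le> \<eta>" using N[OF n] by linarith
  qed
qed

lemma circle_mean_bounded:
  assumes F: "F holomorphic_on ball 0 1" and M: "\<And>w. norm w < 1 \<Longrightarrow> norm (F w) \<le> M" 
    and p: "p > 0" and r: "0 \<le> r" "r < 1"
  shows "circle_mean r (\<lambda>w. norm (F w) powr p) \<le> M powr p"
proof -
  have "circle_mean r (\<lambda>w. norm (F w) powr p) \<le> circle_mean r (\<lambda>_. M powr p)"
    by (intro circle_mean_mono continuous_on_norm_powr F continuous_intros powr_mono2 M) (use p r in auto)
  thus ?thesis by (simp add: circle_mean_const)
qed

text \<open>With \<open>R\<close> and \<open>G\<close> half the sum and half the difference of
  \<open>F\<close> and its dilation, the parallelogram law gives as sum of their means the average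
  of the means of \<open>F\<close> over the radii \<open>r\<close> and \<open>s * r\<close>, which
  is below any common bound. Arguing by contradiction produces the sequence to which the squeeze
  applies.\<close>

lemma dilation_converges_H2:
  assumes F: "F holomorphic_on ball 0 1" and M: "\<And>w. norm w < 1 \<Longrightarrow> norm (F w) \<le> M" and \<eta>: "\<eta> > 0"
  obtains s0 where "0 < s0" "s0 < 1"
    "\<And>s r. s0 \<le> s \<Longrightarrow> s < 1 \<Longrightarrow> 0 < r \<Longrightarrow> r < 1 \<Longrightarrow>
       circle_mean r (\<lambda>w. norm (F w - F (of_real s * w)) powr 2) \<le> \<eta>"
proof -
  let ?P = "\<lambda>s. \<forall>r. 0 < r \<longrightarrow> r < 1 \<longrightarrow> circle_mean r (\<lambda>w. norm (F w - F (of_real s * w)) powr 2) \<le> \<eta>"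
  have "\<exists>s0. 0 < s0 \<and> s0 < 1 \<and> (\<forall>s. s0 \<le> s \<longrightarrow> s < 1 \<longrightarrow> ?P s)"
  proof (rule ccontr)
    assume neg: "\<not> ?thesis"
    define \<rho> where "\<rho> = (\<lambda>n::nat. 1 - 1 / (real n + 2))"
    have \<rho>: "0 < \<rho> n" "\<rho> n < 1" for n by (auto simp: \<rho>_def field_simps)
    have \<rho>lim: "\<rho> \<longlonglongrightarrow> 1" unfolding \<rho>_def by real_asymp
    have "\<exists>s. \<rho> n \<le> s \<and> s < 1 \<and> \<not> ?P s" for n
    proof (rule ccontr)
      assume "\<not> ?thesis"
      hence "0 < \<rho> n \<and> \<rho> n < 1 \<and> (\<forall>s. \<rho> n \<le> s \<longrightarrow> s < 1 \<longrightarrow> ?P s)" using \<rho>[of n] by blast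
      thus False using neg by blast
    qed
    then obtain s where s: "\<And>n. \<rho> n \<le> s n" "\<And>n. s n < 1" "\<And>n. \<not> ?P (s n)" by metis
    have slim: "s \<longlonglongrightarrow> 1"
      by (rule tendsto_sandwich[OF _ _ \<rho>lim tendsto_const]) (use s(1) less_imp_le[OF s(2)] in \<open>auto intro!: always_eventually\<close>)
    have s0: "0 < s n" for n using s(1)[of n] \<rho>(1)[of n] by linarith
    note d = holomorphic_on_dilate(1)[OF F s0 s(2)]
    define R where "R = (\<lambda>n w. (F w + F (of_real (s n) * w)) / 2)"
    define G where "G = (\<lambda>n w. (F w - F (of_real (s n) * w)) / 2)"
    have sw: "norm (of_real (s n) * w) < 1" if "norm w < 1" for n and w :: complex
    proof -
      have "s n * norm w \<le> 1 * norm w" using s(2)[of n] by (intro mult_right_mono) auto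
      hence "s n * norm w < 1" using that by linarith
      thus ?thesis using s0[of n] by (simp add: norm_mult)
    qed
    have Rh: "R n holomorphic_on ball 0 1" and Gh: "G n holomorphic_on ball 0 1" for n
      unfolding R_def G_def by (intro holomorphic_intros F d; simp)+
    have mb: "circle_mean r (\<lambda>w. norm (F w) powr 2) \<le> M powr 2" if "0 < r" "r < 1" for r
      by (rule circle_mean_bounded[OF F M]) (use that in auto)
    \<comment> \<open>\<open>G n\<close> is half the difference, so its squared mean is a quarter of
      the wanted one.\<close>
    have "\<eta>/4 > 0" using \<eta> by simp
    obtain N where N: "\<And>n r. n \<ge> N \<Longrightarrow> 0 < r \<Longrightarrow> r < 1 \<Longrightarrow> circle_mean r (\<lambda>w. norm (G n w) powr 2) \<le> \<eta>/4"
    proof (rule circle_means_squeeze[OF F _ mb Rh Gh _ _ _ _ \<open>\<eta>/4 > 0\<close>, where b = "\<lambda>_. M"])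
      fix w :: complex assume w: "norm w < 1"
      have "isCont F w" using holomorphic_on_imp_continuous_on[OF F] w
        by (auto simp: continuous_on_eq_continuous_at)
      moreover have "(\<lambda>n. of_real (s n) * w) \<longlonglongrightarrow> of_real 1 * w"
        by (intro tendsto_intros slim)
      ultimately have "(\<lambda>n. F (of_real (s n) * w)) \<longlonglongrightarrow> F w"
        using isCont_tendsto_compose by fastforce
      hence "(\<lambda>n. R n w) \<longlonglongrightarrow> (F w + F w) / 2" unfolding R_def by (intro tendsto_intros) auto
      thus "(\<lambda>n. R n w) \<longlonglongrightarrow> F w" by simp
      fix n
      have "norm (R n w) \<le> (norm (F w) + norm (F (of_real (s n) * w))) / 2"
        unfolding R_def by (simp add: norm_divide norm_triangle_ineq)
      also have "\<dots> \<le> M" using M[OF w] M[OF sw[OF w, of n]] by simp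
      finally show "norm (R n w) \<le> M" .
    next
      fix n r m assume r: "0 < r" "r < (1::real)"
        and m: "\<And>s. 0 < s \<Longrightarrow> s < 1 \<Longrightarrow> circle_mean s (\<lambda>w. norm (F w) powr 2) \<le> m"
      note c = continuous_on_norm_powr[of _ "ball 0 1" 2]
      have "circle_mean r (\<lambda>w. norm (G n w) powr 2) + circle_mean r (\<lambda>w. norm (R n w) powr 2)
          = circle_mean r (\<lambda>w. 1 * norm (G n w) powr 2 + 1 * norm (R n w) powr 2)"
        using circle_mean_add_mult[OF c[OF Gh[of n]] c[OF Rh[of n]], of r 1 1] r by simp
      also have "\<dots> = circle_mean r (\<lambda>w. 1/2 * norm (F w) powr 2 + 1/2 * norm (F (of_real (s n) * w)) powr 2)"
      proof (rule circle_mean_cong)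
        fix w
        have "(norm (a - b))\<^sup>2 + (norm (a + b))\<^sup>2 = 2 * (norm a)\<^sup>2 + 2 * (norm b)\<^sup>2" for a b :: complex
          unfolding cmod_power2 by (simp add: power2_eq_square algebra_simps)
        from this[of "F w" "F (of_real (s n) * w)"]
        show "1 * norm (G n w) powr 2 + 1 * norm (R n w) powr 2 =
          1/2 * norm (F w) powr 2 + 1/2 * norm (F (of_real (s n) * w)) powr 2"
          unfolding G_def R_def by (simp add: norm_divide power_divide powr_numeral)
      qed (use r in auto)
      also have "\<dots> = 1/2 * circle_mean r (\<lambda>w. norm (F w) powr 2) + 1/2 * circle_mean r (\<lambda>w. norm (F (of_real (s n) * w)) powr 2)"
        by (rule circle_mean_add_mult) (use r c[OF F] c[OF d[of n]] in auto)
      also have "circle_mean r (\<lambda>w. norm (F (of_real (s n) * w)) powr 2) = circle_mean (s n * r) (\<lambda>w. norm (F w) powr 2)"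
        by (rule circle_mean_dilate[where f="\<lambda>w. norm (F w) powr 2"])
      also have "1/2 * circle_mean r (\<lambda>w. norm (F w) powr 2) + 1/2 * \<dots> \<le> m"
      proof -
        have "s n * r < 1 * 1" using s(2)[of n] s0[of n] r by (intro mult_strict_mono) auto
        thus ?thesis using m[of r] m[of "s n * r"] r s0[of n] by simp
      qed
      finally show "circle_mean r (\<lambda>w. norm (G n w) powr 2) + circle_mean r (\<lambda>w. norm (R n w) powr 2) \<le> m" .
    qed (auto intro: that)
    have "?P (s N)"
    proof (intro allI impI)
      fix r :: real assume r: "0 < r" "r < 1"
      have "circle_mean r (\<lambda>w. norm (G N w) powr 2) = circle_mean r (\<lambda>w. norm (F w - F (of_real (s N) * w)) powr 2) / 4"
        unfolding circle_mean_def G_def by (simp add: norm_divide powr_numeral power_divide)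
      thus "circle_mean r (\<lambda>w. norm (F w - F (of_real (s N) * w)) powr 2) \<le> \<eta>"
        using N[of N r] r by simp
    qed
    thus False using s(3) by blast
  qed
  thus ?thesis using that by blast
qed

text \<open>With \<open>t = n / (n + V)\<close>, which satisfies \<open>|t|^2 + |1 - t|^2 \<le> 1\<close>, the function \<open>F\<close> is split as
  \<open>F t (2 - t) + F (1 - t)^2\<close>, where the first summand is bounded. The companion for the squeeze is \<open>F t^2\<close>.\<close>

lemma bounded_approximation_Hp:
  assumes F: "F holomorphic_on ball 0 1" and V: "V holomorphic_on ball 0 1" and p: "p \<ge> 1"
    and maj: "\<And>w. norm w < 1 \<Longrightarrow> norm (F w) powr p \<le> Re (V w)" and \<eta>: "\<eta> > 0"
  obtains F1 h B where "F1 holomorphic_on ball 0 1" "\<And>w. norm w < 1 \<Longrightarrow> norm (F1 w) \<le> B"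
    "h holomorphic_on ball 0 1" "\<And>w. norm w < 1 \<Longrightarrow> norm (F w - F1 w) powr p \<le> Re (h w)" "Re (h 0) \<le> \<eta>"
proof -
  define t where "t = (\<lambda>n w. of_nat (Suc n) / (of_nat (Suc n) + V w))"
  have ReV: "Re (V w) \<ge> 0" if "norm w < 1" for w using maj[OF that] powr_ge_zero order_trans by blast
  have sq: "(real (Suc n))\<^sup>2 + (norm (V w))\<^sup>2 \<le> (norm (of_nat (Suc n) + V w))\<^sup>2" if "norm w < 1" for n w
    unfolding cmod_power2 using ReV[OF that] by (simp add: power2_eq_square algebra_simps)
  have nz: "of_nat (Suc n) + V w \<noteq> 0" if "norm w < 1" for n w
  proof
    assume "of_nat (Suc n) + V w = 0"
    hence "Re (of_nat (Suc n) + V w) = 0" by simp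
    thus False using ReV[OF that] by simp
  qed
  have th: "t n holomorphic_on ball 0 1" for n
    unfolding t_def by (intro holomorphic_intros V) (use nz in auto)
  have tsum: "(norm (t n w))\<^sup>2 + (norm (1 - t n w))\<^sup>2 \<le> 1" if "norm w < 1" for n w
  proof -
    have e: "1 - t n w = V w / (of_nat (Suc n) + V w)" using nz[OF that, of n] unfolding t_def by (simp add: field_simps)
    have "(norm (t n w))\<^sup>2 + (norm (1 - t n w))\<^sup>2 = ((real (Suc n))\<^sup>2 + (norm (V w))\<^sup>2) / (norm (of_nat (Suc n) + V w))\<^sup>2"
      unfolding e unfolding t_def norm_divide norm_of_nat power_divide by (simp add: add_divide_distrib)
    also have "\<dots> \<le> 1" using sq[OF that, of n] nz[OF that, of n] by (simp del: of_nat_Suc)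
    finally show ?thesis .
  qed
  have tle: "norm (t n w) \<le> 1" if "norm w < 1" for n w
  proof -
    have "(norm (t n w))\<^sup>2 \<le> 1\<^sup>2" using tsum[OF that, of n] zero_le_power2[of "norm (1 - t n w)"] unfolding power_one by linarith
    thus ?thesis by (rule power2_le_imp_le) simp
  qed
  define R where "R = (\<lambda>n w. F w * (t n w)\<^sup>2)"
  define G where "G = (\<lambda>n w. F w * (1 - t n w)\<^sup>2)"
  have Rh: "R n holomorphic_on ball 0 1" and Gh: "G n holomorphic_on ball 0 1" for n
    unfolding R_def G_def by (intro holomorphic_intros F th; simp)+
  obtain N where N: "\<And>n r. n \<ge> N \<Longrightarrow> 0 < r \<Longrightarrow> r < 1 \<Longrightarrow> circle_mean r (\<lambda>w. norm (G n w) powr p) \<le> \<eta>"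
  proof (rule circle_means_squeeze[OF F p _ Rh Gh _ _ _ _ \<eta>, where ?m0.0 = "Re (V 0)" and b = "\<lambda>w. norm (F w)"])
    fix w :: complex assume w: "norm w < 1"
    have "(\<lambda>n. t n w) \<longlonglongrightarrow> 1"
    proof -
      have l: "(\<lambda>n. 1 / (1 + V w * complex_of_real (inverse (real (Suc n))))) \<longlonglongrightarrow> 1 / (1 + V w * of_real 0)"
        by (intro tendsto_intros LIMSEQ_inverse_real_of_nat) auto
      have "1 / (1 + V w * of_real (inverse (real (Suc n)))) = t n w" for n
      proof -
        have "of_nat (Suc n) \<noteq> (0::complex)" by (metis of_nat_eq_0_iff nat.distinct(1))
        thus ?thesis unfolding t_def using nz[OF w, of n]
          by (simp add: field_simps del: of_nat_Suc)
      qed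
      thus ?thesis using l by simp
    qed
    hence "(\<lambda>n. R n w) \<longlonglongrightarrow> F w * 1\<^sup>2" unfolding R_def by (intro tendsto_intros)
    thus "(\<lambda>n. R n w) \<longlonglongrightarrow> F w" by simp
    fix n
    have "norm (t n w) ^ 2 \<le> 1" using tle[OF w, of n] by (simp add: power_le_one)
    thus "norm (R n w) \<le> norm (F w)" unfolding R_def
      by (simp add: norm_mult norm_power mult_left_le)
  next
    fix n r m assume r: "0 < r" "r < (1::real)"
      and m: "\<And>s. 0 < s \<Longrightarrow> s < 1 \<Longrightarrow> circle_mean s (\<lambda>w. norm (F w) powr p) \<le> m"
    have p0: "p > 0" using p by simp
    note c = continuous_on_norm_powr[OF _ p0, of _ "ball 0 1"]
    have "circle_mean r (\<lambda>w. norm (G n w) powr p) + circle_mean r (\<lambda>w. norm (R n w) powr p)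
        = circle_mean r (\<lambda>w. 1 * norm (G n w) powr p + 1 * norm (R n w) powr p)"
      using circle_mean_add_mult[OF c[OF Gh[of n]] c[OF Rh[of n]], of r 1 1] r by simp
    also have "\<dots> \<le> circle_mean r (\<lambda>w. norm (F w) powr p)"
    proof (rule circle_mean_mono)
      fix w :: complex assume "norm w = r"
      hence w: "norm w < 1" using r by simp
      \<comment> \<open>This is why \<open>t\<close> and \<open>1 - t\<close> enter squared:
        \<open>|t|^2\<close> and \<open>|1 - t|^2\<close> have sum at most 1, and a power
        \<open>p \<ge> 1\<close> only decreases numbers in the unit interval, so the additive bound
        holds for every such \<open>p\<close>.\<close>
      have q: "x powr p \<le> x" if "0 \<le> x" "x \<le> 1" for x :: real
        using that p powr_mono'[of 1 p x] by (cases "x = 0") auto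
      have "norm (G n w) powr p + norm (R n w) powr p
         = norm (F w) powr p * (((norm (1 - t n w))\<^sup>2) powr p + ((norm (t n w))\<^sup>2) powr p)"
        unfolding G_def R_def by (simp add: norm_mult norm_power powr_mult algebra_simps)
      also have "\<dots> \<le> norm (F w) powr p * ((norm (1 - t n w))\<^sup>2 + (norm (t n w))\<^sup>2)"
        using tsum[OF w, of n] zero_le_power2[of "norm (1 - t n w)"] zero_le_power2[of "norm (t n w)"]
        by (intro mult_left_mono add_mono q powr_ge_zero) linarith+
      also have "\<dots> \<le> norm (F w) powr p * 1" using tsum[OF w, of n] by (intro mult_left_mono) auto
      finally show "1 * norm (G n w) powr p + 1 * norm (R n w) powr p \<le> norm (F w) powr p" by simp
    qed (use r c[OF F] c[OF Rh[of n]] c[OF Gh[of n]] in \<open>auto intro!: continuous_intros\<close>)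
    also have "\<dots> \<le> m" using m r by simp
    finally show "circle_mean r (\<lambda>w. norm (G n w) powr p) + circle_mean r (\<lambda>w. norm (R n w) powr p) \<le> m" .
  qed (use circle_mean_le_majorant[OF F V _ _ _ maj] p holomorphic_on_imp_continuous_on[OF F] in \<open>auto intro!: continuous_intros intro: that\<close>)
  obtain h where h: "h holomorphic_on ball 0 1" "Re (h 0) \<le> \<eta>" "\<And>w. norm w < 1 \<Longrightarrow> norm (G N w) powr p \<le> Re (h w)"
    using holomorphic_majorant_of_means[OF Gh[of N] p N[of N]] by blast
  show ?thesis
  proof (rule that[of "\<lambda>w. F w - G N w" "3 * (1 + real (Suc N))" h])
    show "(\<lambda>w. F w - G N w) holomorphic_on ball 0 1" by (intro holomorphic_intros F Gh)
    fix w :: complex assume w: "norm w < 1"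
    show "norm (F w - (F w - G N w)) powr p \<le> Re (h w)" using h(3)[OF w] by simp
    have "norm (F w) \<le> 1 + norm (V w)"
    proof (cases "norm (F w) \<le> 1")
      case False
      hence "norm (F w) \<le> norm (F w) powr p" using p powr_mono[of 1 p "norm (F w)"] by simp
      also have "\<dots> \<le> norm (V w)" using maj[OF w] complex_Re_le_cmod order_trans by blast
      finally show ?thesis by simp
    qed (use norm_ge_zero[of "V w"] in linarith)
    \<comment> \<open>Since \<open>norm (V w) * norm (t N w)\<close> equals \<open>Suc N\<close>
      times \<open>norm (1 - t N w)\<close>, multiplication by \<open>t\<close> compensates the
      growth of \<open>V\<close>. The other factor \<open>2 - t\<close> has norm at most 3, whence
      the constant \<open>3 * (1 + Suc N)\<close>.\<close>
    hence "norm (F w) * norm (t N w) \<le> (1 + norm (V w)) * norm (t N w)" by (intro mult_right_mono) auto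
    also have "\<dots> = norm (t N w) + real (Suc N) * norm (V w / (of_nat (Suc N) + V w))"
      unfolding t_def norm_divide norm_of_nat by (simp add: algebra_simps add_divide_distrib)
    also have "V w / (of_nat (Suc N) + V w) = 1 - t N w"
      using nz[OF w, of N] unfolding t_def by (simp add: field_simps)
    also have "norm (t N w) + real (Suc N) * norm (1 - t N w) \<le> 1 + real (Suc N) * 1"
    proof (intro add_mono mult_left_mono tle w)
      have "(norm (1 - t N w))\<^sup>2 \<le> 1\<^sup>2" using tsum[OF w, of N] zero_le_power2[of "norm (t N w)"]
        unfolding power_one by linarith
      thus "norm (1 - t N w) \<le> 1" using power2_le_imp_le by (metis zero_le_one)
    qed auto
    finally have b: "norm (F w) * norm (t N w) \<le> 1 + real (Suc N)" by simp
    have "norm (2 - t N w) \<le> 3" using norm_triangle_ineq4[of 2 "t N w"] tle[OF w, of N] by simp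
    moreover have "F w - G N w = F w * t N w * (2 - t N w)" unfolding G_def by (simp add: power2_eq_square algebra_simps)
    hence "norm (F w - G N w) = norm (F w) * norm (t N w) * norm (2 - t N w)" by (simp add: norm_mult)
    ultimately have "norm (F w - G N w) \<le> (1 + real (Suc N)) * 3" using b
      by (simp only:) (intro mult_mono, auto)
    thus "norm (F w - G N w) \<le> 3 * (1 + real (Suc N))" by simp
  qed (use h in auto)
qed

section \<open>Local approximation by exponentials\<close>

lemma exp_span_exp: "(\<lambda>z. c * exp (\<i> * complex_of_real l * z)) \<in> exp_span"
  unfolding exp_span_def by (intro CollectI exI[of _ "{l}"] exI[of _ "\<lambda>_. c"]) auto

lemma exp_span_0: "(\<lambda>z. 0) \<in> exp_span"
  using exp_span_exp[of 0 0] by simp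

lemma exp_span_add:
  assumes "f \<in> exp_span" "g \<in> exp_span" shows "(\<lambda>z. f z + g z) \<in> exp_span"
proof -
  obtain L c L' c' where f: "finite L" "f = (\<lambda>z. \<Sum>l\<in>L. c l * exp (\<i> * complex_of_real l * z))"
    and g: "finite L'" "g = (\<lambda>z. \<Sum>l\<in>L'. c' l * exp (\<i> * complex_of_real l * z))"
    using assms unfolding exp_span_def by auto
  have "f z + g z = (\<Sum>l\<in>L\<union>L'. ((if l \<in> L then c l else 0) + (if l \<in> L' then c' l else 0)) * exp (\<i> * complex_of_real l * z))" for z
  proof -
    have "f z = (\<Sum>l\<in>L\<union>L'. (if l \<in> L then c l else 0) * exp (\<i> * complex_of_real l * z))"
      unfolding f(2) by (intro sum.mono_neutral_cong_left) (use f g in auto)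
    moreover have "g z = (\<Sum>l\<in>L\<union>L'. (if l \<in> L' then c' l else 0) * exp (\<i> * complex_of_real l * z))"
      unfolding g(2) by (intro sum.mono_neutral_cong_left) (use f g in auto)
    ultimately show ?thesis by (simp add: ring_distribs sum.distrib)
  qed
  thus ?thesis unfolding exp_span_def using f(1) g(1)
    by (intro CollectI exI[of _ "L \<union> L'"] exI[of _ "\<lambda>l. (if l \<in> L then c l else 0) + (if l \<in> L' then c' l else 0)"]) auto
qed

lemma exp_span_sum:
  assumes "finite A" "\<And>n. n \<in> A \<Longrightarrow> f n \<in> exp_span" shows "(\<lambda>z. \<Sum>n\<in>A. f n z) \<in> exp_span"
  using assms by (induction A) (auto intro: exp_span_0 exp_span_add)

lemma exp_span_scale:
  assumes "f \<in> exp_span" shows "(\<lambda>z. a * f z) \<in> exp_span"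
proof -
  obtain L c where L: "finite L" "f = (\<lambda>z. \<Sum>l\<in>L. c l * exp (\<i> * complex_of_real l * z))"
    using assms unfolding exp_span_def by auto
  have "(\<lambda>z. \<Sum>l\<in>L. (a * c l) * exp (\<i> * complex_of_real l * z)) \<in> exp_span"
    by (intro exp_span_sum exp_span_exp L)
  thus ?thesis by (simp add: L(2) sum_distrib_left mult.assoc)
qed

lemma exp_span_reflect:
  assumes "f \<in> exp_span" shows "(\<lambda>z. f (- z)) \<in> exp_span"
proof -
  obtain L c where L: "finite L" "f = (\<lambda>z. \<Sum>l\<in>L. c l * exp (\<i> * complex_of_real l * z))"
    using assms unfolding exp_span_def by auto
  have "(\<lambda>z. \<Sum>l\<in>L. c l * exp (\<i> * complex_of_real (- l) * z)) \<in> exp_span"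
    by (intro exp_span_sum exp_span_exp L)
  thus ?thesis unfolding L(2) by simp
qed

lemma open_strip: "open strip"
proof -
  have eq: "strip = {z. - (pi/2) < Im z} \<inter> {z. Im z < pi/2}" by (auto simp: strip_def)
  show ?thesis unfolding eq by (intro open_Int open_halfspace_Im_gt open_halfspace_Im_lt)
qed

lemma convex_strip: "convex strip"
proof -
  have eq: "strip = {z. - (pi/2) < Im z} \<inter> {z. Im z < pi/2}" by (auto simp: strip_def)
  show ?thesis unfolding eq by (intro convex_Int convex_halfspace_Im_gt convex_halfspace_Im_lt)
qed

lemma zero_in_strip: "0 \<in> strip"
  by (simp add: strip_def)

lemma exp_span_subset_Hinf: "exp_span \<subseteq> Hinf strip"
proof
  fix g assume "g \<in> exp_span"
  then obtain L c where L: "finite L" "g = (\<lambda>z. \<Sum>l\<in>L. c l * exp (\<i> * complex_of_real l * z))"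
    unfolding exp_span_def by auto
  have "norm (g z) \<le> (\<Sum>l\<in>L. norm (c l) * exp (\<bar>l\<bar> * (pi/2)))" if "z \<in> strip" for z
    unfolding L(2)
  proof (rule sum_norm_le)
    fix l assume "l \<in> L"
    have "\<bar>Im z\<bar> \<le> pi/2" using that by (auto simp: strip_def)
    hence "\<bar>l\<bar> * \<bar>Im z\<bar> \<le> \<bar>l\<bar> * (pi/2)" by (intro mult_left_mono) auto
    hence "- (l * Im z) \<le> \<bar>l\<bar> * (pi/2)" by (simp add: abs_mult[symmetric])
    thus "norm (c l * exp (\<i> * complex_of_real l * z)) \<le> norm (c l) * exp (\<bar>l\<bar> * (pi/2))"
      by (simp add: norm_mult mult_left_mono)
  qed
  hence "bounded (g ` strip)" unfolding bounded_iff by blast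
  moreover have "g holomorphic_on strip" unfolding L(2) by (intro holomorphic_intros)
  ultimately show "g \<in> Hinf strip" by (simp add: Hinf_def)
qed

section \<open>The periodic Cauchy kernel\<close>

definition wide_strip :: "real \<Rightarrow> complex set" where
  "wide_strip b = {z. \<bar>Im z\<bar> < b}"

lemma strip_subset_wide_strip: "pi/2 \<le> b \<Longrightarrow> strip \<subseteq> wide_strip b"
  by (auto simp: strip_def wide_strip_def)

text \<open>This kernel has period \<open>2 * pi / \<epsilon>\<close> and principal part \<open>1 / w\<close> at 0, and it is a power series in
  \<open>exp (- \<i> * \<epsilon> * w)\<close> below the real axis and in \<open>exp (\<i> * \<epsilon> * w)\<close> above it.\<close>

definition periodic_kernel :: "real \<Rightarrow> complex \<Rightarrow> complex" where
  "periodic_kernel \<epsilon> w = \<i> * of_real \<epsilon> / (1 - exp (- \<i> * of_real \<epsilon> * w))"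

lemma exp_periodic_neq_1:
  assumes "\<epsilon> > 0" "\<bar>Re w\<bar> < 2 * pi / \<epsilon>" "w \<noteq> 0"
  shows "exp (- \<i> * of_real \<epsilon> * w) \<noteq> 1"
proof
  assume "exp (- \<i> * of_real \<epsilon> * w) = 1"
  then obtain n :: int where n: "\<epsilon> * Im w = 0" "- (\<epsilon> * Re w) = of_int (2 * n) * pi"
    unfolding exp_eq_1 by auto
  have "\<epsilon> * \<bar>Re w\<bar> < 2 * pi" using assms by (simp add: field_simps)
  moreover have "\<epsilon> * \<bar>Re w\<bar> = \<bar>of_int (2 * n) * pi\<bar>" using n(2) assms(1) by (metis abs_minus_cancel abs_mult abs_of_pos)
  ultimately have "\<bar>real_of_int n\<bar> < 1" by (simp add: abs_mult)
  hence "n = 0" by linarith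
  thus False using n assms by (simp add: complex_eq_iff)
qed

lemma norm_exp_periodic: "norm (exp (- \<i> * of_real \<epsilon> * w)) = exp (\<epsilon> * Im w)"
  by simp

text \<open>The bound must not depend on \<open>\<epsilon>\<close>. The exponential has modulus
  \<open>exp (\<epsilon> * Im w)\<close>, so by \<open>exp x \<ge> 1 + x\<close> the denominator is
  at least \<open>\<epsilon> * d / (1 + \<epsilon> * d)\<close>, which cancels the factor
  \<open>\<epsilon>\<close> in the numerator.\<close>

lemma norm_periodic_kernel_le:
  assumes "\<epsilon> > 0" "\<epsilon> \<le> 1" "d > 0" "\<bar>Im w\<bar> \<ge> d"
  shows "norm (periodic_kernel \<epsilon> w) \<le> 1 + 1/d"
proof -
  define y where "y = norm (exp (- \<i> * of_real \<epsilon> * w))"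
  have y: "y = exp (\<epsilon> * Im w)" unfolding y_def by simp
  have ed: "\<epsilon> * d > 0" using assms by simp
  have "\<epsilon> * d / (1 + \<epsilon> * d) \<le> \<bar>1 - y\<bar>"
  proof (cases "Im w > 0")
    case True
    hence "\<epsilon> * d \<le> \<epsilon> * Im w" using assms by (intro mult_left_mono) auto
    hence "1 + \<epsilon> * d \<le> y" using exp_ge_add_one_self[of "\<epsilon> * Im w"] unfolding y by linarith
    moreover have "\<epsilon> * d / (1 + \<epsilon> * d) \<le> \<epsilon> * d / 1" using ed by (intro divide_left_mono) auto
    ultimately show ?thesis by linarith
  next
    case False
    hence "\<epsilon> * d \<le> \<epsilon> * (- Im w)" using assms by (intro mult_left_mono) auto
    hence "1 + \<epsilon> * d \<le> exp (- (\<epsilon> * Im w))" using exp_ge_add_one_self[of "- (\<epsilon> * Im w)"] by (simp only: mult_minus_right)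
    hence "y \<le> 1 / (1 + \<epsilon> * d)" unfolding y exp_minus using ed by (simp add: field_simps)
    moreover have "1 - 1 / (1 + \<epsilon> * d) = \<epsilon> * d / (1 + \<epsilon> * d)" using ed by (simp add: field_simps)
    ultimately show ?thesis by linarith
  qed
  also have "\<dots> \<le> norm (1 - exp (- \<i> * of_real \<epsilon> * w))"
    unfolding y_def using norm_triangle_ineq3[of 1 "exp (- \<i> * of_real \<epsilon> * w)"] by simp
  finally have "norm (periodic_kernel \<epsilon> w) \<le> \<epsilon> / (\<epsilon> * d / (1 + \<epsilon> * d))"
    unfolding periodic_kernel_def norm_divide using assms ed
    by (intro frac_le divide_pos_pos add_pos_pos) (auto simp: norm_mult)
  also have "\<dots> = \<epsilon> + 1/d" using assms ed by (simp add: field_simps)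
  finally show ?thesis using assms by simp
qed

text \<open>Around half a period away from the pole the exponential has nonpositive real part, so
  the denominator has modulus at least 1. This serves the vertical sides of the rectangle.\<close>

lemma norm_periodic_kernel_le_side:
  assumes "\<epsilon> > 0" "cos (\<epsilon> * Re w) \<le> 0"
  shows "norm (periodic_kernel \<epsilon> w) \<le> \<epsilon>"
proof -
  have "Re (exp (- \<i> * of_real \<epsilon> * w)) = exp (\<epsilon> * Im w) * cos (\<epsilon> * Re w)"
    by (simp add: Re_exp)
  also have "\<dots> \<le> 0" using assms by (intro mult_nonneg_nonpos) auto
  finally have "1 \<le> Re (1 - exp (- \<i> * of_real \<epsilon> * w))" by simp
  also have "\<dots> \<le> norm (1 - exp (- \<i> * of_real \<epsilon> * w))" by (rule complex_Re_le_cmod)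
  finally have "norm (periodic_kernel \<epsilon> w) \<le> \<epsilon> / 1"
    unfolding periodic_kernel_def norm_divide using assms by (intro frac_le) (auto simp: norm_mult)
  thus ?thesis by simp
qed

text \<open>Splitting off the simple pole at 0 writes the kernel as a holomorphic function with
  value 1 at 0, divided by \<open>w\<close>; this is the shape that Cauchy's integral formula
  needs.\<close>

lemma periodic_kernel_cauchy_factor:
  assumes "\<epsilon> > 0"
  shows "(\<lambda>w. if w = 0 then 1 else w * periodic_kernel \<epsilon> w) holomorphic_on {w. \<bar>Re w\<bar> < 2 * pi / \<epsilon>}"
    (is "?k holomorphic_on ?U")
proof (rule no_isolated_singularity'[where K="{0}"])
  have "?U = {w. - (2 * pi / \<epsilon>) < Re w} \<inter> {w. Re w < 2 * pi / \<epsilon>}" by auto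
  thus op: "open ?U" by (simp add: open_halfspace_Re_gt open_halfspace_Re_lt open_Int)
  have "(\<lambda>w. w * periodic_kernel \<epsilon> w) holomorphic_on ?U - {0}"
    unfolding periodic_kernel_def
    by (intro holomorphic_intros) (use exp_periodic_neq_1[OF assms] in auto)
  thus "?k holomorphic_on ?U - {0}" by (rule holomorphic_transform) auto
  fix z :: complex assume "z \<in> {0}"
  hence z: "z = 0" by simp
  have "((\<lambda>w. 1 - exp (- \<i> * of_real \<epsilon> * w)) has_field_derivative (\<i> * of_real \<epsilon>)) (at 0)"
    by (auto intro!: derivative_eq_intros)
  hence "((\<lambda>w. (1 - exp (- \<i> * of_real \<epsilon> * w)) / w) \<longlongrightarrow> \<i> * of_real \<epsilon>) (at 0)"
    unfolding has_field_derivative_iff by simp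
  hence "((\<lambda>w. \<i> * of_real \<epsilon> / ((1 - exp (- \<i> * of_real \<epsilon> * w)) / w)) \<longlongrightarrow> \<i> * of_real \<epsilon> / (\<i> * of_real \<epsilon>)) (at 0)"
    by (intro tendsto_intros) (use assms in auto)
  hence "((\<lambda>w. \<i> * of_real \<epsilon> / ((1 - exp (- \<i> * of_real \<epsilon> * w)) / w)) \<longlongrightarrow> 1) (at 0)" using assms by simp
  moreover have "eventually (\<lambda>w. \<i> * of_real \<epsilon> / ((1 - exp (- \<i> * of_real \<epsilon> * w)) / w) = ?k w) (at (0::complex))"
    by (auto simp: eventually_at_filter periodic_kernel_def)
  ultimately have "(?k \<longlongrightarrow> 1) (at 0)" by (rule Lim_transform_eventually)
  thus "(?k \<longlongrightarrow> ?k z) (at z within ?U)" unfolding z by (auto intro: tendsto_within_subset)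
qed auto

text \<open>A finite geometric sum with exact remainder, so that no infinite series has to be
  exchanged with an integral.\<close>

lemma periodic_kernel_expand_below:
  assumes "exp (- \<i> * of_real \<epsilon> * w) \<noteq> 1"
  shows "periodic_kernel \<epsilon> w = \<i> * of_real \<epsilon> * (\<Sum>n<m. exp (- \<i> * of_real \<epsilon> * w) ^ n)
     + exp (- \<i> * of_real \<epsilon> * w) ^ m * periodic_kernel \<epsilon> w"
proof -
  define q where "q = exp (- \<i> * of_real \<epsilon> * w)"
  have "q \<noteq> 1" using assms by (simp add: q_def)
  hence S: "(\<Sum>n<m. q ^ n) = (1 - q ^ m) / (1 - q)" by (simp add: sum_gp_strict)
  have "c / r = c * ((1 - a) / r) + a * (c / r)" for a c r :: complex
    by (simp add: diff_divide_distrib algebra_simps)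
  thus ?thesis unfolding periodic_kernel_def q_def[symmetric] S .
qed

text \<open>Follows from \<open>1 / (1 - q) + 1 / (1 - 1/q) = 1\<close>. It transfers estimates from
  below the strip to above it.\<close>

lemma periodic_kernel_minus:
  assumes "exp (- \<i> * of_real \<epsilon> * w) \<noteq> 1"
  shows "periodic_kernel \<epsilon> w = \<i> * of_real \<epsilon> - periodic_kernel \<epsilon> (- w)"
proof -
  define q where "q = exp (- \<i> * of_real \<epsilon> * w)"
  have q: "q \<noteq> 0" "q \<noteq> 1" using assms by (auto simp: q_def)
  have e: "exp (- \<i> * of_real \<epsilon> * - w) = 1 / q" by (simp add: q_def exp_minus divide_inverse)
  show ?thesis unfolding periodic_kernel_def e q_def[symmetric] using q by (simp add: field_simps)
qed

section \<open>Cauchy's formula on a long rectangle\<close>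

lemma rectangle_cauchy_periodic:
  assumes T: "T > 0" and b: "0 < b" "b < b'" and F: "F holomorphic_on wide_strip b'"
    and z: "\<bar>Re z\<bar> < T" "\<bar>Im z\<bar> < b" and \<epsilon>: "\<epsilon> = pi / T"
  defines "f \<equiv> \<lambda>\<zeta>. F \<zeta> * periodic_kernel \<epsilon> (\<zeta> - z)"
  shows "2 * of_real pi * \<i> * F z = contour_integral (linepath (Complex (-T) (-b)) (Complex T (-b))) f
    + (contour_integral (linepath (Complex T (-b)) (Complex T b)) f
    + (contour_integral (linepath (Complex T b) (Complex (-T) b)) f
    + contour_integral (linepath (Complex (-T) b) (Complex (-T) (-b))) f))"
proof -
  \<comment> \<open>If \<open>|Re \<zeta>| < T'\<close>, then \<open>|Re (\<zeta> - z)|\<close> is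
    less than \<open>2 * T\<close>, which is the period of the kernel. So \<open>z\<close> is the
    only pole in \<open>S\<close>, and \<open>T' > T\<close> leaves room around the
    rectangle.\<close>
  define T' where "T' = 2 * T - \<bar>Re z\<bar>"
  have T': "T' > T" using z by (simp add: T'_def)
  have \<epsilon>0: "\<epsilon> > 0" and per: "2 * pi / \<epsilon> = 2 * T" using T by (auto simp: \<epsilon>)
  define S where "S = {\<zeta>. - T' < Re \<zeta>} \<inter> {\<zeta>. Re \<zeta> < T'} \<inter> {\<zeta>. - b' < Im \<zeta>} \<inter> {\<zeta>. Im \<zeta> < b'}"
  have Sc: "convex S" unfolding S_def
    by (intro convex_Int convex_halfspace_Im_gt convex_halfspace_Im_lt convex_halfspace_Re_gt convex_halfspace_Re_lt)
  have So: "open S" unfolding S_def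
    by (intro open_Int open_halfspace_Im_gt open_halfspace_Im_lt open_halfspace_Re_gt open_halfspace_Re_lt)
  have SF: "F holomorphic_on S" by (rule holomorphic_on_subset[OF F]) (auto simp: S_def wide_strip_def)
  have Sz: "\<bar>Re (\<zeta> - z)\<bar> < 2 * pi / \<epsilon>" if "\<zeta> \<in> S" for \<zeta> using that unfolding per by (auto simp: S_def T'_def)
  let ?k = "\<lambda>w. if w = 0 then 1 else w * periodic_kernel \<epsilon> w"
  have kh: "(\<lambda>\<zeta>. ?k (\<zeta> - z)) holomorphic_on S"
  proof -
    have "?k \<circ> (\<lambda>\<zeta>. \<zeta> - z) holomorphic_on S"
      by (intro holomorphic_on_compose_gen[OF _ periodic_kernel_cauchy_factor[OF \<epsilon>0]] holomorphic_intros) (use Sz in auto)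
    thus ?thesis by (simp add: o_def)
  qed
  have Fkh: "(\<lambda>\<zeta>. F \<zeta> * ?k (\<zeta> - z)) holomorphic_on S" by (rule holomorphic_on_mult[OF SF kh])
  define \<gamma> where "\<gamma> = rectpath (Complex (-T) (-b)) (Complex T b)"
  have zS: "z \<in> S" using z b T' by (auto simp: S_def)
  have pim: "path_image \<gamma> \<subseteq> S - {z}"
    unfolding \<gamma>_def using T b T' z by (subst path_image_rectpath) (auto simp: S_def)
  have "((\<lambda>\<zeta>. F \<zeta> * ?k (\<zeta> - z) / (\<zeta> - z)) has_contour_integral
     (2 * pi * \<i> * winding_number \<gamma> z * (F z * ?k (z - z)))) \<gamma>"
    by (rule Cauchy_integral_formula_convex_simple[OF Sc Fkh])
       (use zS So pim in \<open>auto simp: interior_open \<gamma>_def\<close>)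
  moreover have "winding_number \<gamma> z = 1" unfolding \<gamma>_def
    by (rule winding_number_rectpath) (use z in \<open>auto simp: in_box_complex_iff\<close>)
  ultimately have I: "((\<lambda>\<zeta>. F \<zeta> * ?k (\<zeta> - z) / (\<zeta> - z)) has_contour_integral (2 * pi * \<i> * F z)) \<gamma>" by simp
  have "(f has_contour_integral (2 * pi * \<i> * F z)) \<gamma>"
    by (rule has_contour_integral_eq[OF I]) (use pim in \<open>auto simp: f_def\<close>)
  hence eq: "contour_integral \<gamma> f = 2 * pi * \<i> * F z" by (rule contour_integral_unique)
  have fc: "continuous_on (S - {z}) f" unfolding f_def periodic_kernel_def
  proof (intro continuous_intros continuous_on_subset[OF holomorphic_on_imp_continuous_on[OF SF]] ballI)
    fix \<zeta> assume "\<zeta> \<in> S - {z}"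
    thus "1 - exp (- \<i> * of_real \<epsilon> * (\<zeta> - z)) \<noteq> 0" using exp_periodic_neq_1[OF \<epsilon>0 Sz, of \<zeta>] by auto
  qed auto
  have seg: "f contour_integrable_on linepath p q" if "path_image (linepath p q) \<subseteq> path_image \<gamma>" for p q
    by (rule contour_integrable_continuous_linepath, rule continuous_on_subset[OF fc]) (use that pim in auto)
  have pj: "path_image \<gamma> = path_image (linepath (Complex (-T) (-b)) (Complex T (-b))) \<union>
     (path_image (linepath (Complex T (-b)) (Complex T b)) \<union>
     (path_image (linepath (Complex T b) (Complex (-T) b)) \<union>
     path_image (linepath (Complex (-T) b) (Complex (-T) (-b)))))"
    unfolding \<gamma>_def rectpath_def Let_def by (simp add: path_image_join)
  note s = seg[of "Complex (-T) (-b)" "Complex T (-b)"] seg[of "Complex T (-b)" "Complex T b"]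
    seg[of "Complex T b" "Complex (-T) b"] seg[of "Complex (-T) b" "Complex (-T) (-b)"]
  have "contour_integral \<gamma> f = contour_integral (linepath (Complex (-T) (-b)) (Complex T (-b))) f
    + (contour_integral (linepath (Complex T (-b)) (Complex T b)) f
    + (contour_integral (linepath (Complex T b) (Complex (-T) b)) f
    + contour_integral (linepath (Complex (-T) b) (Complex (-T) (-b))) f))"
    unfolding \<gamma>_def rectpath_def Let_def complex.sel
    by (intro contour_integral_unique has_contour_integral_join has_contour_integral_integral s valid_path_join)
       (auto simp: pj)
  thus ?thesis using eq by simp
qed

text \<open>The value does not depend on \<open>T\<close>: the arctangent bounds the integral of
  \<open>1 / (1 + (a * x)^2)\<close> over any interval by \<open>pi / a\<close>.\<close>

lemma integral_lorentz_bound: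
  fixes \<phi> k :: "real \<Rightarrow> complex"
  assumes \<phi>: "continuous_on {-T..T} \<phi>" "\<And>x. norm (\<phi> x) \<le> M / (1 + (a * x)\<^sup>2)" and a: "a > 0" and T: "T \<ge> 0"
    and k: "continuous_on {-T..T} k" "\<And>x. norm (k x) \<le> B"
  shows "norm (integral {-T..T} (\<lambda>x. \<phi> x * k x)) \<le> B * (M * pi / a)"
proof -
  have B: "B \<ge> 0" using k(2)[of 0] norm_ge_zero order_trans by blast
  have M: "M \<ge> 0" using order_trans[OF norm_ge_zero \<phi>(2)[of 0]] by simp
  have "((\<lambda>x. B * M / (1 + (a * x)\<^sup>2)) has_integral (B * M / a * arctan (a * T) - B * M / a * arctan (a * (-T)))) {-T..T}"
  proof (rule fundamental_theorem_of_calculus)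
    fix x assume "x \<in> {-T..T}"
    have "((\<lambda>x. B * M / a * arctan (a * x)) has_real_derivative B * M / a * (inverse (1 + (a * x)\<^sup>2) * a)) (at x within {-T..T})"
      by (auto intro!: derivative_eq_intros)
    moreover have "B * M / a * (inverse X * a) = B * M / X" for X using a by (simp add: field_simps)
    ultimately have "((\<lambda>x. B * M / a * arctan (a * x)) has_real_derivative B * M / (1 + (a * x)\<^sup>2)) (at x within {-T..T})"
      by simp
    thus "((\<lambda>x. B * M / a * arctan (a * x)) has_vector_derivative B * M / (1 + (a * x)\<^sup>2)) (at x within {-T..T})"
      by (simp add: has_real_derivative_iff_has_vector_derivative)
  qed (use T in auto)
  moreover have "norm (integral {-T..T} (\<lambda>x. \<phi> x * k x)) \<le> integral {-T..T} (\<lambda>x. B * M / (1 + (a * x)\<^sup>2))"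
  proof (rule integral_norm_bound_integral)
    fix x
    have "norm (\<phi> x * k x) \<le> M / (1 + (a * x)\<^sup>2) * B" unfolding norm_mult
      using M B by (intro mult_mono \<phi> k) auto
    thus "norm (\<phi> x * k x) \<le> B * M / (1 + (a * x)\<^sup>2)" by (simp add: mult.commute)
  next
    show "(\<lambda>x. \<phi> x * k x) integrable_on {-T..T}"
      by (intro integrable_continuous_interval continuous_intros \<phi> k)
  qed (use calculation in auto)
  ultimately have "norm (integral {-T..T} (\<lambda>x. \<phi> x * k x)) \<le> B * M / a * (2 * arctan (a * T))"
    by (simp add: integral_unique arctan_minus mult_ac)
  also have "\<dots> \<le> B * M / a * pi"
    using arctan_ubound[of "a * T"] B M a by (intro mult_left_mono) auto
  finally show ?thesis by (simp add: field_simps)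
qed

lemma contour_integral_linepath_horizontal:
  assumes "a < b"
  shows "contour_integral (linepath (Complex a c) (Complex b c)) f = integral {a..b} (\<lambda>x. f (Complex x c))"
proof -
  have "contour_integral (linepath (Complex a c) (Complex b c)) f =
      of_real (b - a) * integral {0..1} (\<lambda>t. f (linepath (Complex a c) (Complex b c) t))"
    by (simp add: contour_integral_integral Complex_eq)
  also have "(\<lambda>t. f (linepath (Complex a c) (Complex b c) t)) = (\<lambda>t. f (Complex ((b - a) * t + a) c))"
    by (simp add: linepath_def Complex_eq scaleR_conv_of_real algebra_simps)
  also have "{0..1} = (\<lambda>x. x / (b - a)) ` {0..b - a}" using assms by simp
  also have "integral \<dots> (\<lambda>t. f (Complex ((b - a) * t + a) c)) = integral {a - a..b - a} (\<lambda>x. f (Complex (x + a) c)) / of_real (b - a)"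
    using assms by (subst integral_stretch_real) (auto simp: scaleR_conv_of_real)
  also have "\<dots> = integral {a..b} (\<lambda>x. f (Complex x c)) / of_real (b - a)"
    by (subst integral_shift_real_ivl) (rule refl)
  finally show ?thesis using assms by simp
qed

text \<open>On a line below the strip the exponential in the kernel has modulus at most
  \<open>exp (- \<epsilon> * d)\<close>, uniformly in \<open>x\<close> and in \<open>z\<close> from
  the strip, so truncating the geometric series leaves a uniformly small remainder. The last bound
  contains neither \<open>T\<close> nor \<open>\<epsilon>\<close> nor \<open>\<eta>\<close>; the
  common bound for all approximants rests on it.\<close>

lemma exp_span_horizontal_below:
  assumes \<phi>: "continuous_on {-T..T} \<phi>" "\<And>x. norm (\<phi> x) \<le> M / (1 + (a * x)\<^sup>2)" and a: "a > 0" and T: "T \<ge> 0"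
    and \<epsilon>: "0 < \<epsilon>" "\<epsilon> \<le> 1" and b: "b > pi/2" and \<eta>: "\<eta> > 0"
  obtains e where "e \<in> exp_span"
    "\<And>z. z \<in> strip \<Longrightarrow> norm (integral {-T..T} (\<lambda>x. \<phi> x * periodic_kernel \<epsilon> (Complex x (-b) - z)) - e z) \<le> \<eta>"
    "\<And>z. z \<in> strip \<Longrightarrow> norm (integral {-T..T} (\<lambda>x. \<phi> x * periodic_kernel \<epsilon> (Complex x (-b) - z))) \<le> (1 + 1 / (b - pi/2)) * (M * pi / a)"
proof -
  define d where "d = b - pi/2"
  have d: "d > 0" using b by (simp add: d_def)
  let ?B = "(1 + 1/d) * (M * pi / a)"
  have Im: "Im (Complex x (-b) - z) \<le> - d" if "z \<in> strip" for x z using that by (auto simp: strip_def d_def)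
  have k: "norm (periodic_kernel \<epsilon> (Complex x (-b) - z)) \<le> 1 + 1/d" if "z \<in> strip" for x z
    using Im[OF that, of x] d by (intro norm_periodic_kernel_le \<epsilon>) auto
  have q: "norm (exp (- \<i> * of_real \<epsilon> * (Complex x (-b) - z))) \<le> exp (- (\<epsilon> * d))" if "z \<in> strip" for x z
    using mult_left_mono[OF Im[OF that, of x], of \<epsilon>] \<epsilon> unfolding norm_exp_periodic by simp
  have q1: "exp (- \<i> * of_real \<epsilon> * (Complex x (-b) - z)) \<noteq> 1" if "z \<in> strip" for x z
  proof
    assume "exp (- \<i> * of_real \<epsilon> * (Complex x (-b) - z)) = 1"
    hence "1 \<le> exp (- (\<epsilon> * d))" using q[OF that, of x] by (simp only: norm_one)
    thus False using \<epsilon> d by (simp add: mult_le_0_iff)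
  qed
  have kc: "continuous_on {-T..T} (\<lambda>x. periodic_kernel \<epsilon> (Complex x (-b) - z))" if "z \<in> strip" for z
    unfolding periodic_kernel_def by (intro continuous_intros) (use q1[OF that] in auto)
  have "(\<lambda>m. ?B * exp (- (\<epsilon> * d)) ^ m) \<longlonglongrightarrow> ?B * 0"
    using \<epsilon> d by (intro tendsto_intros LIMSEQ_power_zero) auto
  hence "eventually (\<lambda>m. ?B * exp (- (\<epsilon> * d)) ^ m < \<eta>) sequentially" using \<eta> by (intro order_tendstoD(2)) auto
  then obtain m where m: "?B * exp (- (\<epsilon> * d)) ^ m < \<eta>" using eventually_happens'[OF sequentially_bot] by blast
  \<comment> \<open>The n-th power of the exponential is a function of \<open>x\<close> times
    \<open>exp (\<i> * \<epsilon> * n * z)\<close>; integrating over \<open>x\<close> leaves these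
    coefficients.\<close>
  define c where "c = (\<lambda>n. \<i> * of_real \<epsilon> * integral {-T..T} (\<lambda>x. \<phi> x * exp (- \<i> * of_real \<epsilon> * Complex x (-b)) ^ n))"
  define e where "e = (\<lambda>z. \<Sum>n<m. c n * exp (\<i> * complex_of_real (\<epsilon> * real n) * z))"
  have ec: "continuous_on A (\<lambda>x. exp (- \<i> * of_real \<epsilon> * (Complex x (-b) - z)))" for z A
    by (intro continuous_intros)
  show ?thesis
  proof (rule that[of e])
    show "e \<in> exp_span" unfolding e_def by (intro exp_span_sum exp_span_exp) auto
    fix z assume z: "z \<in> strip"
    show "norm (integral {-T..T} (\<lambda>x. \<phi> x * periodic_kernel \<epsilon> (Complex x (-b) - z))) \<le> (1 + 1 / (b - pi/2)) * (M * pi / a)"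
      unfolding d_def[symmetric] by (rule integral_lorentz_bound[OF \<phi> a T kc[OF z] k[OF z]])
    let ?q = "\<lambda>x. exp (- \<i> * of_real \<epsilon> * (Complex x (-b) - z))"
    let ?k = "\<lambda>x. periodic_kernel \<epsilon> (Complex x (-b) - z)"
    have pt: "?q x ^ n = exp (- \<i> * of_real \<epsilon> * Complex x (-b)) ^ n * exp (\<i> * complex_of_real (\<epsilon> * real n) * z)" for x n
    proof -
      have "exp (\<i> * complex_of_real (\<epsilon> * real n) * z) = exp (of_nat n * (\<i> * of_real \<epsilon> * z))" by (simp add: mult_ac)
      hence 1: "exp (\<i> * complex_of_real (\<epsilon> * real n) * z) = exp (\<i> * of_real \<epsilon> * z) ^ n" by (simp only: exp_of_nat_mult)
      have "?q x = exp (- \<i> * of_real \<epsilon> * Complex x (-b)) * exp (\<i> * of_real \<epsilon> * z)"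
        by (simp add: exp_add[symmetric] algebra_simps)
      thus ?thesis unfolding 1 power_mult_distrib[symmetric] by simp
    qed
    have "integral {-T..T} (\<lambda>x. \<phi> x * ?k x) = integral {-T..T} (\<lambda>x. (\<Sum>n<m. \<i> * of_real \<epsilon> * (\<phi> x * ?q x ^ n)) + \<phi> x * (?q x ^ m * ?k x))"
    proof (rule integral_cong)
      fix x
      show "\<phi> x * ?k x = (\<Sum>n<m. \<i> * of_real \<epsilon> * (\<phi> x * ?q x ^ n)) + \<phi> x * (?q x ^ m * ?k x)"
      proof -
        have "\<phi> x * ?k x = \<phi> x * (\<i> * of_real \<epsilon> * (\<Sum>n<m. ?q x ^ n) + ?q x ^ m * ?k x)"
          by (rule arg_cong[OF periodic_kernel_expand_below[OF q1[OF z], of x m]])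
        also have "\<dots> = \<i> * of_real \<epsilon> * (\<phi> x * (\<Sum>n<m. ?q x ^ n)) + \<phi> x * (?q x ^ m * ?k x)"
          by (simp only: ring_distribs mult_ac)
        finally show ?thesis by (simp only: sum_distrib_left)
      qed
    qed
    also have "\<dots> = (\<Sum>n<m. integral {-T..T} (\<lambda>x. \<i> * of_real \<epsilon> * (\<phi> x * ?q x ^ n))) + integral {-T..T} (\<lambda>x. \<phi> x * (?q x ^ m * ?k x))"
    proof -
      have i1: "(\<lambda>x. \<i> * of_real \<epsilon> * (\<phi> x * ?q x ^ n)) integrable_on {-T..T}" for n
        by (intro integrable_continuous_interval continuous_intros \<phi> ec)
      have i2: "(\<lambda>x. \<phi> x * (?q x ^ m * ?k x)) integrable_on {-T..T}"
        by (intro integrable_continuous_interval continuous_intros \<phi> ec kc z)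
      show ?thesis using integral_add[OF integrable_sum[OF finite_lessThan i1] i2] integral_sum[OF finite_lessThan i1] by simp
    qed
    also have "(\<Sum>n<m. integral {-T..T} (\<lambda>x. \<i> * of_real \<epsilon> * (\<phi> x * ?q x ^ n))) = e z"
      unfolding e_def c_def
    proof (rule sum.cong)
      fix n
      have "(\<lambda>x. \<i> * of_real \<epsilon> * (\<phi> x * ?q x ^ n)) = (\<lambda>x. \<i> * of_real \<epsilon> * (\<phi> x * exp (- \<i> * of_real \<epsilon> * Complex x (-b)) ^ n) * exp (\<i> * complex_of_real (\<epsilon> * real n) * z))"
        unfolding pt by (simp only: mult.assoc)
      thus "integral {-T..T} (\<lambda>x. \<i> * of_real \<epsilon> * (\<phi> x * ?q x ^ n)) =
        \<i> * of_real \<epsilon> * integral {-T..T} (\<lambda>x. \<phi> x * exp (- \<i> * of_real \<epsilon> * Complex x (-b)) ^ n) * exp (\<i> * complex_of_real (\<epsilon> * real n) * z)"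
        by (simp only: integral_mult_right integral_mult_left)
    qed auto
    finally have "integral {-T..T} (\<lambda>x. \<phi> x * ?k x) - e z = integral {-T..T} (\<lambda>x. \<phi> x * (?q x ^ m * ?k x))" by simp
    also have "norm \<dots> \<le> (exp (- (\<epsilon> * d)) ^ m * (1 + 1/d)) * (M * pi / a)"
    proof (rule integral_lorentz_bound[OF \<phi> a T])
      show "continuous_on {-T..T} (\<lambda>x. ?q x ^ m * ?k x)" by (intro continuous_intros ec kc z)
      fix x
      show "norm (?q x ^ m * ?k x) \<le> exp (- (\<epsilon> * d)) ^ m * (1 + 1/d)"
        unfolding norm_mult norm_power by (intro mult_mono power_mono q k z) auto
    qed
    also have "\<dots> \<le> \<eta>" using m by (simp add: mult_ac)
    finally show "norm (integral {-T..T} (\<lambda>x. \<phi> x * ?k x) - e z) \<le> \<eta>" .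
  qed
qed

text \<open>Reflecting both \<open>x\<close> and \<open>z\<close> turns the line at height
  \<open>b\<close> into the one at height \<open>-b\<close>. The reflection formula of the kernel
  adds a constant of size at most \<open>M * pi / a\<close>, which accounts for the 2 in the
  bound.\<close>

lemma exp_span_horizontal_above:
  assumes \<phi>: "continuous_on {-T..T} \<phi>" "\<And>x. norm (\<phi> x) \<le> M / (1 + (a * x)\<^sup>2)" and a: "a > 0" and T: "T \<ge> 0"
    and \<epsilon>: "0 < \<epsilon>" "\<epsilon> \<le> 1" and b: "b > pi/2" and \<eta>: "\<eta> > 0"
  obtains e where "e \<in> exp_span"
    "\<And>z. z \<in> strip \<Longrightarrow> norm (integral {-T..T} (\<lambda>x. \<phi> x * periodic_kernel \<epsilon> (Complex x b - z)) - e z) \<le> \<eta>"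
    "\<And>z. z \<in> strip \<Longrightarrow> norm (integral {-T..T} (\<lambda>x. \<phi> x * periodic_kernel \<epsilon> (Complex x b - z))) \<le> (2 + 1 / (b - pi/2)) * (M * pi / a)"
proof -
  define \<psi> where "\<psi> = (\<lambda>x. \<phi> (- x))"
  have \<psi>: "continuous_on {-T..T} \<psi>" "\<And>x. norm (\<psi> x) \<le> M / (1 + (a * x)\<^sup>2)"
    unfolding \<psi>_def using \<phi>(2)[of "- x" for x] by (auto intro!: continuous_on_compose2[OF \<phi>(1)] continuous_intros)
  obtain e where e: "e \<in> exp_span"
    "\<And>z. z \<in> strip \<Longrightarrow> norm (integral {-T..T} (\<lambda>x. \<psi> x * periodic_kernel \<epsilon> (Complex x (-b) - z)) - e z) \<le> \<eta>"
    "\<And>z. z \<in> strip \<Longrightarrow> norm (integral {-T..T} (\<lambda>x. \<psi> x * periodic_kernel \<epsilon> (Complex x (-b) - z))) \<le> (1 + 1 / (b - pi/2)) * (M * pi / a)"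
    by (rule exp_span_horizontal_below[OF \<psi> a T \<epsilon> b \<eta>]) (use that in blast)
  define c where "c = \<i> * of_real \<epsilon> * integral {-T..T} \<phi>"
  have B: "norm (integral {-T..T} \<phi>) \<le> M * pi / a"
    using integral_lorentz_bound[OF \<phi> a T, of "\<lambda>_. 1" 1] by simp
  have "M * pi / a \<ge> 0" using B norm_ge_zero order_trans by blast
  hence cB: "norm c \<le> M * pi / a" using mult_mono[OF \<epsilon>(2) B] \<epsilon> by (simp add: c_def norm_mult)
  have eq: "integral {-T..T} (\<lambda>x. \<phi> x * periodic_kernel \<epsilon> (Complex x b - z))
     = c - integral {-T..T} (\<lambda>x. \<psi> x * periodic_kernel \<epsilon> (Complex x (-b) - (- z)))" if z: "z \<in> strip" for z
  proof -
    have q1: "exp (- \<i> * of_real \<epsilon> * (Complex x b - z)) \<noteq> 1" for x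
    proof
      assume "exp (- \<i> * of_real \<epsilon> * (Complex x b - z)) = 1"
      hence "norm (exp (- \<i> * of_real \<epsilon> * (Complex x b - z))) = 1" by simp
      thus False using z b \<epsilon> unfolding norm_exp_periodic by (auto simp: strip_def)
    qed
    have q1': "exp (- \<i> * of_real \<epsilon> * - (Complex x b - z)) \<noteq> 1" for x
    proof -
      have "exp (- \<i> * of_real \<epsilon> * - (Complex x b - z)) = inverse (exp (- \<i> * of_real \<epsilon> * (Complex x b - z)))"
        unfolding exp_minus[symmetric] by (simp add: algebra_simps)
      thus ?thesis using q1[of x] by (metis inverse_eq_1_iff)
    qed
    have kc: "continuous_on {-T..T} (\<lambda>x. periodic_kernel \<epsilon> (- (Complex x b - z)))"
      unfolding periodic_kernel_def by (intro continuous_intros) (use q1' in auto)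
    have "integral {-T..T} (\<lambda>x. \<phi> x * periodic_kernel \<epsilon> (Complex x b - z))
      = integral {-T..T} (\<lambda>x. \<i> * of_real \<epsilon> * \<phi> x - \<phi> x * periodic_kernel \<epsilon> (- (Complex x b - z)))"
      by (rule integral_cong) (subst periodic_kernel_minus[OF q1], simp add: algebra_simps)
    also have "\<dots> = c - integral {-T..T} (\<lambda>x. \<phi> x * periodic_kernel \<epsilon> (- (Complex x b - z)))"
      unfolding c_def integral_mult_right[symmetric]
      by (rule integral_diff) (intro integrable_continuous_interval continuous_intros \<phi> kc)+
    also have "integral {-T..T} (\<lambda>x. \<phi> x * periodic_kernel \<epsilon> (- (Complex x b - z))) =
       integral {-T..T} (\<lambda>x. \<phi> (-x) * periodic_kernel \<epsilon> (- (Complex (-x) b - z)))"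
      using Henstock_Kurzweil_Integration.integral_reflect_real[of T "- T" "\<lambda>x. \<phi> x * periodic_kernel \<epsilon> (- (Complex x b - z))"] by simp
    also have "(\<lambda>x. \<phi> (-x) * periodic_kernel \<epsilon> (- (Complex (-x) b - z))) = (\<lambda>x. \<psi> x * periodic_kernel \<epsilon> (Complex x (-b) - (- z)))"
      unfolding \<psi>_def by (intro ext arg_cong2[where f="(*)"] arg_cong[where f="periodic_kernel \<epsilon>"]) (auto simp: complex_eq_iff)
    finally show ?thesis .
  qed
  have m: "- z \<in> strip" if "z \<in> strip" for z using that by (auto simp: strip_def)
  show ?thesis
  \<comment> \<open>The constant \<open>c\<close> is the exponential of frequency 0.\<close>
  proof (rule that[of "\<lambda>z. c * exp (\<i> * complex_of_real 0 * z) + (- 1) * e (- z)"])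
    show "(\<lambda>z. c * exp (\<i> * complex_of_real 0 * z) + (- 1) * e (- z)) \<in> exp_span"
      by (intro exp_span_add exp_span_exp exp_span_scale exp_span_reflect e)
    fix z assume z: "z \<in> strip"
    show "norm (integral {-T..T} (\<lambda>x. \<phi> x * periodic_kernel \<epsilon> (Complex x b - z)) - (c * exp (\<i> * complex_of_real 0 * z) + (- 1) * e (- z))) \<le> \<eta>"
      unfolding eq[OF z] using e(2)[OF m[OF z]] by (simp add: norm_minus_commute)
    have "norm (c - integral {-T..T} (\<lambda>x. \<psi> x * periodic_kernel \<epsilon> (Complex x (-b) - (- z)))) \<le> M * pi / a + (1 + 1 / (b - pi/2)) * (M * pi / a)"
      using norm_triangle_ineq4 order_trans add_mono[OF cB e(3)[OF m[OF z]]] by blast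
    thus "norm (integral {-T..T} (\<lambda>x. \<phi> x * periodic_kernel \<epsilon> (Complex x b - z))) \<le> (2 + 1 / (b - pi/2)) * (M * pi / a)"
      unfolding eq[OF z] by (simp add: algebra_simps)
  qed
qed

text \<open>The order of quantifiers is essential: \<open>C\<close> bounds the approximants on the
  whole strip and is fixed before \<open>\<eta>\<close> and \<open>R\<close>, while closeness is
  claimed only for bounded real part.\<close>

lemma exp_span_local_approximation:
  assumes F: "F holomorphic_on wide_strip b'" and b': "b' > pi/2" and a: "a > 0"
    and M: "\<And>z. z \<in> wide_strip b' \<Longrightarrow> norm (F z) \<le> M / (1 + (a * Re z)\<^sup>2)"
  obtains C where "\<And>\<eta> R. \<eta> > 0 \<Longrightarrow> \<exists>e\<in>exp_span. (\<forall>z\<in>strip. norm (e z) \<le> C) \<and>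
     (\<forall>z\<in>strip. \<bar>Re z\<bar> \<le> R \<longrightarrow> norm (F z - e z) \<le> \<eta>)"
proof -
  obtain b where b: "pi/2 < b" "b < b'" using b' dense by blast
  have b0: "b > 0" using b pi_gt_zero by linarith
  define B where "B = (2 + 1 / (b - pi/2)) * (M * pi / a)"
  \<comment> \<open>Two horizontal integrals, each bounded by \<open>B\<close>, and two truncation
    errors, each at most 1.\<close>
  define C where "C = B + B + 1 + 1"
  have M0: "M \<ge> 0"
  proof -
    have "0 \<in> wide_strip b'" using b b0 by (simp add: wide_strip_def)
    from order_trans[OF norm_ge_zero M[OF this]] show ?thesis by simp
  qed
  show ?thesis
  proof (rule that[of C])
    fix \<eta>0 R0 :: real assume \<eta>0: "\<eta>0 > 0"
    \<comment> \<open>The cap at 1 keeps the truncation errors within the fixed constant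
      \<open>C\<close>.\<close>
    define \<eta> where "\<eta> = min 1 \<eta>0"
    have \<eta>: "\<eta> > 0" "\<eta> \<le> 1" "\<eta> \<le> \<eta>0" using \<eta>0 by (auto simp: \<eta>_def)
    \<comment> \<open>\<open>T \<ge> pi\<close> gives \<open>\<epsilon> \<le> 1\<close>;
      \<open>T \<ge> 2 * R0\<close> keeps \<open>|\<epsilon> * Re z|\<close> at most
      \<open>pi/2\<close>; the last entry makes the contribution of the vertical sides at most
      \<open>\<eta>/2\<close>.\<close>
    define T where "T = max (max pi (2 * R0)) (max 1 (4 * b * M * pi / \<eta>))"
    have T: "T \<ge> pi" "T \<ge> 2 * R0" "T \<ge> 1" "T \<ge> 4 * b * M * pi / \<eta>" by (auto simp: T_def)
    define \<epsilon> where "\<epsilon> = pi / T"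
    have \<epsilon>: "0 < \<epsilon>" "\<epsilon> \<le> 1" using T by (auto simp: \<epsilon>_def)
    have \<epsilon>T: "\<epsilon> * T = pi" using T by (simp add: \<epsilon>_def)
    have line: "continuous_on {-T..T} (\<lambda>x. F (Complex x s))" "norm (F (Complex x s)) \<le> M / (1 + (a * x)\<^sup>2)"
      if "s = b \<or> s = - b" for s x
    proof -
      have w: "Complex x s \<in> wide_strip b'" for x using that b b0 by (auto simp: wide_strip_def)
      show "continuous_on {-T..T} (\<lambda>x. F (Complex x s))"
        by (rule continuous_on_compose2[OF holomorphic_on_imp_continuous_on[OF F]])
           (use w in \<open>auto simp: Complex_eq intro!: continuous_intros\<close>)
      show "norm (F (Complex x s)) \<le> M / (1 + (a * x)\<^sup>2)" using M[OF w[of x]] by simp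
    qed
    define lo where "lo = (\<lambda>z. integral {-T..T} (\<lambda>x. F (Complex x (-b)) * periodic_kernel \<epsilon> (Complex x (-b) - z)))"
    define hi where "hi = (\<lambda>z. integral {-T..T} (\<lambda>x. F (Complex x b) * periodic_kernel \<epsilon> (Complex x b - z)))"
    have T0: "T \<ge> 0" using T by simp
    obtain e1 where e1: "e1 \<in> exp_span" "\<And>z. z \<in> strip \<Longrightarrow> norm (lo z - e1 z) \<le> \<eta>"
      "\<And>z. z \<in> strip \<Longrightarrow> norm (lo z) \<le> (1 + 1 / (b - pi/2)) * (M * pi / a)"
      unfolding lo_def by (rule exp_span_horizontal_below[OF line[of "-b"] a T0 \<epsilon> b(1) \<eta>(1)]) (use that in auto)
    obtain e2 where e2: "e2 \<in> exp_span" "\<And>z. z \<in> strip \<Longrightarrow> norm (hi z - e2 z) \<le> \<eta>"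
      "\<And>z. z \<in> strip \<Longrightarrow> norm (hi z) \<le> B"
      unfolding hi_def B_def by (rule exp_span_horizontal_above[OF line[of b] a T0 \<epsilon> b(1) \<eta>(1)]) (use that in auto)
    have loB: "norm (lo z) \<le> B" if "z \<in> strip" for z
      using e1(3)[OF that] unfolding B_def
      by (rule order_trans, intro mult_right_mono) (use M0 a in auto)
    define p where "p = 2 * of_real pi * \<i>"
    have np: "norm p = 2 * pi" by (simp add: p_def norm_mult)
    define e where "e = (\<lambda>z. (e1 z - e2 z) / p)"
    have "(\<lambda>z. (1/p) * e1 z + (- 1/p) * e2 z) \<in> exp_span" by (intro exp_span_add exp_span_scale e1 e2)
    hence es: "e \<in> exp_span" by (simp add: e_def diff_divide_distrib)
    have ediff: "norm ((lo z - hi z) / p - e z) \<le> \<eta> / 2" if "z \<in> strip" for z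
    proof -
      have "(lo z - hi z) / p - e z = ((lo z - e1 z) - (hi z - e2 z)) / p"
        unfolding e_def by (simp add: diff_divide_distrib)
      hence "norm ((lo z - hi z) / p - e z) = norm ((lo z - e1 z) - (hi z - e2 z)) / (2 * pi)"
        by (simp add: norm_divide np)
      also have "\<dots> \<le> (\<eta> + \<eta>) / (2 * pi)"
        by (intro divide_right_mono order_trans[OF norm_triangle_ineq4] add_mono e1 e2 that) auto
      also have "\<dots> = \<eta> / pi" by simp
      also have "\<dots> \<le> \<eta> / 2" using \<eta> pi_ge_two by (intro divide_left_mono) auto
      finally show ?thesis .
    qed
    show "\<exists>e\<in>exp_span. (\<forall>z\<in>strip. norm (e z) \<le> C) \<and> (\<forall>z\<in>strip. \<bar>Re z\<bar> \<le> R0 \<longrightarrow> norm (F z - e z) \<le> \<eta>0)"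
    proof (rule bexI[OF _ es], intro conjI ballI impI)
      fix z assume z: "z \<in> strip"
      have "norm (e z) = norm (e1 z - e2 z) / (2 * pi)" by (simp add: e_def norm_divide np)
      also have "\<dots> \<le> norm (e1 z - e2 z) / 1" using pi_ge_two by (intro divide_left_mono) auto
      also have "\<dots> = norm ((lo z - hi z) - ((lo z - e1 z) - (hi z - e2 z)))" by (simp add: algebra_simps)
      also have "\<dots> \<le> (norm (lo z) + norm (hi z)) + (norm (lo z - e1 z) + norm (hi z - e2 z))"
        by (intro order_trans[OF norm_triangle_ineq4] add_mono norm_triangle_ineq4)
      also have "\<dots> \<le> C" using loB[OF z] e2(3)[OF z] e1(2)[OF z] e2(2)[OF z] \<eta> unfolding C_def by linarith
      finally show "norm (e z) \<le> C" .
    next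
      fix z assume z: "z \<in> strip" and R: "\<bar>Re z\<bar> \<le> R0"
      have zT: "\<bar>Re z\<bar> < T" "\<bar>Im z\<bar> < b" using z R T b by (auto simp: strip_def)
      let ?f = "\<lambda>\<zeta>. F \<zeta> * periodic_kernel \<epsilon> (\<zeta> - z)"
      have TT: "T > 0" using T by simp
      have side: "norm (contour_integral (linepath (Complex c s) (Complex c (- s))) ?f) \<le> (M * \<epsilon>) * (2 * b)"
        if cs: "c = T \<or> c = - T" "s = b \<or> s = - b" for c s
      proof -
        have in_seg: "Re x = c" "\<bar>Im x\<bar> \<le> b" if xs: "x \<in> closed_segment (Complex c s) (Complex c (- s))" for x
        proof -
          obtain u where u: "0 \<le> u" "u \<le> 1" "x = (1 - u) *\<^sub>R Complex c s + u *\<^sub>R Complex c (- s)"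
            using xs unfolding closed_segment_def by auto
          show "Re x = c" unfolding u(3) by (simp add: algebra_simps)
          have "Im x = (1 - 2 * u) * s" unfolding u(3) by (simp add: algebra_simps)
          moreover have "\<bar>1 - 2 * u\<bar> * \<bar>s\<bar> \<le> 1 * b" using u cs b0 by (intro mult_mono) auto
          ultimately show "\<bar>Im x\<bar> \<le> b" by (simp add: abs_mult)
        qed
        \<comment> \<open>On a vertical side \<open>\<epsilon> * Re x\<close> is \<open>pi\<close>
          or \<open>-pi\<close>, and subtracting \<open>\<epsilon> * Re z\<close> moves it by at
          most \<open>pi/2\<close>, into the range where the cosine is nonpositive.\<close>
        have kb: "norm (periodic_kernel \<epsilon> (x - z)) \<le> \<epsilon>" and cosn: "cos (\<epsilon> * Re (x - z)) \<le> 0" if "Re x = c" for x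
        proof -
          have "\<bar>\<epsilon> * Re z\<bar> \<le> \<epsilon> * (T / 2)" using R T \<epsilon> by (simp add: abs_mult)
          hence "\<bar>\<epsilon> * Re z\<bar> \<le> pi / 2" using \<epsilon>T by simp
          hence "cos (\<epsilon> * Re z) \<ge> 0" by (intro cos_ge_zero) auto
          moreover have "\<epsilon> * Re (x - z) = pi - \<epsilon> * Re z \<or> \<epsilon> * Re (x - z) = - (pi + \<epsilon> * Re z)"
            using cs that \<epsilon>T by (auto simp: algebra_simps)
          ultimately show "cos (\<epsilon> * Re (x - z)) \<le> 0" by (auto simp: cos_diff cos_add)
          thus "norm (periodic_kernel \<epsilon> (x - z)) \<le> \<epsilon>" by (rule norm_periodic_kernel_le_side[OF \<epsilon>(1)])
        qed
        have ws: "x \<in> wide_strip b'" if "x \<in> closed_segment (Complex c s) (Complex c (- s))" for x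
          using in_seg[OF that] b by (simp add: wide_strip_def)
        have "norm (contour_integral (linepath (Complex c s) (Complex c (- s))) ?f) \<le> (M * \<epsilon>) * norm (Complex c (- s) - Complex c s)"
        proof (rule contour_integral_bound_linepath)
          show "?f contour_integrable_on linepath (Complex c s) (Complex c (- s))"
            unfolding periodic_kernel_def
          proof (intro contour_integrable_continuous_linepath continuous_intros continuous_on_subset[OF holomorphic_on_imp_continuous_on[OF F]] ballI)
            fix x assume "x \<in> closed_segment (Complex c s) (Complex c (- s))"
            hence "cos (\<epsilon> * Re (x - z)) \<le> 0" by (intro cosn in_seg)
            hence "Re (exp (- \<i> * of_real \<epsilon> * (x - z))) \<le> 0" by (simp add: Re_exp mult_nonneg_nonpos)
            thus "1 - exp (- \<i> * of_real \<epsilon> * (x - z)) \<noteq> 0" by (metis eq_iff_diff_eq_0 not_one_le_zero one_complex.sel(1))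
          qed (use ws in auto)
          fix x assume x: "x \<in> closed_segment (Complex c s) (Complex c (- s))"
          have "norm (F x) \<le> M / 1"
            using M0 by (intro order_trans[OF M[OF ws[OF x]]] divide_left_mono) (auto intro: add_pos_nonneg)
          thus "norm (?f x) \<le> M * \<epsilon>" unfolding norm_mult using M0
            by (intro mult_mono kb in_seg(1)[OF x]) auto
        qed (use M0 \<epsilon> in auto)
        also have "Complex c (- s) - Complex c s = of_real (- 2 * s) * \<i>" by (simp add: complex_eq_iff)
        also have "norm \<dots> = 2 * b" using cs b0 by (auto simp: norm_mult)
        finally show ?thesis .
      qed
      have h1: "contour_integral (linepath (Complex (-T) (-b)) (Complex T (-b))) ?f = lo z"
        using contour_integral_linepath_horizontal[of "-T" T "-b" ?f] TT by (simp add: lo_def)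
      have "contour_integral (linepath (Complex T b) (Complex (-T) b)) ?f = - contour_integral (linepath (Complex (-T) b) (Complex T b)) ?f"
        by (metis contour_integral_reversepath reversepath_linepath valid_path_linepath)
      also have "\<dots> = - hi z"
        using contour_integral_linepath_horizontal[of "-T" T b ?f] TT by (simp add: hi_def)
      finally have h2: "contour_integral (linepath (Complex T b) (Complex (-T) b)) ?f = - hi z" .
      define s1 where "s1 = contour_integral (linepath (Complex T (-b)) (Complex T b)) ?f"
      define s2 where "s2 = contour_integral (linepath (Complex (-T) b) (Complex (-T) (-b))) ?f"
      have ss: "norm s1 \<le> (M * \<epsilon>) * (2 * b)" "norm s2 \<le> (M * \<epsilon>) * (2 * b)"
        using side[of T "-b"] side[of "-T" b] by (auto simp: s1_def s2_def)
      have "p * F z = lo z + (s1 + (- hi z + s2))"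
        using rectangle_cauchy_periodic[OF TT b0 b(2) F zT \<epsilon>_def] unfolding h1 h2 s1_def s2_def p_def by simp
      moreover have "p \<noteq> 0" by (simp add: p_def)
      ultimately have "F z = (lo z + (s1 + (- hi z + s2))) / p" by (simp add: field_simps)
      hence "F z - (lo z - hi z) / p = (s1 + s2) / p" by (simp add: diff_divide_distrib add_divide_distrib)
      hence "norm (F z - (lo z - hi z) / p) = norm (s1 + s2) / (2 * pi)" by (simp add: norm_divide np)
      also have "\<dots> \<le> norm (s1 + s2) / 2" using pi_ge_two by (intro divide_left_mono) auto
      also have "\<dots> \<le> (M * \<epsilon>) * (2 * b)" using norm_triangle_ineq[of s1 s2] ss by linarith
      also have "\<dots> \<le> \<eta> / 2"
        using T(4) TT \<eta> unfolding \<epsilon>_def by (simp add: field_simps)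
      finally have "norm (F z - (lo z - hi z) / p) \<le> \<eta> / 2" .
      moreover have "F z - e z = (F z - (lo z - hi z) / p) + ((lo z - hi z) / p - e z)" by simp
      ultimately have "norm (F z - e z) \<le> \<eta> / 2 + \<eta> / 2"
        using ediff[OF z] norm_triangle_ineq order_trans add_mono by (metis (no_types, lifting))
      thus "norm (F z - e z) \<le> \<eta>0" using \<eta> by simp
    qed
  qed
qed

section \<open>Approximation of bounded functions on the strip\<close>

text \<open>This is \<open>tanh (z/2)\<close>, which maps the strip conformally onto the unit disc
  and fixes 0.\<close>

definition to_disc :: "complex \<Rightarrow> complex" where
  "to_disc z = (exp z - 1) / (exp z + 1)"

text \<open>This is \<open>2 * artanh w\<close>. For \<open>norm w < 1\<close> the argument of the
  logarithm lies in the right half-plane, away from the branch cut.\<close>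

definition from_disc :: "complex \<Rightarrow> complex" where
  "from_disc w = Ln ((1 + w) / (1 - w))"

lemma norm_exp_pm_1: 
  "(norm (exp z - 1))\<^sup>2 = (exp (Re z))\<^sup>2 - 2 * exp (Re z) * cos (Im z) + 1"
  "(norm (exp z + 1))\<^sup>2 = (exp (Re z))\<^sup>2 + 2 * exp (Re z) * cos (Im z) + 1"
proof -
  have e: "(exp (Re z))\<^sup>2 = (Re (exp z))\<^sup>2 + (Im (exp z))\<^sup>2"
    unfolding cmod_power2[symmetric] by simp
  show "(norm (exp z - 1))\<^sup>2 = (exp (Re z))\<^sup>2 - 2 * exp (Re z) * cos (Im z) + 1"
    unfolding e cmod_power2 by (simp add: Re_exp power2_eq_square algebra_simps)
  show "(norm (exp z + 1))\<^sup>2 = (exp (Re z))\<^sup>2 + 2 * exp (Re z) * cos (Im z) + 1"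
    unfolding e cmod_power2 by (simp add: Re_exp power2_eq_square algebra_simps)
qed

text \<open>\<open>|exp z + 1|^2 - s^2 * |exp z - 1|^2\<close> is estimated from below by
  \<open>2 * exp (Re z) \<le> exp (Re z)^2 + 1\<close>. For \<open>s = 1\<close> the condition is
  \<open>cos (Im z) > 0\<close>; for \<open>s < 1\<close> it tolerates slightly negative cosines, so
  a dilated function extends beyond the strip.\<close>

lemma norm_to_disc_less:
  assumes s: "0 \<le> s" and c: "(1 - s\<^sup>2) + cos (Im z) * (1 + s\<^sup>2) > 0" and s1: "s \<le> 1"
  shows "exp z + 1 \<noteq> 0" "norm (of_real s * to_disc z) < 1"
proof -
  have e: "2 * exp (Re z) \<le> (exp (Re z))\<^sup>2 + 1"
    using zero_le_power2[of "exp (Re z) - 1"] by (simp add: power2_eq_square algebra_simps)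
  have "0 < 2 * exp (Re z) * ((1 - s\<^sup>2) + cos (Im z) * (1 + s\<^sup>2))" using c by simp
  also have "\<dots> \<le> (1 - s\<^sup>2) * ((exp (Re z))\<^sup>2 + 1) + 2 * exp (Re z) * cos (Im z) * (1 + s\<^sup>2)"
    using mult_left_mono[OF e, of "1 - s\<^sup>2"] s s1 by (simp add: algebra_simps power_le_one)
  also have "\<dots> = (norm (exp z + 1))\<^sup>2 - s\<^sup>2 * (norm (exp z - 1))\<^sup>2"
    unfolding norm_exp_pm_1 by (simp add: algebra_simps)
  finally have l: "(s * norm (exp z - 1))\<^sup>2 < (norm (exp z + 1))\<^sup>2" by (simp add: power_mult_distrib)
  hence l': "s * norm (exp z - 1) < norm (exp z + 1)" by (rule power2_less_imp_less) simp
  show nz: "exp z + 1 \<noteq> 0"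
  proof
    assume "exp z + 1 = 0"
    hence "norm (exp z + 1) = 0" by simp
    thus False using l zero_le_power2[of "s * norm (exp z - 1)"] by simp
  qed
  show "norm (of_real s * to_disc z) < 1"
    using l' nz s unfolding to_disc_def by (simp add: norm_mult norm_divide)
qed

lemma strip_cos_pos: "z \<in> strip \<Longrightarrow> cos (Im z) > 0"
  by (auto simp: strip_def intro!: cos_gt_zero_pi)

lemma to_disc_in_ball: assumes "z \<in> strip" shows "norm (to_disc z) < 1" "exp z + 1 \<noteq> 0"
  using norm_to_disc_less[of 1 z] strip_cos_pos[OF assms] by simp_all

lemma holomorphic_to_disc: "to_disc holomorphic_on strip"
  unfolding to_disc_def by (intro holomorphic_intros) (use to_disc_in_ball in auto)

lemma half_plane_of_ball:
  assumes "norm w < 1" shows "Re ((1 + w) / (1 - w)) > 0" "1 - w \<noteq> 0"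
proof -
  show nz: "1 - w \<noteq> 0" using assms by auto
  have "Re ((1 + w) / (1 - w)) = Re ((1 + w) * cnj (1 - w)) / (norm (1 - w))\<^sup>2"
    by (subst complex_div_cnj) (simp add: Re_divide_of_real del: of_real_power)
  moreover have "Re ((1 + w) * cnj (1 - w)) = 1 - (norm w)\<^sup>2"
    unfolding cmod_power2 by (simp add: power2_eq_square algebra_simps)
  moreover have "(norm w)\<^sup>2 < 1" using assms by (simp add: power_less_one_iff abs_square_less_1)
  ultimately show "Re ((1 + w) / (1 - w)) > 0" using nz by simp
qed

lemma from_disc_in_strip:
  assumes "norm w < 1" shows "from_disc w \<in> strip"
proof -
  have "(1 + w) / (1 - w) \<noteq> 0" using half_plane_of_ball(1)[OF assms] by (metis less_irrefl zero_complex.sel(1))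
  hence "\<bar>Im (from_disc w)\<bar> < pi/2"
    using half_plane_of_ball(1)[OF assms] Re_Ln_pos_lt unfolding from_disc_def by blast
  thus ?thesis by (auto simp: strip_def abs_less_iff)
qed

lemma holomorphic_from_disc: "from_disc holomorphic_on ball 0 1"
proof -
  have "(1 + w) / (1 - w) \<notin> \<real>\<^sub>\<le>\<^sub>0" if "norm w < 1" for w :: complex
    using half_plane_of_ball(1)[OF that] by (auto simp: complex_nonpos_Reals_iff)
  thus ?thesis unfolding from_disc_def
    by (intro holomorphic_intros) (use half_plane_of_ball(2) in auto)
qed

lemma from_disc_to_disc:
  assumes "z \<in> strip" shows "from_disc (to_disc z) = z"
proof -
  have nz: "exp z + 1 \<noteq> 0" using to_disc_in_ball[OF assms] by simp
  have "1 + to_disc z = 2 * exp z / (exp z + 1)" "1 - to_disc z = 2 / (exp z + 1)"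
    using nz by (simp_all add: to_disc_def field_simps)
  hence "(1 + to_disc z) / (1 - to_disc z) = exp z" using nz by simp
  moreover have "Ln (exp z) = z" using assms pi_gt_zero by (intro Ln_exp) (auto simp: strip_def)
  ultimately show ?thesis by (simp add: from_disc_def)
qed

lemma to_disc_0: "to_disc 0 = 0" and from_disc_0: "from_disc 0 = 0"
  by (simp_all add: to_disc_def from_disc_def)

lemma holomorphic_to_disc_compose:
  "h holomorphic_on ball 0 1 \<Longrightarrow> (\<lambda>z. h (to_disc z)) holomorphic_on strip"
  using holomorphic_on_compose_gen[OF holomorphic_to_disc, of h "ball 0 1"] to_disc_in_ball
  by (auto simp: o_def image_subset_iff)

lemma holomorphic_from_disc_compose:
  "h holomorphic_on strip \<Longrightarrow> (\<lambda>w. h (from_disc w)) holomorphic_on ball 0 1"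
  using holomorphic_on_compose_gen[OF holomorphic_from_disc, of h strip] from_disc_in_strip
  by (auto simp: o_def image_subset_iff)

text \<open>Approximation errors are measured at 0, whereas a Riemann map may send the centre of the
  disc to another point \<open>z0\<close>. The constant depends on \<open>z0\<close> alone.\<close>

lemma harnack_strip:
  assumes "z0 \<in> strip"
  obtains K where "K > 0" "\<And>h. h holomorphic_on strip \<Longrightarrow> (\<And>z. z \<in> strip \<Longrightarrow> Re (h z) \<ge> 0) \<Longrightarrow> Re (h z0) \<le> K * Re (h 0)"
proof (rule that)
  let ?w = "to_disc z0"
  have w: "norm ?w < 1" by (rule to_disc_in_ball[OF assms])
  show "(3 + norm ?w) / (1 - norm ?w) > 0" using w by (intro divide_pos_pos add_pos_nonneg) auto
  fix h assume h: "h holomorphic_on strip" "\<And>z. z \<in> strip \<Longrightarrow> Re (h z) \<ge> 0"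
  have "Re (h (from_disc ?w)) \<le> (3 + norm ?w) / (1 - norm ?w) * Re (h (from_disc 0))"
    by (rule harnack_ball[OF holomorphic_from_disc_compose[OF h(1)] _ w]) (use h(2) from_disc_in_strip in auto)
  thus "Re (h z0) \<le> (3 + norm ?w) / (1 - norm ?w) * Re (h 0)" by (simp add: from_disc_to_disc assms from_disc_0)
qed

text \<open>The closure condition used for all approximation steps: uniformly bounded approximants whose
  errors have harmonic majorants that are small at 0. It needs no transitivity, because it is
  only ever applied to sets \<open>X\<close> that are closed under it.\<close>

definition approx_closed :: "(complex \<Rightarrow> complex) set \<Rightarrow> bool" where
  "approx_closed X \<longleftrightarrow> (\<forall>f\<in>Hinf strip.
     (\<exists>C. \<forall>\<eta>>0. \<exists>a\<in>X \<inter> Hinf strip. \<exists>h. h holomorphic_on strip \<and>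
        (\<forall>z\<in>strip. norm (a z) \<le> C \<and> (norm (f z - a z))\<^sup>2 \<le> Re (h z)) \<and> Re (h 0) \<le> \<eta>) \<longrightarrow> f \<in> X)"

lemma approx_closedD:
  assumes "approx_closed X" "f holomorphic_on strip" "\<And>z. z \<in> strip \<Longrightarrow> norm (f z) \<le> M"
    "\<And>\<eta>. \<eta> > 0 \<Longrightarrow> \<exists>a\<in>X. a holomorphic_on strip \<and> (\<exists>h. h holomorphic_on strip \<and>
        (\<forall>z\<in>strip. norm (a z) \<le> C \<and> (norm (f z - a z))\<^sup>2 \<le> Re (h z)) \<and> Re (h 0) \<le> \<eta>)"
  shows "f \<in> X"
proof -
  have "f \<in> Hinf strip" using assms(2,3) by (auto simp: Hinf_def bounded_iff)
  moreover have "\<exists>a\<in>X \<inter> Hinf strip. \<exists>h. h holomorphic_on strip \<and>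
        (\<forall>z\<in>strip. norm (a z) \<le> C \<and> (norm (f z - a z))\<^sup>2 \<le> Re (h z)) \<and> Re (h 0) \<le> \<eta>" if \<eta>: "\<eta> > 0" for \<eta>
  proof -
    obtain a h where a: "a \<in> X" "a holomorphic_on strip" "h holomorphic_on strip"
      "\<forall>z\<in>strip. norm (a z) \<le> C \<and> (norm (f z - a z))\<^sup>2 \<le> Re (h z)" "Re (h 0) \<le> \<eta>"
      using assms(4)[OF \<eta>] by blast
    have "a \<in> Hinf strip" using a(2,4) by (auto simp: Hinf_def bounded_iff)
    thus ?thesis using a by blast
  qed
  ultimately show ?thesis using assms(1) unfolding approx_closed_def by blast
qed

section \<open>A harmonic majorant for the far part of the strip\<close>

text \<open>The complement \<open>1 - N^2 / (N^2 + z^2)\<close> of the decaying factor. It vanishes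
  at 0, and after adding \<open>pi^2 / N^2\<close> its real part is nonnegative on the strip and at
  least 1/4 where \<open>|Re z| \<ge> N\<close>: an explicit substitute for harmonic measure of the
  two ends.\<close>

definition tail_fun :: "real \<Rightarrow> complex \<Rightarrow> complex" where
  "tail_fun N z = z\<^sup>2 / (of_real (N\<^sup>2) + z\<^sup>2)"

lemma tail_fun_denominator:
  assumes "(Im z)\<^sup>2 \<le> N\<^sup>2 / 2" "N > 0"
  shows "Re (of_real (N\<^sup>2) + z\<^sup>2) \<ge> (N\<^sup>2 + (Re z)\<^sup>2) / 2" "Re (of_real (N\<^sup>2) + z\<^sup>2) \<ge> N\<^sup>2 / 2"
    "of_real (N\<^sup>2) + z\<^sup>2 \<noteq> 0"
proof -
  have "Re (of_real (N\<^sup>2) + z\<^sup>2) = N\<^sup>2 + (Re z)\<^sup>2 - (Im z)\<^sup>2" by (simp add: power2_eq_square)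
  hence eq: "Re (of_real (N\<^sup>2) + z\<^sup>2) = N\<^sup>2 + (Re z)\<^sup>2 - (Im z)\<^sup>2" .
  show "Re (of_real (N\<^sup>2) + z\<^sup>2) \<ge> (N\<^sup>2 + (Re z)\<^sup>2) / 2"
  proof -
    have "(Im z)\<^sup>2 + 0 \<le> N\<^sup>2 / 2 + (Re z)\<^sup>2 / 2" by (rule add_mono[OF assms(1)]) simp
    thus ?thesis unfolding eq by (simp add: field_simps)
  qed
  show 1: "Re (of_real (N\<^sup>2) + z\<^sup>2) \<ge> N\<^sup>2 / 2"
    unfolding eq using assms(1) zero_le_power2[of "Re z"] by linarith
  have "N\<^sup>2 / 2 > 0" using assms by simp
  thus "of_real (N\<^sup>2) + z\<^sup>2 \<noteq> 0" using 1 by (metis less_le_trans not_less_iff_gr_or_eq zero_complex.sel(1))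
qed

lemma strip_Im_sq: "z \<in> strip \<Longrightarrow> N \<ge> 3 \<Longrightarrow> (Im z)\<^sup>2 \<le> N\<^sup>2 / 2" "z \<in> strip \<Longrightarrow> (Im z)\<^sup>2 \<le> pi\<^sup>2 / 4"
proof -
  assume z: "z \<in> strip"
  have "\<bar>Im z\<bar> \<le> pi/2" using z by (auto simp: strip_def)
  hence "\<bar>Im z\<bar>\<^sup>2 \<le> (pi/2)\<^sup>2" by (intro power_mono) auto
  thus 1: "(Im z)\<^sup>2 \<le> pi\<^sup>2 / 4" by (simp add: power_divide)
  assume N: "N \<ge> 3"
  have "pi\<^sup>2 \<le> 4\<^sup>2" using pi_less_4 by (intro power_mono) auto
  moreover have "3\<^sup>2 \<le> N\<^sup>2" using N by (intro power_mono) auto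
  ultimately show "(Im z)\<^sup>2 \<le> N\<^sup>2 / 2" using 1 by simp
qed

lemma holomorphic_tail_fun: "N \<ge> 3 \<Longrightarrow> tail_fun N holomorphic_on strip"
  unfolding tail_fun_def by (intro holomorphic_intros) (use tail_fun_denominator(3) strip_Im_sq(1) in auto)

text \<open>With \<open>J = N^2 + z^2\<close>, the squared modulus exceeds the real part by exactly
  \<open>N^2 * ((Im z)^2 - (Re z)^2) / |J|^2\<close>, and \<open>|J| \<ge> N^2 / 2\<close> bounds
  this by \<open>pi^2 / N^2\<close>. Far out \<open>|z| \<ge> N\<close> gives
  \<open>|J| \<le> 2 * |z|^2\<close>, so the modulus is at least 1/2.\<close>

lemma tail_fun_bounds:
  assumes z: "z \<in> strip" and N: "N \<ge> 3"
  shows "(norm (tail_fun N z))\<^sup>2 \<le> Re (tail_fun N z) + pi\<^sup>2 / N\<^sup>2"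
    "\<bar>Re z\<bar> \<ge> N \<Longrightarrow> 1/4 \<le> Re (tail_fun N z) + pi\<^sup>2 / N\<^sup>2"
    "0 \<le> Re (tail_fun N z) + pi\<^sup>2 / N\<^sup>2"
proof -
  define J where "J = of_real (N\<^sup>2) + z\<^sup>2"
  have N0: "N > 0" using N by simp
  note d = tail_fun_denominator[OF strip_Im_sq(1)[OF z N] N0, folded J_def]
  have J: "norm J \<ge> N\<^sup>2 / 2" using d(2) complex_Re_le_cmod order_trans by blast
  have R1: "Re (tail_fun N z) = Re (z\<^sup>2 * cnj J) / (norm J)\<^sup>2"
    unfolding tail_fun_def J_def[symmetric] by (subst complex_div_cnj) (simp add: Re_divide_of_real del: of_real_power)
  have R2: "Re (z\<^sup>2 * cnj J) = N\<^sup>2 * ((Re z)\<^sup>2 - (Im z)\<^sup>2) + (norm z)^4"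
  proof -
    have "(norm z)^4 = ((norm z)\<^sup>2)\<^sup>2" by simp
    also have "\<dots> = ((Re z)\<^sup>2 + (Im z)\<^sup>2)\<^sup>2" by (simp only: cmod_power2)
    finally show ?thesis unfolding J_def by (simp add: power2_eq_square algebra_simps)
  qed
  have R3: "(norm (tail_fun N z))\<^sup>2 = (norm z)^4 / (norm J)\<^sup>2"
    unfolding tail_fun_def J_def[symmetric] by (simp add: norm_divide norm_power power_divide flip: power_mult)
  have "(norm (tail_fun N z))\<^sup>2 = Re (tail_fun N z) + N\<^sup>2 * ((Im z)\<^sup>2 - (Re z)\<^sup>2) / (norm J)\<^sup>2"
    unfolding R3 R1 R2 add_divide_distrib[symmetric] by (simp add: algebra_simps)
  moreover have "N\<^sup>2 * ((Im z)\<^sup>2 - (Re z)\<^sup>2) / (norm J)\<^sup>2 \<le> N\<^sup>2 * (pi\<^sup>2 / 4) / (N\<^sup>2 / 2)\<^sup>2"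
  proof (rule frac_le)
    show "N\<^sup>2 * ((Im z)\<^sup>2 - (Re z)\<^sup>2) \<le> N\<^sup>2 * (pi\<^sup>2 / 4)"
      using strip_Im_sq(2)[OF z] zero_le_power2[of "Re z"] by (intro mult_left_mono) (linarith, simp)
    show "(N\<^sup>2 / 2)\<^sup>2 \<le> (norm J)\<^sup>2" using J by (intro power_mono) auto
  qed (use N0 in auto)
  moreover have "N\<^sup>2 * (pi\<^sup>2 / 4) / (N\<^sup>2 / 2)\<^sup>2 = pi\<^sup>2 / N\<^sup>2" using N0 by (simp add: field_simps power2_eq_square)
  ultimately show 1: "(norm (tail_fun N z))\<^sup>2 \<le> Re (tail_fun N z) + pi\<^sup>2 / N\<^sup>2" by simp
  thus "0 \<le> Re (tail_fun N z) + pi\<^sup>2 / N\<^sup>2" using zero_le_power2 order_trans by blast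
  assume x: "\<bar>Re z\<bar> \<ge> N"
  have "N \<le> norm z" using x abs_Re_le_cmod order_trans by blast
  hence "N\<^sup>2 \<le> (norm z)\<^sup>2" using N0 by (intro power_mono) auto
  moreover have "norm J \<le> N\<^sup>2 + (norm z)\<^sup>2"
    unfolding J_def using norm_triangle_ineq[of "of_real (N\<^sup>2)" "z\<^sup>2"] by (simp add: norm_power del: of_real_power)
  moreover have "norm J > 0" using d(3) by simp
  ultimately have "1/2 \<le> (norm z)\<^sup>2 / norm J" by (simp add: field_simps)
  hence "1/2 \<le> norm (tail_fun N z)" unfolding tail_fun_def J_def[symmetric] by (simp add: norm_divide norm_power)
  hence "(1/2)\<^sup>2 \<le> (norm (tail_fun N z))\<^sup>2" by (intro power_mono) auto
  hence "1/4 \<le> (norm (tail_fun N z))\<^sup>2" by (simp add: power_divide)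
  thus "1/4 \<le> Re (tail_fun N z) + pi\<^sup>2 / N\<^sup>2" using 1 by (rule order_trans)
qed

text \<open>The lower bound 7 ensures \<open>4^2 \<le> N^2 / 2\<close>, which keeps
  \<open>N^2 + z^2\<close> away from 0 on every strip of half-width at most
  \<open>pi < 4\<close>.\<close>

lemma tail_small:
  assumes "c \<ge> 0" "\<eta> > (0::real)"
  obtains N where "N \<ge> 7" "c * (pi\<^sup>2 / N\<^sup>2) \<le> \<eta>"
proof -
  define N where "N = max 7 (c * pi\<^sup>2 / \<eta>)"
  have N: "N \<ge> 7" "N \<ge> c * pi\<^sup>2 / \<eta>" by (auto simp: N_def)
  have "c * pi\<^sup>2 \<le> \<eta> * N" using N(2) assms by (simp add: field_simps)
  also have "\<dots> \<le> \<eta> * (N * N)" using assms N by (intro mult_left_mono) auto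
  finally have "c * (pi\<^sup>2 / N\<^sup>2) \<le> \<eta>" using N by (simp add: field_simps power2_eq_square)
  thus ?thesis using N that by blast
qed

section \<open>Bounded functions as limits of exponential sums\<close>

context
  fixes X assumes X: "exp_span \<subseteq> X" "approx_closed X"
begin

text \<open>Where \<open>|Re z| \<le> N\<close> the squared error is at most the constant
  \<open>\<eta>/2\<close>; elsewhere only the crude bound \<open>M + C\<close> is known, and the
  tail function majorizes its square at small cost at 0.\<close>

lemma approx_closed_decaying:
  assumes F: "F holomorphic_on wide_strip b" and b: "b > pi/2" and a: "a > 0"
    and M: "\<And>z. z \<in> wide_strip b \<Longrightarrow> norm (F z) \<le> M / (1 + (a * Re z)\<^sup>2)"
  shows "F \<in> X"
proof -
  have sub: "strip \<subseteq> wide_strip b" using strip_subset_wide_strip b by simp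
  have Mn: "M \<ge> 0" using order_trans[OF norm_ge_zero M[of 0]] sub zero_in_strip by auto
  have FM: "norm (F z) \<le> M" if "z \<in> strip" for z
  proof -
    have "norm (F z) \<le> M / 1"
      using Mn sub that by (intro order_trans[OF M] divide_left_mono) (auto intro: add_pos_nonneg)
    thus ?thesis by simp
  qed
  obtain C where C: "\<And>\<eta> R. \<eta> > 0 \<Longrightarrow> \<exists>e\<in>exp_span. (\<forall>z\<in>strip. norm (e z) \<le> C) \<and>
     (\<forall>z\<in>strip. \<bar>Re z\<bar> \<le> R \<longrightarrow> norm (F z - e z) \<le> \<eta>)"
    using exp_span_local_approximation[OF F b a M] by blast
  show ?thesis
  proof (rule approx_closedD[OF X(2) holomorphic_on_subset[OF F sub] FM])
    fix \<eta> :: real assume \<eta>: "\<eta> > 0"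
    \<comment> \<open>The factor 4 offsets the lower bound 1/4 of the tail majorant.\<close>
    define c where "c = 4 * (M + C)\<^sup>2"
    obtain N where N: "N \<ge> 7" "c * (pi\<^sup>2 / N\<^sup>2) \<le> \<eta>/2"
      using tail_small[of c "\<eta>/2"] \<eta> by (auto simp: c_def)
    have "sqrt (\<eta>/2) > 0" using \<eta> by simp
    then obtain e where e: "e \<in> exp_span" "\<forall>z\<in>strip. norm (e z) \<le> C"
      "\<forall>z\<in>strip. \<bar>Re z\<bar> \<le> N \<longrightarrow> norm (F z - e z) \<le> sqrt (\<eta>/2)"
      using C by meson
    have N3: "N \<ge> 3" using N by simp
    define h where "h = (\<lambda>z. of_real (\<eta>/2) + of_real c * (tail_fun N z + of_real (pi\<^sup>2 / N\<^sup>2)))"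
    have Reh: "Re (h z) = \<eta>/2 + c * (Re (tail_fun N z) + pi\<^sup>2 / N\<^sup>2)" for z by (simp add: h_def)
    have hh: "h holomorphic_on strip" unfolding h_def by (intro holomorphic_intros holomorphic_tail_fun N3)
    have "(norm (F z - e z))\<^sup>2 \<le> Re (h z)" if z: "z \<in> strip" for z
    proof (cases "\<bar>Re z\<bar> \<le> N")
      case True
      have "(norm (F z - e z))\<^sup>2 \<le> (sqrt (\<eta>/2))\<^sup>2" using e(3) z True by (intro power_mono) auto
      moreover have "0 \<le> c * (Re (tail_fun N z) + pi\<^sup>2 / N\<^sup>2)"
        using tail_fun_bounds(3)[OF z N3] by (intro mult_nonneg_nonneg) (auto simp: c_def)
      ultimately show ?thesis unfolding Reh using \<eta> by simp
    next
      case False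
      have "norm (F z - e z) \<le> M + C"
        using norm_triangle_ineq4[of "F z" "e z"] FM[OF z] e(2) z by fastforce
      hence "(norm (F z - e z))\<^sup>2 \<le> (M + C)\<^sup>2" by (intro power_mono) auto
      also have "\<dots> = c * (1/4)" by (simp add: c_def)
      also have "\<dots> \<le> c * (Re (tail_fun N z) + pi\<^sup>2 / N\<^sup>2)"
        using tail_fun_bounds(2)[OF z N3] False by (intro mult_left_mono) (auto simp: c_def)
      also have "\<dots> \<le> Re (h z)" unfolding Reh using \<eta> by simp
      finally show ?thesis .
    qed
    moreover have "Re (h 0) \<le> \<eta>"
    proof -
      have "Re (h 0) = \<eta>/2 + c * (pi\<^sup>2 / N\<^sup>2)" unfolding Reh by (simp add: tail_fun_def)
      thus ?thesis using N(2) by linarith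
    qed
    moreover have "e holomorphic_on strip" using e(1) exp_span_subset_Hinf by (auto simp: Hinf_def)
    ultimately show "\<exists>a\<in>X. a holomorphic_on strip \<and> (\<exists>h. h holomorphic_on strip \<and>
        (\<forall>z\<in>strip. norm (a z) \<le> C \<and> (norm (F z - a z))\<^sup>2 \<le> Re (h z)) \<and> Re (h 0) \<le> \<eta>)"
      using e X(1) hh by (intro bexI[of _ e] conjI exI[of _ h]) auto
  qed
qed

text \<open>Multiplication by \<open>N^2 / (N^2 + z^2)\<close> creates the decay, and the error is
  \<open>g\<close> times the tail function, whose squared modulus has a majorant that is small at 0.
  The 2 in the bound comes from \<open>Re (N^2 + z^2) \<ge> (N^2 + (Re z)^2) / 2\<close>.\<close>

lemma approx_closed_wide:
  assumes g: "g holomorphic_on wide_strip b" and b: "b > pi/2" "b \<le> pi"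
    and M: "\<And>z. z \<in> wide_strip b \<Longrightarrow> norm (g z) \<le> M"
  shows "g \<in> X"
proof -
  have sub: "strip \<subseteq> wide_strip b" using strip_subset_wide_strip b by simp
  have Mn: "M \<ge> 0" using order_trans[OF norm_ge_zero M[of 0]] sub zero_in_strip by auto
  have wide: "(Im z)\<^sup>2 \<le> N\<^sup>2 / 2" if "z \<in> wide_strip b" "N \<ge> 7" for z N
  proof -
    have "\<bar>Im z\<bar> \<le> 4" using that b pi_less_4 by (auto simp: wide_strip_def)
    hence "\<bar>Im z\<bar>\<^sup>2 \<le> 4\<^sup>2" by (intro power_mono) auto
    moreover have "7\<^sup>2 \<le> N\<^sup>2" using that by (intro power_mono) auto
    ultimately show ?thesis by simp
  qed
  show ?thesis
  proof (rule approx_closedD[OF X(2) holomorphic_on_subset[OF g sub]])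
    show "norm (g z) \<le> M" if "z \<in> strip" for z using M sub that by auto
    fix \<eta> :: real assume \<eta>: "\<eta> > 0"
    obtain N where N: "N \<ge> 7" "M\<^sup>2 * (pi\<^sup>2 / N\<^sup>2) \<le> \<eta>" using tail_small[of "M\<^sup>2" \<eta>] \<eta> by auto
    have N3: "N \<ge> 3" "N > 0" using N by simp_all
    define G where "G = (\<lambda>z. g z * (of_real (N\<^sup>2) / (of_real (N\<^sup>2) + z\<^sup>2)))"
    have nz: "of_real (N\<^sup>2) + z\<^sup>2 \<noteq> 0" if "z \<in> wide_strip b" for z
      by (rule tail_fun_denominator(3)[OF wide[OF that N(1)] N3(2)])
    have Gh: "G holomorphic_on wide_strip b" unfolding G_def
      by (intro holomorphic_intros g) (use nz in auto)
    have GM: "norm (G z) \<le> 2 * M / (1 + (1/N * Re z)\<^sup>2)" if z: "z \<in> wide_strip b" for z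
    proof -
      have "(N\<^sup>2 + (Re z)\<^sup>2) / 2 \<le> norm (of_real (N\<^sup>2) + z\<^sup>2)"
        using tail_fun_denominator(1)[OF wide[OF z N(1)] N3(2)] complex_Re_le_cmod order_trans by blast
      hence "norm (G z) \<le> M * (N\<^sup>2 / ((N\<^sup>2 + (Re z)\<^sup>2) / 2))"
        unfolding G_def norm_mult norm_divide using M[OF z] N3 Mn
        by (intro mult_mono frac_le) (auto intro!: divide_nonneg_nonneg add_pos_nonneg simp: norm_power)
      also have "N\<^sup>2 / ((N\<^sup>2 + (Re z)\<^sup>2) / 2) = 2 / (1 + (1/N * Re z)\<^sup>2)"
        using N3 by (simp add: field_simps power2_eq_square)
      finally show ?thesis by (simp add: mult.commute)
    qed
    have GX: "G \<in> X" by (rule approx_closed_decaying[OF Gh b(1) _ GM]) (use N3 in auto)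
    define h where "h = (\<lambda>z. of_real (M\<^sup>2) * (tail_fun N z + of_real (pi\<^sup>2 / N\<^sup>2)))"
    have Reh: "Re (h z) = M\<^sup>2 * (Re (tail_fun N z) + pi\<^sup>2 / N\<^sup>2)" for z by (simp add: h_def del: of_real_power)
    have hh: "h holomorphic_on strip" unfolding h_def by (intro holomorphic_intros holomorphic_tail_fun N3)
    have "norm (G z) \<le> 2 * M \<and> (norm (g z - G z))\<^sup>2 \<le> Re (h z)" if z: "z \<in> strip" for z
    proof
      have zw: "z \<in> wide_strip b" using z sub by auto
      have "2 * M / (1 + (1/N * Re z)\<^sup>2) \<le> 2 * M / 1" using Mn by (intro divide_left_mono) (auto intro: add_pos_nonneg)
      thus "norm (G z) \<le> 2 * M" using GM[OF zw] by simp
      have "g z - G z = g z * tail_fun N z"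
        using nz[OF zw] unfolding G_def tail_fun_def by (simp add: field_simps)
      hence "(norm (g z - G z))\<^sup>2 = (norm (g z))\<^sup>2 * (norm (tail_fun N z))\<^sup>2" by (simp add: norm_mult power_mult_distrib)
      also have "\<dots> \<le> M\<^sup>2 * (Re (tail_fun N z) + pi\<^sup>2 / N\<^sup>2)"
        by (intro mult_mono power_mono M zw tail_fun_bounds(1) z N3) auto
      finally show "(norm (g z - G z))\<^sup>2 \<le> Re (h z)" unfolding Reh .
    qed
    moreover have "Re (h 0) \<le> \<eta>" unfolding Reh using N(2) by (simp add: tail_fun_def)
    ultimately show "\<exists>a\<in>X. a holomorphic_on strip \<and> (\<exists>h. h holomorphic_on strip \<and>
        (\<forall>z\<in>strip. norm (a z) \<le> 2 * M \<and> (norm (g z - a z))\<^sup>2 \<le> Re (h z)) \<and> Re (h 0) \<le> \<eta>)"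
      using GX hh holomorphic_on_subset[OF Gh sub] by (intro bexI[of _ G] conjI exI[of _ h]) auto
  qed
qed

theorem approx_closed_Hinf: "Hinf strip \<subseteq> X"
proof
  fix f assume "f \<in> Hinf strip"
  then obtain M where f: "f holomorphic_on strip" and M: "\<And>z. z \<in> strip \<Longrightarrow> norm (f z) \<le> M"
    by (auto simp: Hinf_def bounded_iff)
  define F where "F = (\<lambda>w. f (from_disc w))"
  have F: "F holomorphic_on ball 0 1" unfolding F_def by (rule holomorphic_from_disc_compose[OF f])
  have FM: "norm (F w) \<le> M" if "norm w < 1" for w unfolding F_def by (intro M from_disc_in_strip that)
  show "f \<in> X"
  proof (rule approx_closedD[OF X(2) f M])
    fix \<eta> :: real assume \<eta>: "\<eta> > 0"
    obtain s where s: "0 < s" "s < 1" "\<And>r. 0 < r \<Longrightarrow> r < 1 \<Longrightarrow>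
       circle_mean r (\<lambda>w. norm (F w - F (of_real s * w)) powr 2) \<le> \<eta>"
      using dilation_converges_H2[OF F FM \<eta>] by (metis order_refl)
    have dh: "(\<lambda>w. F w - F (of_real s * w)) holomorphic_on ball 0 1"
      by (intro holomorphic_intros F holomorphic_on_dilate(1) s)
    obtain h where h: "h holomorphic_on ball 0 1" "Re (h 0) \<le> \<eta>"
      "\<And>w. norm w < 1 \<Longrightarrow> norm (F w - F (of_real s * w)) powr 2 \<le> Re (h w)"
      using holomorphic_majorant_of_means[OF dh _ s(3)] by auto
    define g where "g = (\<lambda>z. F (of_real s * to_disc z))"
    \<comment> \<open>The value \<open>-k\<close> of the cosine is critical: there
      \<open>(1 - s^2) + cos (Im z) * (1 + s^2)\<close> vanishes. Half of it keeps the expression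
      positive and, being negative, gives a half-width \<open>b\<close> above
      \<open>pi/2\<close>.\<close>
    define k where "k = (1 - s\<^sup>2) / (1 + s\<^sup>2)"
    define y where "y = - k / 2"
    have s2: "0 < s\<^sup>2" "s\<^sup>2 < 1" using s by (auto simp: power_less_one_iff abs_square_less_1)
    have y: "-1 < y" "y < 0" "(1 - s\<^sup>2) + y * (1 + s\<^sup>2) > 0"
    proof -
      have k: "0 < k" "k < 1" "k * (1 + s\<^sup>2) = 1 - s\<^sup>2" 
        using s2 add_pos_pos[OF zero_less_one s2(1)] less_irrefl by (simp_all add: k_def field_simps del: zero_less_power2)
      show "-1 < y" "y < 0" using k(1,2) by (simp_all add: y_def)
      have "y * (1 + s\<^sup>2) = - ((1 - s\<^sup>2) / 2)" using k(3) by (simp add: y_def)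
      thus "(1 - s\<^sup>2) + y * (1 + s\<^sup>2) > 0" using s2 by simp
    qed
    define b where "b = arccos y"
    have b: "pi/2 < b" "b < pi" "cos b = y"
      using arccos_less_mono[of 0 y] arccos_less_mono[of y "-1"] y by (auto simp: b_def)
    have cosw: "(1 - s\<^sup>2) + cos (Im z) * (1 + s\<^sup>2) > 0" if "z \<in> wide_strip b" for z
    proof -
      \<comment> \<open>The cosine is even and decreasing on the interval from 0 to
        \<open>pi\<close>.\<close>
      have "cos b \<le> cos \<bar>Im z\<bar>" using that b by (intro cos_monotone_0_pi_le) (auto simp: wide_strip_def)
      hence "y \<le> cos (Im z)" using b by simp
      hence "y * (1 + s\<^sup>2) \<le> cos (Im z) * (1 + s\<^sup>2)" using s2 by (intro mult_right_mono) auto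
      thus ?thesis using y(3) by linarith
    qed
    have s': "0 \<le> s" "s \<le> 1" using s by auto
    note td = norm_to_disc_less[OF s'(1) cosw s'(2)]
    have "(\<lambda>z. of_real s * to_disc z) holomorphic_on wide_strip b"
      unfolding to_disc_def by (intro holomorphic_intros) (use td(1) in auto)
    hence "F \<circ> (\<lambda>z. of_real s * to_disc z) holomorphic_on wide_strip b"
      by (rule holomorphic_on_compose_gen[OF _ F]) (use td(2) in auto)
    hence gh: "g holomorphic_on wide_strip b" by (simp add: g_def o_def)
    have gM: "norm (g z) \<le> M" if "z \<in> wide_strip b" for z unfolding g_def by (intro FM td(2) that)
    have gX: "g \<in> X" using approx_closed_wide[OF gh b(1) _ gM] b(2) by simp
    have sub: "strip \<subseteq> wide_strip b" using strip_subset_wide_strip b by simp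
    have "norm (g z) \<le> M \<and> (norm (f z - g z))\<^sup>2 \<le> Re (h (to_disc z))" if z: "z \<in> strip" for z
      using gM[of z] h(3)[OF to_disc_in_ball(1)[OF z]] z sub
      by (auto simp: F_def g_def from_disc_to_disc powr_numeral)
    moreover have "Re (h (to_disc 0)) \<le> \<eta>" using h(2) by (simp add: to_disc_0)
    ultimately show "\<exists>a\<in>X. a holomorphic_on strip \<and> (\<exists>h. h holomorphic_on strip \<and>
        (\<forall>z\<in>strip. norm (a z) \<le> M \<and> (norm (f z - a z))\<^sup>2 \<le> Re (h z)) \<and> Re (h 0) \<le> \<eta>)"
      using gX holomorphic_on_subset[OF gh sub] holomorphic_to_disc_compose[OF h(1)]
      by (intro bexI[of _ g] conjI exI[of _ "\<lambda>z. h (to_disc z)"]) auto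
  qed
qed

end

section \<open>Radial limits of bounded holomorphic functions\<close>

text \<open>Monotone convergence: the sum of the norms has a finite integral and is therefore finite
  almost everywhere.\<close>

lemma AE_summable_of_integrals:
  fixes D :: "nat \<Rightarrow> real \<Rightarrow> 'a::euclidean_space"
  assumes D: "\<And>j. continuous_on {a..b} (D j)" and bd: "\<And>j. integral {a..b} (\<lambda>t. norm (D j t)) \<le> c j"
    and c: "summable c" "\<And>j. c j \<ge> 0"
  shows "AE t in lebesgue_on {a..b}. summable (\<lambda>j. norm (D j t))"
proof -
  let ?L = "lebesgue_on {a..b}"
  have int: "integrable ?L (\<lambda>t. norm (D j t))" for j
    by (intro continuous_imp_integrable_real continuous_intros D)
  have "(\<integral>\<^sup>+t. (\<Sum>j. ennreal (norm (D j t))) \<partial>?L) = (\<Sum>j. \<integral>\<^sup>+t. ennreal (norm (D j t)) \<partial>?L)"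
    by (rule nn_integral_suminf) (use int in auto)
  also have "\<dots> \<le> (\<Sum>j. ennreal (c j))"
  proof (rule suminf_le)
    fix j
    have "(\<integral>\<^sup>+t. ennreal (norm (D j t)) \<partial>?L) = ennreal (integral\<^sup>L ?L (\<lambda>t. norm (D j t)))"
      by (rule nn_integral_eq_integral[OF int]) auto
    also have "integral\<^sup>L ?L (\<lambda>t. norm (D j t)) = integral {a..b} (\<lambda>t. norm (D j t))"
      by (rule lebesgue_integral_eq_integral[OF int]) auto
    finally show "(\<integral>\<^sup>+t. ennreal (norm (D j t)) \<partial>?L) \<le> ennreal (c j)" using bd by (simp add: ennreal_leI)
  qed auto
  also have "\<dots> = ennreal (\<Sum>j. c j)" using c by (intro suminf_ennreal2)
  also have "\<dots> < \<infinity>" by simp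
  finally have "(\<integral>\<^sup>+t. (\<Sum>j. ennreal (norm (D j t))) \<partial>?L) \<noteq> \<infinity>" by simp
  hence "AE t in ?L. (\<Sum>j. ennreal (norm (D j t))) \<noteq> \<infinity>"
    by (intro nn_integral_noteq_infinite) (use int in auto)
  thus ?thesis
    by eventually_elim (auto intro: summable_suminf_not_top)
qed

text \<open>The radii are chosen so close to 1 that consecutive differences are summable in L^1.
  Limits along one sequence are enough to represent the boundary function of a primitive as an
  integral; full radial limits follow from that.\<close>

lemma exists_boundary_limits_along_sequence:
  assumes G: "G holomorphic_on ball 0 1" and M: "\<And>w. norm w < 1 \<Longrightarrow> norm (G w) \<le> M"
  obtains \<rho> :: "nat \<Rightarrow> real" and N where "\<And>n. 0 < \<rho> n" "\<And>n. \<rho> n < 1" "\<rho> \<longlonglongrightarrow> 1" "negligible N"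
    "\<And>t. t \<in> {0..2*pi} - N \<Longrightarrow> convergent (\<lambda>n. G (of_real (\<rho> n) * cis t))"
proof -
  have "\<exists>s0. 0 < s0 \<and> s0 < 1 \<and> (\<forall>s r. s0 \<le> s \<longrightarrow> s < 1 \<longrightarrow> 0 < r \<longrightarrow> r < 1 \<longrightarrow>
       circle_mean r (\<lambda>w. norm (G w - G (of_real s * w)) powr 2) \<le> (1/4)^j)" for j
  proof -
    have "(1/4::real)^j > 0" by simp
    from dilation_converges_H2[OF G M this] show ?thesis by (smt (verit))
  qed
  then obtain s0 where s0: "\<And>j. 0 < s0 j" "\<And>j. s0 j < 1"
    "\<And>j s r. s0 j \<le> s \<Longrightarrow> s < 1 \<Longrightarrow> 0 < r \<Longrightarrow> r < 1 \<Longrightarrow>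
       circle_mean r (\<lambda>w. norm (G w - G (of_real s * w)) powr 2) \<le> (1/4)^j" by metis
  \<comment> \<open>The second entry forces convergence to 1. The running maximum taken next makes
    the radii nondecreasing, so that each is a dilation of its successor.\<close>
  define a where "a = (\<lambda>j. max (s0 j) (1 - 1 / (real j + 2)))"
  define \<rho> where "\<rho> = (\<lambda>j. Max (a ` {..j}))"
  have a1: "a j < 1" "0 < a j" for j using s0(1,2)[of j] by (auto simp: a_def less_max_iff_disj)
  have \<rho>1: "\<rho> j < 1" for j unfolding \<rho>_def using a1 by (subst Max_less_iff) auto
  have \<rho>a: "a j \<le> \<rho> j" for j unfolding \<rho>_def by (intro Max_ge) auto
  have \<rho>0: "0 < \<rho> j" for j using \<rho>a[of j] a1(2)[of j] by linarith
  have \<rho>mono: "\<rho> j \<le> \<rho> (Suc j)" for j unfolding \<rho>_def by (intro Max_mono) auto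
  have \<rho>lim: "\<rho> \<longlonglongrightarrow> 1"
  proof (rule tendsto_sandwich[OF _ _ _ tendsto_const])
    show "(\<lambda>j. 1 - 1 / (real j + 2)) \<longlonglongrightarrow> 1" by real_asymp
    have "1 - 1 / (real j + 2) \<le> \<rho> j" for j using \<rho>a[of j] unfolding a_def by linarith
    thus "\<forall>\<^sub>F j in sequentially. 1 - 1 / (real j + 2) \<le> \<rho> j" by simp
    show "\<forall>\<^sub>F j in sequentially. \<rho> j \<le> 1" by (simp add: less_imp_le[OF \<rho>1])
  qed
  define D where "D = (\<lambda>j t. G (of_real (\<rho> (Suc j)) * cis t) - G (of_real (\<rho> j) * cis t))"
  have cG: "continuous_on A (\<lambda>t. G (of_real (\<rho> j) * cis t))" for j A
    by (rule continuous_on_compose2[OF holomorphic_on_imp_continuous_on[OF G]])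
       (use \<rho>0 \<rho>1 in \<open>auto intro!: continuous_intros simp: norm_mult abs_of_pos\<close>)
  have cD: "continuous_on A (D j)" for j A unfolding D_def by (intro continuous_intros cG)
  have D2: "integral {0..2*pi} (\<lambda>t. (norm (D j t))\<^sup>2) \<le> 2 * pi * (1/4)^j" for j
  proof (cases "\<rho> j = \<rho> (Suc j)")
    case True
    thus ?thesis by (simp add: D_def)
  next
    case False
    \<comment> \<open>Since \<open>\<rho> (Suc j) < 1\<close>, this ratio is at least
      \<open>\<rho> j\<close> and hence at least \<open>s0 j\<close>, as the dilation estimate
      demands.\<close>
    define s where "s = \<rho> j / \<rho> (Suc j)"
    have s: "s < 1" using False \<rho>mono[of j] \<rho>0[of "Suc j"] by (simp add: s_def)
    have "\<rho> j * \<rho> (Suc j) \<le> \<rho> j * 1" using \<rho>0[of j] \<rho>1[of "Suc j"] by (intro mult_left_mono) auto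
    hence "\<rho> j \<le> s" using \<rho>0[of "Suc j"] by (simp add: s_def field_simps)
    moreover have "s0 j \<le> \<rho> j" using \<rho>a[of j] by (simp add: a_def)
    ultimately have "circle_mean (\<rho> (Suc j)) (\<lambda>w. norm (G w - G (of_real s * w)) powr 2) \<le> (1/4)^j"
      by (intro s0(3) s \<rho>0 \<rho>1) auto
    moreover have "of_real s * (of_real (\<rho> (Suc j)) * w) = of_real (\<rho> j) * w" for w :: complex
      using \<rho>0[of "Suc j"] by (simp add: s_def)
    ultimately have "integral {0..2*pi} (\<lambda>t. (norm (D j t))\<^sup>2) / (2*pi) \<le> (1/4)^j"
      unfolding circle_mean_def D_def by (simp only: powr_numeral norm_ge_zero)
    thus ?thesis by (simp add: field_simps)
  qed
  have D1: "integral {0..2*pi} (\<lambda>t. norm (D j t)) \<le> 2 * pi * (1/2)^j" for j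
  proof -
    have "integral {0..2*pi} (\<lambda>t. norm (D j t)) \<le> integral {0..2*pi} (\<lambda>t. (1/2)^j / 2 + 2^j / 2 * (norm (D j t))\<^sup>2)"
    proof (rule integral_le)
      fix t
      \<comment> \<open>The weight \<open>2^j\<close> balances the L^2 bound \<open>(1/4)^j\<close>,
        so that both terms contribute equally, of order \<open>(1/2)^j\<close>.\<close>
      have "0 \<le> 2^j / 2 * (norm (D j t) - (1/2)^j)\<^sup>2" by simp
      also have "\<dots> = (1/2)^j / 2 + 2^j / 2 * (norm (D j t))\<^sup>2 - norm (D j t)"
        by (simp add: power2_eq_square algebra_simps power_one_over)
      finally show "norm (D j t) \<le> (1/2)^j / 2 + 2^j / 2 * (norm (D j t))\<^sup>2" by simp
    qed (intro integrable_continuous_interval continuous_intros cD)+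
    also have "\<dots> = 2 * pi * (1/2)^j / 2 + 2^j / 2 * integral {0..2*pi} (\<lambda>t. (norm (D j t))\<^sup>2)"
      by (subst integral_add) (auto intro!: integrable_continuous_interval continuous_intros cD)
    also have "\<dots> \<le> 2 * pi * (1/2)^j / 2 + 2^j / 2 * (2 * pi * (1/4)^j)"
      by (intro add_left_mono mult_left_mono D2) auto
    also have "2^j / 2 * (2 * pi * (1/4)^j) = 2 * pi * (1/2)^j / 2"
      by (simp add: power_one_over power_mult_distrib[symmetric] field_simps flip: power_mult)
    finally show ?thesis by simp
  qed
  have "AE t in lebesgue_on {0..2*pi}. summable (\<lambda>j. norm (D j t))"
    by (rule AE_summable_of_integrals[OF cD D1]) (auto intro!: summable_mult summable_geometric)
  hence "AE t in lebesgue. t \<in> {0..2*pi} \<longrightarrow> summable (\<lambda>j. norm (D j t))"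
    by (subst (asm) AE_restrict_space_iff) auto
  then obtain N where N: "N \<in> null_sets lebesgue" "{t. \<not> (t \<in> {0..2*pi} \<longrightarrow> summable (\<lambda>j. norm (D j t)))} \<subseteq> N"
    by (auto simp: eventually_ae_filter)
  show ?thesis
  proof (rule that[OF \<rho>0 \<rho>1 \<rho>lim, of N])
    show "negligible N" using N by (simp add: negligible_iff_null_sets)
    fix t assume "t \<in> {0..2*pi} - N"
    hence "summable (\<lambda>j. norm (D j t))" using N(2) by blast
    hence "summable (\<lambda>j. D j t)" by (rule summable_norm_cancel)
    hence "convergent (\<lambda>n. \<Sum>j<n. D j t)" by (simp add: summable_iff_convergent)
    moreover have "(\<Sum>j<n. D j t) = G (of_real (\<rho> n) * cis t) - G (of_real (\<rho> 0) * cis t)" for n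
      unfolding D_def by (rule sum_lessThan_telescope)
    ultimately have "convergent (\<lambda>n. G (of_real (\<rho> n) * cis t) - G (of_real (\<rho> 0) * cis t))" by simp
    thus "convergent (\<lambda>n. G (of_real (\<rho> n) * cis t))" by (simp add: convergent_diff_const_right_iff)
  qed
qed

section \<open>Boundary values of a primitive\<close>

lemma lipschitz_primitive_extension:
  assumes G: "G holomorphic_on ball 0 1" and M: "\<And>w. norm w < 1 \<Longrightarrow> norm (G w) \<le> M"
  obtains g where "continuous_on (cball 0 1) g" "\<And>w. norm w < 1 \<Longrightarrow> (g has_field_derivative G w) (at w)"
proof -
  have M0: "M \<ge> 0" using order_trans[OF norm_ge_zero M[of 0]] by simp
  obtain p where p: "\<And>x. x \<in> ball 0 1 \<Longrightarrow> (p has_field_derivative G x) (at x within ball 0 1)"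
    using holomorphic_convex_primitive'[OF convex_ball open_ball G] by blast
  have "M-lipschitz_on (ball 0 1) p"
  proof (rule bounded_derivative_imp_lipschitz[OF _ convex_ball])
    fix x :: complex assume x: "x \<in> ball 0 1"
    show "(p has_derivative (\<lambda>h. G x * h)) (at x within ball 0 1)"
      using p[OF x] by (simp add: has_field_derivative_def)
    show "onorm (\<lambda>h. G x * h) \<le> M"
      using x M[of x] by (intro onorm_le) (auto simp: norm_mult intro!: mult_right_mono)
  qed (rule M0)
  hence uc: "uniformly_continuous_on (ball 0 1) p" by (rule lipschitz_on_uniformly_continuous)
  obtain g where g: "uniformly_continuous_on (closure (ball 0 1)) g" "\<And>x. x \<in> ball 0 1 \<Longrightarrow> p x = g x"
  proof (rule uniformly_continuous_on_extension_on_closure[OF uc])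
    fix g assume "uniformly_continuous_on (closure (ball 0 1)) g" "\<And>x. x \<in> ball 0 1 \<Longrightarrow> p x = g x"
    thus ?thesis by (rule that)
  qed
  show ?thesis
  proof (rule that[of g])
    show "continuous_on (cball 0 1) g" using uniformly_continuous_imp_continuous[OF g(1)] by simp
    fix w :: complex assume "norm w < 1"
    hence w: "w \<in> ball 0 1" by simp
    have "(p has_field_derivative G w) (at w)" using p[OF w] unfolding at_within_open[OF w open_ball] .
    thus "(g has_field_derivative G w) (at w)"
      by (rule has_field_derivative_transform_within_open[OF _ open_ball w]) (use g in auto)
  qed
qed

text \<open>The library's differentiation theorem is one-sided; the other side follows by reflection.\<close>

lemma indefinite_integral_differentiable_ae:
  fixes f :: "real \<Rightarrow> complex"
  assumes f: "\<And>a b. f integrable_on {a..b}"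
  obtains N where "negligible N"
    "\<And>x e. x \<notin> N \<Longrightarrow> e > 0 \<Longrightarrow> \<exists>d>0. \<forall>h. 0 < h \<and> h < d \<longrightarrow>
       norm (integral {x..x+h} f - of_real h * f x) \<le> e * h \<and> norm (integral {x-h..x} f - of_real h * f x) \<le> e * h"
proof -
  have conv: "norm (I - of_real h * y) \<le> e * h" if "norm (I /\<^sub>R h - y) < e" "h > 0" for I y :: complex and e h :: real
  proof -
    have "I - of_real h * y = of_real h * (I /\<^sub>R h - y)" using that by (simp add: scaleR_conv_of_real field_simps)
    hence "norm (I - of_real h * y) = h * norm (I /\<^sub>R h - y)" using that by (simp add: norm_mult)
    thus ?thesis using that by (simp add: mult.commute mult_left_mono)
  qed
  obtain N1 where N1: "negligible N1" "\<And>x e. \<lbrakk>x \<notin> N1; 0 < e\<rbrakk> \<Longrightarrow>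
     \<exists>d>0. \<forall>h. 0 < h \<and> h < d \<longrightarrow> norm (integral (cbox x (x + h *\<^sub>R One)) f /\<^sub>R h ^ DIM(real) - f x) < e"
  proof (rule integrable_ccontinuous_explicit[of f])
    show "f integrable_on cbox a b" for a b using f by (simp add: box_real)
    fix N assume "negligible N" "\<And>x e. \<lbrakk>x \<notin> N; 0 < e\<rbrakk> \<Longrightarrow>
     \<exists>d>0. \<forall>h. 0 < h \<and> h < d \<longrightarrow> norm (integral (cbox x (x + h *\<^sub>R One)) f /\<^sub>R h ^ DIM(real) - f x) < e"
    thus ?thesis by (rule that)
  qed
  have fm: "(\<lambda>x. f (- x)) integrable_on {a..b}" for a b
    using f[of "-b" "-a"] Henstock_Kurzweil_Integration.integrable_reflect_real[where f=f and a="-b" and b="-a"] by simp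
  obtain N2 where N2: "negligible N2" "\<And>x e. \<lbrakk>x \<notin> N2; 0 < e\<rbrakk> \<Longrightarrow>
     \<exists>d>0. \<forall>h. 0 < h \<and> h < d \<longrightarrow> norm (integral (cbox x (x + h *\<^sub>R One)) (\<lambda>x. f (- x)) /\<^sub>R h ^ DIM(real) - f (- x)) < e"
  proof (rule integrable_ccontinuous_explicit[of "\<lambda>x. f (- x)"])
    show "(\<lambda>x. f (- x)) integrable_on cbox a b" for a b using fm by (simp add: box_real)
    fix N assume "negligible N" "\<And>x e. \<lbrakk>x \<notin> N; 0 < e\<rbrakk> \<Longrightarrow>
     \<exists>d>0. \<forall>h. 0 < h \<and> h < d \<longrightarrow> norm (integral (cbox x (x + h *\<^sub>R One)) (\<lambda>x. f (- x)) /\<^sub>R h ^ DIM(real) - f (- x)) < e"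
    thus ?thesis by (rule that)
  qed
  show ?thesis
  proof (rule that[of "N1 \<union> uminus ` N2"])
    have "negligible (uminus ` N2)"
      by (rule negligible_differentiable_image_negligible[OF _ N2(1)]) (auto intro!: derivative_intros)
    thus "negligible (N1 \<union> uminus ` N2)" using N1(1) by simp
    fix x e :: real assume x: "x \<notin> N1 \<union> uminus ` N2" and e: "e > 0"
    have "- x \<notin> N2" using x by force
    from N2(2)[OF this e] obtain d2 where d2: "d2 > 0"
      "\<And>h. 0 < h \<Longrightarrow> h < d2 \<Longrightarrow> norm (integral {-x..-x+h} (\<lambda>x. f (- x)) /\<^sub>R h - f x) < e" by auto
    obtain d1 where d1: "d1 > 0"
      "\<And>h. 0 < h \<Longrightarrow> h < d1 \<Longrightarrow> norm (integral {x..x+h} f /\<^sub>R h - f x) < e" using N1(2)[of x e] x e by auto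
    have refl: "integral {-x..-x+h} (\<lambda>x. f (- x)) = integral {x-h..x} f" for h
      using Henstock_Kurzweil_Integration.integral_reflect_real[of x "x-h" f] by simp
    show "\<exists>d>0. \<forall>h. 0 < h \<and> h < d \<longrightarrow>
       norm (integral {x..x+h} f - of_real h * f x) \<le> e * h \<and> norm (integral {x-h..x} f - of_real h * f x) \<le> e * h"
      by (rule exI[of _ "min d1 d2"]) (use d1 d2 conv refl in auto)
  qed
qed

text \<open>The tangential derivatives of \<open>g\<close> on the circles of radius
  \<open>\<rho> n\<close> are bounded and converge almost everywhere to some \<open>f\<close>. By
  dominated convergence \<open>g (cis t)\<close> is an indefinite integral of \<open>f\<close>, and
  Lebesgue's differentiation theorem applies.\<close>

lemma boundary_primitive_differentiable_ae:
  assumes G: "G holomorphic_on ball 0 1" and M: "\<And>w. norm w < 1 \<Longrightarrow> norm (G w) \<le> M"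
    and g: "continuous_on (cball 0 1) g" "\<And>w. norm w < 1 \<Longrightarrow> (g has_field_derivative G w) (at w)"
  obtains N where "negligible N"
    "\<And>t. t \<in> {0..2*pi} - N \<Longrightarrow> 0 < t \<and> t < 2*pi \<and> (\<exists>A. ((\<lambda>t. g (cis t)) has_vector_derivative A) (at t))"
proof -
  obtain \<rho> :: "nat \<Rightarrow> real" and N where \<rho>: "\<And>n. 0 < \<rho> n" "\<And>n. \<rho> n < 1" "\<rho> \<longlonglongrightarrow> 1" and N: "negligible N"
    "\<And>t. t \<in> {0..2*pi} - N \<Longrightarrow> convergent (\<lambda>n. G (of_real (\<rho> n) * cis t))"
  proof (rule exists_boundary_limits_along_sequence[OF G M])
    fix \<rho> :: "nat \<Rightarrow> real" and N
    assume "\<And>n. 0 < \<rho> n" "\<And>n. \<rho> n < 1" "\<rho> \<longlonglongrightarrow> 1" "negligible N"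
      "\<And>t. t \<in> {0..2*pi} - N \<Longrightarrow> convergent (\<lambda>n. G (of_real (\<rho> n) * cis t))"
    thus ?thesis by (rule that)
  qed
  have M0: "M \<ge> 0" using order_trans[OF norm_ge_zero M[of 0]] by simp
  define q where "q = (\<lambda>n t. G (of_real (\<rho> n) * cis t) * of_real (\<rho> n) * \<i> * cis t)"
  define S where "S = {0..2*pi} - N"
  \<comment> \<open>Setting the functions to 0 on the exceptional set makes the convergence hold at
    every point, as required for dominated convergence of gauge integrals.\<close>
  define q' where "q' = (\<lambda>n t. if t \<in> S then q n t else 0)"
  define f where "f = (\<lambda>t. if t \<in> S then lim (\<lambda>n. G (of_real (\<rho> n) * cis t)) * \<i> * cis t else 0)"
  have nr: "norm (of_real (\<rho> n) * cis t) < 1" for n t using \<rho>(1,2)[of n] by (simp add: norm_mult abs_of_pos)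
  have cq: "continuous_on A (q n)" for n A
    unfolding q_def by (intro continuous_intros continuous_on_compose2[OF holomorphic_on_imp_continuous_on[OF G]])
       (use nr in auto)
  have nq: "norm (q n t) \<le> M" for n t
  proof -
    have "norm (q n t) = norm (G (of_real (\<rho> n) * cis t)) * \<rho> n" using \<rho>(1)[of n] by (simp add: q_def norm_mult)
    also have "\<dots> \<le> M * 1" using \<rho>(1,2)[of n] M0 by (intro mult_mono M nr) auto
    finally show ?thesis by simp
  qed
  have q'int: "q' n integrable_on {a..b}" "integral {a..b} (q' n) = integral {a..b} (q n)" if "0 \<le> a" "b \<le> 2*pi" for n a b
  proof -
    have eq: "q' n x = q n x" if "x \<in> {a..b} - N" for x using that \<open>0 \<le> a\<close> \<open>b \<le> 2*pi\<close> by (auto simp: q'_def S_def)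
    show "q' n integrable_on {a..b}"
      by (rule integrable_spike[OF integrable_continuous_interval[OF cq] N(1)]) (use eq in auto)
    show "integral {a..b} (q' n) = integral {a..b} (q n)"
      by (rule integral_spike[OF N(1)]) (use eq in auto)
  qed
  have q'lim: "(\<lambda>n. q' n t) \<longlonglongrightarrow> f t" for t
  proof (cases "t \<in> S")
    case True
    have "(\<lambda>n. G (of_real (\<rho> n) * cis t)) \<longlonglongrightarrow> lim (\<lambda>n. G (of_real (\<rho> n) * cis t))"
      using N(2)[of t] True by (simp add: S_def convergent_LIMSEQ_iff)
    moreover have "(\<lambda>n. of_real (\<rho> n) :: complex) \<longlonglongrightarrow> of_real 1" by (intro tendsto_of_real \<rho>)
    ultimately have "(\<lambda>n. q n t) \<longlonglongrightarrow> lim (\<lambda>n. G (of_real (\<rho> n) * cis t)) * of_real 1 * \<i> * cis t"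
      unfolding q_def by (intro tendsto_intros \<rho>(3))
    thus ?thesis using True by (simp add: q'_def f_def)
  qed (simp add: q'_def f_def)
  have nq': "norm (q' n t) \<le> M" for n t using nq M0 by (simp add: q'_def)
  have fint: "f integrable_on {a..b}" "(\<lambda>n. integral {a..b} (q' n)) \<longlonglongrightarrow> integral {a..b} f"
    if "0 \<le> a" "b \<le> 2*pi" for a b
    by (rule dominated_convergence[of q' "{a..b}" "\<lambda>_. M"]; use q'int[OF that] nq' q'lim in auto)+
  have FTC: "integral {a..b} f = g (cis b) - g (cis a)" if ab: "0 \<le> a" "a \<le> b" "b \<le> 2*pi" for a b
  proof -
    have "integral {a..b} (q' n) = g (of_real (\<rho> n) * cis b) - g (of_real (\<rho> n) * cis a)" for n
    proof -
      have "(q n has_integral (g (of_real (\<rho> n) * cis b) - g (of_real (\<rho> n) * cis a))) {a..b}"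
      proof (rule fundamental_theorem_of_calculus[OF ab(2)])
        fix x
        have "((\<lambda>x. of_real (\<rho> n) * cis x) has_vector_derivative of_real (\<rho> n) * (\<i> * cis x)) (at x within {a..b})"
          unfolding has_vector_derivative_def
          by (auto intro!: derivative_eq_intros simp: scaleR_conv_of_real)
        from field_vector_diff_chain_within[OF this, of g "G (of_real (\<rho> n) * cis x)"]
        have "(g \<circ> (\<lambda>x. of_real (\<rho> n) * cis x) has_vector_derivative of_real (\<rho> n) * (\<i> * cis x) * G (of_real (\<rho> n) * cis x)) (at x within {a..b})"
          using g(2)[OF nr[of n x]] has_field_derivative_at_within by blast
        thus "((\<lambda>x. g (of_real (\<rho> n) * cis x)) has_vector_derivative q n x) (at x within {a..b})"
          by (simp add: o_def q_def mult_ac)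
      qed
      thus ?thesis using q'int(2)[OF ab(1,3)] by (simp add: integral_unique)
    qed
    hence "(\<lambda>n. g (of_real (\<rho> n) * cis b) - g (of_real (\<rho> n) * cis a)) \<longlonglongrightarrow> integral {a..b} f"
      using fint(2)[OF ab(1,3)] by simp
    moreover have "(\<lambda>n. g (of_real (\<rho> n) * cis t)) \<longlonglongrightarrow> g (cis t)" for t
    proof (rule continuous_on_tendsto_compose[OF g(1)])
      have "(\<lambda>n. of_real (\<rho> n) * cis t) \<longlonglongrightarrow> of_real 1 * cis t" by (intro tendsto_intros \<rho>)
      thus "(\<lambda>n. of_real (\<rho> n) * cis t) \<longlonglongrightarrow> cis t" by simp
    qed (use less_imp_le[OF nr] in auto)
    hence "(\<lambda>n. g (of_real (\<rho> n) * cis b) - g (of_real (\<rho> n) * cis a)) \<longlonglongrightarrow> g (cis b) - g (cis a)"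
      by (intro tendsto_intros)
    ultimately show ?thesis using LIMSEQ_unique by blast
  qed
  have fall: "f integrable_on {a..b}" for a b
  proof -
    have "(\<lambda>x. if x \<in> {0..2*pi} then f x else 0) integrable_on UNIV"
      using fint(1)[of 0 "2*pi"] by (subst integrable_restrict_UNIV) auto
    moreover have "(\<lambda>x. if x \<in> {0..2*pi} then f x else 0) = f" by (auto simp: f_def S_def)
    ultimately have "f integrable_on UNIV" by simp
    thus ?thesis using integrable_on_subcbox[of f UNIV a b] by simp
  qed
  obtain N3 where N3: "negligible N3"
    "\<And>x e. x \<notin> N3 \<Longrightarrow> e > 0 \<Longrightarrow> \<exists>d>0. \<forall>h. 0 < h \<and> h < d \<longrightarrow>
       norm (integral {x..x+h} f - of_real h * f x) \<le> e * h \<and> norm (integral {x-h..x} f - of_real h * f x) \<le> e * h"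
    by (rule indefinite_integral_differentiable_ae[OF fall]) (use that in blast)
  show ?thesis
  \<comment> \<open>The integral formula is available only on \<open>{0..2*pi}\<close>, so a
    two-sided derivative needs an interior point.\<close>
  proof (rule that[of "N3 \<union> {0, 2*pi}"])
    show "negligible (N3 \<union> {0, 2*pi})" using N3(1) by (auto intro: negligible_Un negligible_finite)
    fix t assume "t \<in> {0..2*pi} - (N3 \<union> {0, 2*pi})"
    hence t: "0 < t" "t < 2*pi" "t \<notin> N3" by auto
    have "((\<lambda>t. g (cis t)) has_vector_derivative f t) (at t)"
      unfolding has_vector_derivative_def has_derivative_at_alt
    proof (intro conjI allI impI bounded_linear_scaleR_left)
      fix e :: real assume "e > 0"
      from N3(2)[OF t(3) this] obtain d where d: "d > 0" 
        "\<And>h. 0 < h \<Longrightarrow> h < d \<Longrightarrow> norm (integral {t..t+h} f - of_real h * f t) \<le> e * h"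
        "\<And>h. 0 < h \<Longrightarrow> h < d \<Longrightarrow> norm (integral {t-h..t} f - of_real h * f t) \<le> e * h" by blast
      define d' where "d' = min d (min t (2*pi - t))"
      have "d' > 0" using d t by (simp add: d'_def)
      moreover have "norm (g (cis y) - g (cis t) - (y - t) *\<^sub>R f t) \<le> e * norm (y - t)" if y: "norm (y - t) < d'" for y
      proof -
        consider "y = t" | "y > t" | "y < t" by linarith
        thus ?thesis
        proof cases
          case 2
          thus ?thesis using d(2)[of "y - t"] FTC[of t y] y t by (simp add: d'_def scaleR_conv_of_real)
        next
          case 3
          have "norm (integral {y..t} f - of_real (t - y) * f t) \<le> e * (t - y)"
            using d(3)[of "t - y"] 3 y by (simp add: d'_def)
          moreover have "integral {y..t} f = g (cis t) - g (cis y)" using FTC[of y t] 3 y t by (simp add: d'_def)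
          moreover have "g (cis y) - g (cis t) - (y - t) *\<^sub>R f t = - (g (cis t) - g (cis y) - of_real (t - y) * f t)"
            by (simp add: scaleR_conv_of_real algebra_simps)
          ultimately show ?thesis using 3 by (simp only: norm_minus_cancel) simp
        qed simp
      qed
      ultimately show "\<exists>d>0. \<forall>y. norm (y - t) < d \<longrightarrow> norm (g (cis y) - g (cis t) - (y - t) *\<^sub>R f t) \<le> e * norm (y - t)" by blast
    qed
    thus "0 < t \<and> t < 2*pi \<and> (\<exists>A. ((\<lambda>t. g (cis t)) has_vector_derivative A) (at t))" using t by blast
  qed
qed

section \<open>From tangential derivatives to radial limits\<close>

text \<open>An affine correction makes the primitive vanish to first order at \<open>z0\<close>
  along the circle. The derivative at \<open>r * z0\<close> is an integral against the kernel
  \<open>k\<close>, whose product with \<open>|u - z0|\<close> is dominated by a multiple of the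
  Poisson kernel; near \<open>z0\<close> this yields a small multiple of total mass, and elsewhere a
  factor \<open>1 - r^2\<close> tends to 0.\<close>

lemma radial_limit_at_differentiability_point:
  assumes g: "continuous_on (cball 0 1) g" "\<And>w. norm w < 1 \<Longrightarrow> (g has_field_derivative G w) (at w)"
    and A: "((\<lambda>t. g (cis t)) has_vector_derivative A) (at t0)" and t0: "0 < t0" "t0 < 2*pi"
  shows "((\<lambda>r. G (of_real r * cis t0)) \<longlongrightarrow> A / (\<i> * cis t0)) (at_left 1)"
proof -
  define z0 where "z0 = cis t0"
  define B where "B = A / (\<i> * z0)"
  have z0: "norm z0 = 1" "z0 \<noteq> 0" by (auto simp: z0_def)
  define g1 where "g1 = (\<lambda>u. g u - g z0 - B * (u - z0))"
  have g1c: "continuous_on (cball 0 1) g1" unfolding g1_def by (intro continuous_intros g)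
  have g1d: "(g1 has_field_derivative G w - B) (at w)" if "norm w < 1" for w
    unfolding g1_def using g(2)[OF that] by (auto intro!: derivative_eq_intros)
  have g1h: "g1 holomorphic_on ball 0 1"
    unfolding holomorphic_on_def field_differentiable_def
    using g1d has_field_derivative_at_within by (metis dist_0_norm mem_ball)
  obtain K where K: "\<And>t. norm (g1 (cis t)) \<le> K"
  proof -
    have "bounded (g1 ` cball 0 1)" using compact_continuous_image[OF g1c] compact_imp_bounded by auto
    then obtain K where "\<forall>u\<in>g1 ` cball 0 1. norm u \<le> K" unfolding bounded_iff by auto
    thus ?thesis using that[of K] by auto
  qed
  have K0: "K \<ge> 0" using K[of 0] norm_ge_zero order_trans by blast
  have near: "\<exists>d>0. \<forall>t. \<bar>t - t0\<bar> < d \<longrightarrow> norm (g1 (cis t)) \<le> e * norm (cis t - z0)" if e: "e > 0" for e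
  proof -
    have cd: "(cis has_vector_derivative \<i> * z0) (at t0)"
      using has_derivative_cis[OF has_derivative_ident, of t0 UNIV] by (simp add: has_vector_derivative_def z0_def)
    have "((\<lambda>t. g1 (cis t)) has_vector_derivative A - 0 - B * (\<i> * z0 - 0)) (at t0)"
      unfolding g1_def by (intro derivative_intros A cd has_vector_derivative_mult_right)
    moreover have "A - 0 - B * (\<i> * z0 - 0) = 0" using z0 by (simp add: B_def)
    ultimately have g1': "((\<lambda>t. g1 (cis t)) has_derivative (\<lambda>h. 0)) (at t0)" by (simp add: has_vector_derivative_def)
    have "g1 (cis t0) = 0" by (simp add: g1_def z0_def)
    moreover have "\<exists>d>0. \<forall>y. norm (y - t0) < d \<longrightarrow> norm (g1 (cis y) - g1 (cis t0) - 0) \<le> e/2 * norm (y - t0)"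
      using g1' e unfolding has_derivative_at_alt by (meson half_gt_zero)
    ultimately obtain d1 where d1: "d1 > 0" "\<And>y. \<bar>y - t0\<bar> < d1 \<Longrightarrow> norm (g1 (cis y)) \<le> e/2 * \<bar>y - t0\<bar>" by auto
    have "(0::real) < 1/2" by simp
    with cd obtain d2 where d2: "d2 > 0"
      "\<And>y. \<bar>y - t0\<bar> < d2 \<Longrightarrow> norm (cis y - z0 - (y - t0) *\<^sub>R (\<i> * z0)) \<le> 1/2 * \<bar>y - t0\<bar>"
      unfolding has_vector_derivative_def has_derivative_at_alt z0_def[symmetric] real_norm_def by meson
    show ?thesis
    proof (intro exI[of _ "min d1 d2"] conjI allI impI)
      fix t assume t: "\<bar>t - t0\<bar> < min d1 d2"
      have "\<bar>t - t0\<bar> = norm ((t - t0) *\<^sub>R (\<i> * z0))" using z0 by (simp add: norm_mult)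
      also have "\<dots> \<le> norm (cis t - z0) + norm (cis t - z0 - (t - t0) *\<^sub>R (\<i> * z0))"
        by (metis norm_triangle_sub norm_minus_commute add.commute)
      also have "\<dots> \<le> norm (cis t - z0) + 1/2 * \<bar>t - t0\<bar>" using d2(2)[of t] t by simp
      finally have "\<bar>t - t0\<bar> \<le> 2 * norm (cis t - z0)" by simp
      hence "e/2 * \<bar>t - t0\<bar> \<le> e/2 * (2 * norm (cis t - z0))" using e by (intro mult_left_mono) auto
      thus "norm (g1 (cis t)) \<le> e * norm (cis t - z0)" using d1(2)[of t] t by simp
    qed (use d1 d2 in auto)
  qed
  \<comment> \<open>The Cauchy kernel for the derivative minus its reflection, whose pole
    \<open>z0 / r\<close> lies outside the disc. The reflected term integrates to 0 against
    \<open>g1\<close>, and the difference gains a factor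
    \<open>(1 - r^2) * |cis t - z0|\<close>.\<close>
  define k where "k = (\<lambda>r t. 1 / (cis t - of_real r * z0)\<^sup>2 - 1 / (of_real r * cis t - z0)\<^sup>2)"
  have nr: "norm (of_real r * z0) < 1" if "0 < r" "r < 1" for r using that z0 by (simp add: norm_mult)
  have dist_eq: "norm (of_real r * cis t - z0) = norm (cis t - of_real r * z0)" for r t
  proof -
    have "cis t * cnj (cis t) = 1" "z0 * cnj z0 = 1" using z0 by (simp_all add: complex_norm_square[symmetric])
    hence "z0 * cis t * cnj (cis t - of_real r * z0) = z0 - of_real r * cis t"
      by (simp add: algebra_simps)
    hence "norm (z0 - of_real r * cis t) = norm z0 * norm (cis t) * norm (cnj (cis t - of_real r * z0))"
      by (metis norm_mult)
    thus ?thesis using z0 by (simp only: complex_mod_cnj norm_cis) (simp add: norm_minus_commute)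
  qed
  have dpos: "norm (cis t - of_real r * z0) \<ge> 1 - r" if "0 < r" "r < 1" for r t
    using norm_triangle_ineq2[of "cis t" "of_real r * z0"] that z0 by (simp add: norm_mult)
  have dle: "norm (cis t - z0) \<le> 2 * norm (cis t - of_real r * z0)" if r: "0 < r" "r < 1" for r t
  proof -
    have "norm (cis t - z0) \<le> norm (cis t - of_real r * z0) + norm (of_real r * z0 - z0)"
      using norm_triangle_ineq[of "cis t - of_real r * z0" "of_real r * z0 - z0"] by simp
    also have "of_real r * z0 - z0 = of_real (r - 1) * z0" by (simp add: algebra_simps)
    also have "norm \<dots> = 1 - r" using z0 r by (simp only: norm_mult norm_of_real) simp
    finally show ?thesis using dpos[OF r, of t] by linarith
  qed
  have kn: "norm (k r t) \<le> 2 * (1 - r\<^sup>2) * norm (cis t - z0) / norm (cis t - of_real r * z0) ^ 4" if r: "0 < r" "r < 1" for r t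
  proof -
    have nz: "cis t - of_real r * z0 \<noteq> 0" "of_real r * cis t - z0 \<noteq> 0"
    proof -
      have "norm (cis t - of_real r * z0) > 0" using dpos[OF r, of t] r by linarith
      moreover from this have "norm (of_real r * cis t - z0) > 0" by (simp only: dist_eq)
      ultimately show "cis t - of_real r * z0 \<noteq> 0" "of_real r * cis t - z0 \<noteq> 0" unfolding zero_less_norm_iff by blast+
    qed
    have "k r t = ((of_real r * cis t - z0)\<^sup>2 - (cis t - of_real r * z0)\<^sup>2) / ((cis t - of_real r * z0)\<^sup>2 * (of_real r * cis t - z0)\<^sup>2)"
      unfolding k_def using nz by (simp add: diff_frac_eq)
    also have "(of_real r * cis t - z0)\<^sup>2 - (cis t - of_real r * z0)\<^sup>2 = of_real (1 - r\<^sup>2) * ((z0 - cis t) * (z0 + cis t))"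
      by (simp add: power2_eq_square algebra_simps)
    finally have "norm (k r t) = norm (of_real (1 - r\<^sup>2) * ((z0 - cis t) * (z0 + cis t))) / (norm (cis t - of_real r * z0) ^ 2 * norm (of_real r * cis t - z0) ^ 2)"
      by (simp add: norm_divide norm_mult norm_power)
    also have "norm (cis t - of_real r * z0) ^ 2 * norm (of_real r * cis t - z0) ^ 2 = norm (cis t - of_real r * z0) ^ 4"
      unfolding dist_eq by (simp flip: power_add)
    also have "norm (of_real (1 - r\<^sup>2) * ((z0 - cis t) * (z0 + cis t))) = (1 - r\<^sup>2) * (norm (cis t - z0) * norm (z0 + cis t))"
      using r by (simp add: norm_mult norm_minus_commute power_le_one del: of_real_diff of_real_power)
    also have "\<dots> / norm (cis t - of_real r * z0) ^ 4 \<le> (1 - r\<^sup>2) * (norm (cis t - z0) * 2) / norm (cis t - of_real r * z0) ^ 4"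
      using norm_triangle_ineq[of z0 "cis t"] z0 r
      by (intro divide_right_mono mult_left_mono) (auto simp: power_le_one)
    also have "(1 - r\<^sup>2) * (norm (cis t - z0) * 2) = 2 * (1 - r\<^sup>2) * norm (cis t - z0)" by (simp only: mult_ac)
    finally show ?thesis .
  qed
  have main: "((\<lambda>t. g1 (cis t) * k r t * \<i> * cis t) has_integral 2 * of_real pi * \<i> * (G (of_real r * z0) - B)) {0..2*pi}"
    if r: "0 < r" "r < 1" for r
  proof -
    let ?w = "of_real r * z0"
    have w: "?w \<in> ball 0 1" using nr[OF r] by simp
    note C = Cauchy_derivative_integral_circlepath[OF g1c g1h w]
    have "1 / (2 * of_real pi * \<i>) * contour_integral (circlepath 0 1) (\<lambda>u. g1 u / (u - ?w)\<^sup>2) = G ?w - B"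
      using DERIV_unique[OF C(2) g1d[OF nr[OF r]]] .
    hence "contour_integral (circlepath 0 1) (\<lambda>u. g1 u / (u - ?w)\<^sup>2) = 2 * of_real pi * \<i> * (G ?w - B)" by (simp add: field_simps)
    hence 1: "((\<lambda>u. g1 u / (u - ?w)\<^sup>2) has_contour_integral 2 * of_real pi * \<i> * (G ?w - B)) (circlepath 0 1)"
      using has_contour_integral_integral[OF C(1)] by simp
    have nz: "of_real r * u - z0 \<noteq> 0" if "norm u \<le> 1" for u
    proof
      assume "of_real r * u - z0 = 0"
      hence "norm (of_real r * u) = 1" using z0 by simp
      moreover have "r * norm u \<le> r * 1" using that r by (intro mult_left_mono) auto
      ultimately show False using r by (simp add: norm_mult)
    qed
    \<comment> \<open>The inserted factor \<open>u / (u - 0)\<close> lets Cauchy's formula at the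
      centre, which asks only for continuity up to the circle, show that the reflected integral
      vanishes.\<close>
    have "((\<lambda>u. g1 u * u / (of_real r * u - z0)\<^sup>2 / (u - 0)) has_contour_integral (2 * of_real pi * \<i> * (g1 0 * 0 / (of_real r * 0 - z0)\<^sup>2))) (circlepath 0 1)"
      by (rule Cauchy_integral_circlepath) (use nz in \<open>auto intro!: continuous_intros holomorphic_intros g1c g1h\<close>)
    hence 2: "((\<lambda>u. g1 u * u / (of_real r * u - z0)\<^sup>2 / (u - 0)) has_contour_integral 0) (circlepath 0 1)" by simp
    have 3: "((\<lambda>u. g1 u / (u - ?w)\<^sup>2 - g1 u * u / (of_real r * u - z0)\<^sup>2 / (u - 0)) has_contour_integral 2 * of_real pi * \<i> * (G ?w - B)) (circlepath 0 1)"
      using has_contour_integral_diff[OF 1 2] by simp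
    have 4: "((\<lambda>t. (g1 (cis t) / (cis t - ?w)\<^sup>2 - g1 (cis t) * cis t / (of_real r * cis t - z0)\<^sup>2 / (cis t - 0)) * \<i> * cis t) has_integral 2 * of_real pi * \<i> * (G ?w - B)) {0..2*pi}"
      using 3 by (simp add: circlepath_def has_contour_integral_part_circlepath_iff)
    have "(g1 (cis t) / (cis t - ?w)\<^sup>2 - g1 (cis t) * cis t / (of_real r * cis t - z0)\<^sup>2 / (cis t - 0)) = g1 (cis t) * k r t" for t
      unfolding k_def by (simp add: right_diff_distrib)
    thus ?thesis using 4 by simp
  qed
  have "((\<lambda>r. G (of_real r * z0)) \<longlongrightarrow> B) (at_left 1)"
  proof (rule tendstoI)
    fix e0 :: real assume e0: "e0 > 0"
    \<comment> \<open>The near part will contribute \<open>8 * e\<close>, which is half of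
      \<open>e0\<close>.\<close>
    define e where "e = e0 / 16"
    have e: "e > 0" using e0 by (simp add: e_def)
    obtain d where d: "d > 0" "\<And>t. \<bar>t - t0\<bar> < d \<Longrightarrow> norm (g1 (cis t)) \<le> e * norm (cis t - z0)"
      using near[OF e] by blast
    \<comment> \<open>As \<open>t0\<close> is interior to \<open>{0..2*pi}\<close>, no other
      parameter of this interval gives the point \<open>z0\<close>, so compactness yields a positive
      distance.\<close>
    obtain c where c: "c > 0" "\<And>t. t \<in> {0..2*pi} \<Longrightarrow> \<bar>t - t0\<bar> \<ge> d \<Longrightarrow> c \<le> norm (cis t - z0)"
    proof (cases "{0..2*pi} \<inter> {t. \<bar>t - t0\<bar> \<ge> d} = {}")
      case True
      show ?thesis by (rule that[of 1], simp) (use True in blast)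
    next
      case False
      have "closed {t. \<bar>t - t0\<bar> \<ge> d}" by (intro closed_Collect_le continuous_intros)
      hence "compact ({0..2*pi} \<inter> {t. \<bar>t - t0\<bar> \<ge> d})" by (intro compact_Int_closed) auto
      moreover have "continuous_on ({0..2*pi} \<inter> {t. \<bar>t - t0\<bar> \<ge> d}) (\<lambda>t. norm (cis t - z0))" by (intro continuous_intros)
      ultimately obtain t1 where t1: "t1 \<in> {0..2*pi}" "\<bar>t1 - t0\<bar> \<ge> d"
        "\<forall>t\<in>{0..2*pi} \<inter> {t. \<bar>t - t0\<bar> \<ge> d}. norm (cis t1 - z0) \<le> norm (cis t - z0)"
        using continuous_attains_inf[OF _ False] by (metis (no_types, lifting) Int_iff mem_Collect_eq)
      have "cis t1 \<noteq> z0"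
      proof
        assume "cis t1 = z0"
        hence "cis t1 / cis t0 = 1" by (simp add: z0_def)
        hence "cis (t1 - t0) = 1" by (simp add: cis_divide)
        hence "cos (t1 - t0) = 1" by (metis cis.sel(1) one_complex.sel(1))
        then obtain n :: int where n: "t1 - t0 = of_int n * (2 * pi)" by (auto simp: cos_one_2pi_int)
        have "\<bar>t1 - t0\<bar> < 2 * pi" using t1(1) t0 by auto
        hence "\<bar>of_int n\<bar> * (2 * pi) < 1 * (2 * pi)" unfolding n by (simp add: abs_mult)
        hence "\<bar>real_of_int n\<bar> < 1" by (simp only: mult_less_cancel_right) auto
        hence "n = 0" by linarith
        thus False using n t1(2) d(1) by simp
      qed
      thus ?thesis using that[of "norm (cis t1 - z0)"] t1(3) by auto
    qed
    \<comment> \<open>Away from \<open>t0\<close> the distance to \<open>r * z0\<close> is at least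
      \<open>c / 2\<close> and the chord is at most 2, so the kernel is at most
      \<open>4 * (1 - r^2) / (c/2)^4\<close>.\<close>
    define C where "C = K * 64 / c ^ 4"
    have C0: "C \<ge> 0" using K0 c by (simp add: C_def)
    have pt: "norm (g1 (cis t) * k r t * \<i> * cis t) \<le> 8 * e * poisson (of_real r * z0) t + C * (1 - r\<^sup>2)"
      if r: "0 < r" "r < 1" and t: "t \<in> {0..2*pi}" for r t
    proof -
      let ?\<delta> = "norm (cis t - of_real r * z0)"
      let ?x = "norm (cis t - z0)"
      have \<delta>: "?\<delta> > 0" using dpos[OF r, of t] r by linarith
      have r2: "1 - r\<^sup>2 \<ge> 0" using r by (simp add: power_le_one)
      have P: "poisson (of_real r * z0) t = (1 - r\<^sup>2) / ?\<delta>\<^sup>2" using z0 r by (simp add: poisson_def norm_mult)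
      have P0: "poisson (of_real r * z0) t \<ge> 0" by (rule poisson_nonneg[OF nr[OF r]])
      have x2: "?x\<^sup>2 \<le> 4 * ?\<delta>\<^sup>2" using power_mono[OF dle[OF r, of t], of 2] by (simp add: power_mult_distrib)
      have "norm (g1 (cis t)) * norm (k r t) \<le> 8 * e * poisson (of_real r * z0) t + C * (1 - r\<^sup>2)"
      proof (cases "\<bar>t - t0\<bar> < d")
        case True
        have "norm (g1 (cis t)) * norm (k r t) \<le> (e * ?x) * (2 * (1 - r\<^sup>2) * ?x / ?\<delta> ^ 4)"
          using e by (intro mult_mono d(2) True kn r) auto
        also have "\<dots> = (2 * e * (1 - r\<^sup>2) / ?\<delta> ^ 4) * ?x\<^sup>2" by (simp add: power2_eq_square)
        also have "\<dots> \<le> (2 * e * (1 - r\<^sup>2) / ?\<delta> ^ 4) * (4 * ?\<delta>\<^sup>2)"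
          using e r2 by (intro mult_left_mono x2) auto
        also have "\<dots> = 8 * e * poisson (of_real r * z0) t"
          unfolding P using \<delta> by (simp add: field_simps power2_eq_square power4_eq_xxxx)
        finally show ?thesis using C0 r2 by (simp add: add_increasing2)
      next
        case False
        have "c \<le> ?x" using c(2)[OF t] False by simp
        hence "c / 2 \<le> ?\<delta>" using dle[OF r, of t] by linarith
        hence "(c / 2) ^ 4 \<le> ?\<delta> ^ 4" using c by (intro power_mono) auto
        moreover have "?x \<le> 2" using norm_triangle_ineq4[of "cis t" z0] z0 by simp
        ultimately have "2 * (1 - r\<^sup>2) * ?x / ?\<delta> ^ 4 \<le> 2 * (1 - r\<^sup>2) * 2 / (c / 2) ^ 4"
          using r2 c by (intro frac_le mult_left_mono) auto
        hence "norm (g1 (cis t)) * norm (k r t) \<le> K * (2 * (1 - r\<^sup>2) * 2 / (c / 2) ^ 4)"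
          using order_trans[OF kn[OF r, of t]] K0 by (intro mult_mono K) auto
        also have "\<dots> = C * (1 - r\<^sup>2)" by (simp add: C_def power_divide)
        finally show ?thesis using P0 e by (simp add: add_increasing)
      qed
      thus ?thesis by (simp add: norm_mult)
    qed
    have bound: "norm (G (of_real r * z0) - B) \<le> 8 * e + C * (1 - r\<^sup>2)" if r: "0 < r" "r < 1" for r
    proof -
      have i: "(\<lambda>t. 8 * e * poisson (of_real r * z0) t + C * (1 - r\<^sup>2)) integrable_on {0..2*pi}"
        by (intro integrable_continuous_interval continuous_intros continuous_on_poisson nr r)
      have "2 * pi * norm (G (of_real r * z0) - B) = norm (integral {0..2*pi} (\<lambda>t. g1 (cis t) * k r t * \<i> * cis t))"
        using main[OF r] by (simp add: integral_unique norm_mult)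
      also have "\<dots> \<le> integral {0..2*pi} (\<lambda>t. 8 * e * poisson (of_real r * z0) t + C * (1 - r\<^sup>2))"
        using main[OF r] by (intro integral_norm_bound_integral i pt r) (auto simp: integrable_on_def)
      also have "\<dots> = 8 * e * (2 * pi) + 2 * pi * (C * (1 - r\<^sup>2))"
        using poisson_integral_1[OF nr[OF r]] continuous_on_poisson[OF nr[OF r]]
        by (subst integral_add) (auto intro!: integrable_continuous_interval continuous_intros simp: integral_unique)
      also have "\<dots> = 2 * pi * (8 * e + C * (1 - r\<^sup>2))" by (simp add: algebra_simps)
      finally show ?thesis by (subst (asm) mult_le_cancel_left_pos) auto
    qed
    have "((\<lambda>r. 8 * e + C * (1 - r\<^sup>2)) \<longlongrightarrow> 8 * e + C * (1 - 1\<^sup>2)) (at_left (1::real))" by (intro tendsto_intros)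
    hence "eventually (\<lambda>r. 8 * e + C * (1 - r\<^sup>2) < e0) (at_left (1::real))"
      by (rule order_tendstoD(2)) (use e0 in \<open>simp add: e_def\<close>)
    moreover have "eventually (\<lambda>r::real. 0 < r \<and> r < 1) (at_left 1)"
      using eventually_at_left_real[of 0 1] by (simp add: greaterThanLessThan_iff)
    ultimately show "eventually (\<lambda>r. dist (G (of_real r * z0)) B < e0) (at_left 1)"
    proof eventually_elim
      case (elim r)
      thus ?case using bound[of r] by (simp add: dist_norm)
    qed
  qed
  thus ?thesis by (simp add: z0_def B_def)
qed

theorem fatou_radial_limits:
  assumes G: "G holomorphic_on ball 0 1" and M: "\<And>w. norm w < 1 \<Longrightarrow> norm (G w) \<le> M"
  obtains N where "negligible N"
    "\<And>t. t \<in> {0..2*pi} - N \<Longrightarrow> ((\<lambda>r. G (of_real r * cis t)) \<longlongrightarrow> bdry G t) (at_left 1)"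
proof -
  obtain g where g: "continuous_on (cball 0 1) g" "\<And>w. norm w < 1 \<Longrightarrow> (g has_field_derivative G w) (at w)"
  proof (rule lipschitz_primitive_extension[OF G M])
    fix g assume "continuous_on (cball 0 1) g" "\<And>w. norm w < 1 \<Longrightarrow> (g has_field_derivative G w) (at w)"
    thus ?thesis by (rule that)
  qed
  obtain N where N: "negligible N"
    "\<And>t. t \<in> {0..2*pi} - N \<Longrightarrow> 0 < t \<and> t < 2*pi \<and> (\<exists>A. ((\<lambda>t. g (cis t)) has_vector_derivative A) (at t))"
  proof (rule boundary_primitive_differentiable_ae[OF G M g])
    fix N assume "negligible N"
      "\<And>t. t \<in> {0..2*pi} - N \<Longrightarrow> 0 < t \<and> t < 2*pi \<and> (\<exists>A. ((\<lambda>t. g (cis t)) has_vector_derivative A) (at t))"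
    thus ?thesis by (rule that)
  qed
  show ?thesis
  proof (rule that[OF N(1)])
    fix t assume "t \<in> {0..2*pi} - N"
    from N(2)[OF this] obtain A where A: "((\<lambda>r. G (of_real r * cis t)) \<longlongrightarrow> A / (\<i> * cis t)) (at_left 1)"
      using radial_limit_at_differentiability_point[OF g] by blast
    moreover have "bdry G t = A / (\<i> * cis t)"
      unfolding bdry_def using A tendsto_Lim[OF _ A] by auto
    ultimately show "((\<lambda>r. G (of_real r * cis t)) \<longlongrightarrow> bdry G t) (at_left 1)" by simp
  qed
qed

section \<open>Weak-star density and density in Hardy spaces\<close>

lemma bdry_AE_limit:
  assumes G: "G holomorphic_on ball 0 1" and GM: "G ` ball 0 1 \<subseteq> cball 0 M"
    and \<rho>: "\<And>n::nat. 0 < \<rho> n" "\<And>n. \<rho> n < 1" "\<rho> \<longlonglongrightarrow> 1"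
  shows "AE t in lebesgue_on {0..2*pi}. (\<lambda>n. G (of_real (\<rho> n) * cis t)) \<longlonglongrightarrow> bdry G t"
    and "bdry G \<in> borel_measurable (lebesgue_on {0..2*pi})"
    and "AE t in lebesgue_on {0..2*pi}. norm (bdry G t) \<le> M"
proof -
  let ?S = "{0..2*pi}"
  have M: "norm (G w) \<le> M" if "norm w < 1" for w using GM that by (auto simp: image_subset_iff)
  obtain N where N: "negligible N"
    "\<And>t. t \<in> ?S - N \<Longrightarrow> ((\<lambda>r. G (of_real r * cis t)) \<longlongrightarrow> bdry G t) (at_left 1)"
  proof (rule fatou_radial_limits[OF G M])
    fix N assume "negligible N"
      "\<And>t. t \<in> {0..2*pi} - N \<Longrightarrow> ((\<lambda>r. G (of_real r * cis t)) \<longlongrightarrow> bdry G t) (at_left 1)"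
    thus ?thesis by (rule that)
  qed
  have fl: "filterlim \<rho> (at_left 1) sequentially"
    by (rule tendsto_imp_filterlim_at_left[OF \<rho>(3)]) (use \<rho>(2) in simp)
  have lim: "(\<lambda>n. G (of_real (\<rho> n) * cis t)) \<longlonglongrightarrow> bdry G t" if "t \<in> ?S - N" for t
    by (rule filterlim_compose[OF N(2)[OF that] fl])
  have nr: "norm (of_real (\<rho> n) * cis t) < 1" for n t using \<rho>(1,2)[of n] by (simp add: norm_mult abs_of_pos)
  have Nn: "N \<in> null_sets lebesgue" using N(1) by (simp add: negligible_iff_null_sets)
  have AE: "AE t in lebesgue. t \<in> ?S \<longrightarrow> t \<in> ?S - N" using AE_not_in[OF Nn] by eventually_elim auto
  show conv: "AE t in lebesgue_on ?S. (\<lambda>n. G (of_real (\<rho> n) * cis t)) \<longlonglongrightarrow> bdry G t"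
    by (subst AE_restrict_space_iff) (use AE in \<open>auto elim!: eventually_mono intro: lim\<close>)
  thus "AE t in lebesgue_on ?S. norm (bdry G t) \<le> M"
    by eventually_elim (rule Lim_bounded[OF tendsto_norm], auto intro!: M nr)
  have cG: "continuous_on ?S (\<lambda>t. G (of_real (\<rho> n) * cis t))" for n
    by (rule continuous_on_compose2[OF holomorphic_on_imp_continuous_on[OF G]])
       (use nr in \<open>auto intro!: continuous_intros\<close>)
  have "(\<lambda>t. G (of_real (\<rho> n) * cis t)) \<in> borel_measurable (lebesgue_on ?S)" for n
    by (rule continuous_imp_measurable_on_sets_lebesgue[OF cG]) auto
  hence "(\<lambda>t. lim (\<lambda>n. G (of_real (\<rho> n) * cis t))) \<in> borel_measurable (lebesgue_on ?S)"
    by (rule borel_measurable_lim_metric)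
  \<comment> \<open>Extension by 0 to the whole line, where completeness of Lebesgue measure
    transfers measurability across a null set.\<close>
  hence m: "(\<lambda>t. if t \<in> ?S then lim (\<lambda>n. G (of_real (\<rho> n) * cis t)) else 0) \<in> borel_measurable lebesgue"
    by (subst borel_measurable_if) auto
  have "AE t in lebesgue. (if t \<in> ?S then lim (\<lambda>n. G (of_real (\<rho> n) * cis t)) else 0) = (if t \<in> ?S then bdry G t else 0)"
    using AE by eventually_elim (use lim limI in auto)
  from borel_measurable_AE[OF m this] show "bdry G \<in> borel_measurable (lebesgue_on ?S)"
    by (subst (asm) borel_measurable_if) auto
qed

text \<open>Both functions are bounded, so the means over growing circles converge to the boundary
  integral by dominated convergence.\<close>

lemma bdry_difference_L2:
  assumes G: "G holomorphic_on ball 0 1" "G ` ball 0 1 \<subseteq> cball 0 M"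
    and H: "H holomorphic_on ball 0 1" "H ` ball 0 1 \<subseteq> cball 0 K"
    and m: "\<And>r. 0 < r \<Longrightarrow> r < 1 \<Longrightarrow> circle_mean r (\<lambda>w. norm (G w - H w) powr 2) \<le> m"
  shows "integral\<^sup>L (lebesgue_on {0..2*pi}) (\<lambda>t. (norm (bdry G t - bdry H t))\<^sup>2) \<le> 2 * pi * m"
proof -
  let ?L = "lebesgue_on {0..2*pi}"
  define \<rho> where "\<rho> = (\<lambda>n::nat. 1 - 1 / (real n + 2))"
  have \<rho>: "0 < \<rho> n" "\<rho> n < 1" for n by (auto simp: \<rho>_def field_simps)
  have \<rho>lim: "\<rho> \<longlonglongrightarrow> 1" unfolding \<rho>_def by real_asymp
  note bG = bdry_AE_limit[OF G \<rho> \<rho>lim] and bH = bdry_AE_limit[OF H \<rho> \<rho>lim]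
  have nr: "norm (of_real (\<rho> n) * cis t) < 1" for n t using \<rho>[of n] by (simp add: norm_mult abs_of_pos)
  let ?d = "\<lambda>n t. norm (G (of_real (\<rho> n) * cis t) - H (of_real (\<rho> n) * cis t))"
  have cd: "continuous_on {0..2*pi} (\<lambda>t. (?d n t)\<^sup>2)" for n
    by (intro continuous_intros continuous_on_compose2[OF holomorphic_on_imp_continuous_on[OF G(1)]]
        continuous_on_compose2[OF holomorphic_on_imp_continuous_on[OF H(1)]])
       (use nr in auto)
  have "(\<lambda>n. integral\<^sup>L ?L (\<lambda>t. (?d n t)\<^sup>2)) \<longlonglongrightarrow> integral\<^sup>L ?L (\<lambda>t. (norm (bdry G t - bdry H t))\<^sup>2)"
  proof (rule integral_dominated_convergence[where w="\<lambda>_. (M + K)\<^sup>2"])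
    show "(\<lambda>t. (norm (bdry G t - bdry H t))\<^sup>2) \<in> borel_measurable ?L" using bG(2) bH(2) by measurable
    show "(\<lambda>t. (?d n t)\<^sup>2) \<in> borel_measurable ?L" for n
      by (rule continuous_imp_measurable_on_sets_lebesgue[OF cd]) auto
    show "integrable ?L (\<lambda>_. (M + K)\<^sup>2)" by (intro continuous_imp_integrable_real continuous_intros)
    show "AE t in ?L. (\<lambda>n. (?d n t)\<^sup>2) \<longlonglongrightarrow> (norm (bdry G t - bdry H t))\<^sup>2"
      using bG(1) bH(1) by eventually_elim (intro tendsto_intros)
    show "AE t in ?L. norm ((?d n t)\<^sup>2) \<le> (M + K)\<^sup>2" for n
    proof (rule AE_I2)
      fix t
      have "norm (G (of_real (\<rho> n) * cis t)) \<le> M" "norm (H (of_real (\<rho> n) * cis t)) \<le> K"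
        using G(2) H(2) nr[of n t] by (auto simp: image_subset_iff)
      hence "?d n t \<le> M + K" by (rule order_trans[OF norm_triangle_ineq4 add_mono])
      thus "norm ((?d n t)\<^sup>2) \<le> (M + K)\<^sup>2" by (simp add: power_mono)
    qed
  qed
  moreover have "integral\<^sup>L ?L (\<lambda>t. (?d n t)\<^sup>2) \<le> 2 * pi * m" for n
  proof -
    have "integral\<^sup>L ?L (\<lambda>t. (?d n t)\<^sup>2) = integral {0..2*pi} (\<lambda>t. (?d n t)\<^sup>2)"
      by (rule lebesgue_integral_eq_integral[OF continuous_imp_integrable_real[OF cd]]) auto
    also have "\<dots> = 2 * pi * circle_mean (\<rho> n) (\<lambda>w. norm (G w - H w) powr 2)"
      unfolding circle_mean_def by (simp add: powr_numeral)
    also have "\<dots> \<le> 2 * pi * m" by (intro mult_left_mono m \<rho>) auto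
    finally show ?thesis .
  qed
  ultimately show ?thesis by (intro LIMSEQ_le_const2) auto
qed

text \<open>Truncate \<open>h\<close> at height \<open>n\<close>. The tail is small in L^1 and is
  paired with a function bounded by \<open>K\<close>; on the rest
  \<open>x \<le> \<kappa> + x^2 / \<kappa>\<close> reduces the pairing to the L^2 integral. The
  choice of \<open>\<delta>\<close> is uniform over all \<open>D\<close> with the bound
  \<open>K\<close>.\<close>

lemma bounded_L2_small_imp_weak_small:
  fixes h :: "real \<Rightarrow> complex"
  assumes h: "integrable (lebesgue_on {a..b}) h" and K: "K \<ge> 0" and \<epsilon>: "\<epsilon> > 0"
  obtains \<delta> where "\<delta> > 0" "\<And>D. D \<in> borel_measurable (lebesgue_on {a..b}) \<Longrightarrow>
    AE t in lebesgue_on {a..b}. norm (D t) \<le> K \<Longrightarrow>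
    integral\<^sup>L (lebesgue_on {a..b}) (\<lambda>t. (norm (D t))\<^sup>2) \<le> \<delta> \<Longrightarrow>
    norm (integral\<^sup>L (lebesgue_on {a..b}) (\<lambda>t. D t * h t)) < (\<epsilon>::real)"
proof -
  let ?L = "lebesgue_on {a..b}"
  define tail where "tail = (\<lambda>n::nat. \<lambda>t. if norm (h t) \<le> real n then 0 else norm (h t))"
  have hm [measurable]: "h \<in> borel_measurable ?L" using h by simp
  have tm [measurable]: "tail n \<in> borel_measurable ?L" for n unfolding tail_def by measurable
  have ti: "integrable ?L (tail n)" for n
    by (rule Bochner_Integration.integrable_bound[OF integrable_norm[OF h]]) (auto simp: tail_def)
  have "(\<lambda>n. integral\<^sup>L ?L (tail n)) \<longlonglongrightarrow> integral\<^sup>L ?L (\<lambda>_. 0)"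
  proof (rule integral_dominated_convergence[where w="\<lambda>t. norm (h t)"])
    show "AE t in ?L. (\<lambda>n. tail n t) \<longlonglongrightarrow> 0"
    proof (rule AE_I2)
      fix t
      have "eventually (\<lambda>n. norm (h t) \<le> real n) sequentially"
      proof -
        obtain N where "norm (h t) \<le> real N" using real_arch_simple by blast
        thus ?thesis unfolding eventually_sequentially by (intro exI[of _ N]) auto
      qed
      thus "(\<lambda>n. tail n t) \<longlonglongrightarrow> 0" by (rule tendsto_eventually[OF eventually_mono]) (simp add: tail_def)
    qed
  qed (use h in \<open>auto simp: tail_def\<close>)
  hence "eventually (\<lambda>n. integral\<^sup>L ?L (tail n) < \<epsilon> / (3 * (K + 1))) sequentially"
    using K \<epsilon> by (intro order_tendstoD(2)) auto
  then obtain n where n: "integral\<^sup>L ?L (tail n) < \<epsilon> / (3 * (K + 1))"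
    using eventually_happens'[OF sequentially_bot] by blast
  define R where "R = real n + 1"
  have R: "R > 0" by (simp add: R_def)
  define m where "m = measure ?L {a..b} + 1"
  have m: "m > 0" by (simp add: m_def add_nonneg_pos)
  \<comment> \<open>\<open>\<kappa>\<close> keeps the constant term below
    \<open>\<epsilon>/3\<close>, strictly because \<open>m\<close> exceeds the measure by 1;
    \<open>\<delta>\<close> is then chosen so that
    \<open>R / \<kappa> * \<delta> = \<epsilon>/3\<close>.\<close>
  define \<kappa> where "\<kappa> = \<epsilon> / (3 * R * m)"
  have \<kappa>: "\<kappa> > 0" using \<epsilon> R m by (simp add: \<kappa>_def)
  define \<delta> where "\<delta> = \<epsilon> * \<kappa> / (3 * R)"
  show ?thesis
  proof (rule that[of \<delta>])
    show "\<delta> > 0" using \<epsilon> \<kappa> R by (simp add: \<delta>_def)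
    fix D :: "real \<Rightarrow> complex" assume D [measurable]: "D \<in> borel_measurable ?L" and DK: "AE t in ?L. norm (D t) \<le> K"
      and D2: "integral\<^sup>L ?L (\<lambda>t. (norm (D t))\<^sup>2) \<le> \<delta>"
    have ci: "integrable ?L (\<lambda>_. c)" for c :: real by (intro continuous_imp_integrable_real continuous_intros)
    have D2i: "integrable ?L (\<lambda>t. (norm (D t))\<^sup>2)"
      by (rule Bochner_Integration.integrable_bound[OF ci[of "K\<^sup>2"]]) (use DK in \<open>auto elim!: eventually_mono simp: power_mono\<close>)
    have Dhi: "integrable ?L (\<lambda>t. D t * h t)"
      by (rule Bochner_Integration.integrable_bound[OF integrable_mult_right[OF integrable_norm[OF h], of K]])
         (use DK K in \<open>auto elim!: eventually_mono simp: norm_mult abs_mult intro: mult_right_mono\<close>)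
    have "norm (integral\<^sup>L ?L (\<lambda>t. D t * h t)) \<le> integral\<^sup>L ?L (\<lambda>t. norm (D t * h t))"
      by (rule integral_norm_bound)
    also have "\<dots> \<le> integral\<^sup>L ?L (\<lambda>t. K * tail n t + R * \<kappa> + R / \<kappa> * (norm (D t))\<^sup>2)"
    proof (rule integral_mono_AE)
      show "integrable ?L (\<lambda>t. norm (D t * h t))" by (rule integrable_norm[OF Dhi])
      show "integrable ?L (\<lambda>t. K * tail n t + R * \<kappa> + R / \<kappa> * (norm (D t))\<^sup>2)"
        by (intro Bochner_Integration.integrable_add integrable_mult_right ti D2i ci)
      show "AE t in ?L. norm (D t * h t) \<le> K * tail n t + R * \<kappa> + R / \<kappa> * (norm (D t))\<^sup>2"
        using DK
      proof eventually_elim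
        case (elim t)
        show ?case
        proof (cases "norm (h t) \<le> real n")
          case True
          have amgm: "x \<le> \<kappa> + x\<^sup>2 / \<kappa>" if "x \<ge> 0" for x
          proof (cases "x \<le> \<kappa>")
            case True
            moreover have "x\<^sup>2 / \<kappa> \<ge> 0" using \<kappa> by simp
            ultimately show ?thesis by linarith
          next
            case False
            hence "x * \<kappa> \<le> x * x" using that by (intro mult_left_mono) auto
            hence "x \<le> x\<^sup>2 / \<kappa>" using \<kappa> by (simp add: field_simps power2_eq_square)
            thus ?thesis using \<kappa> by linarith
          qed
          have "norm (D t) * norm (h t) \<le> (\<kappa> + (norm (D t))\<^sup>2 / \<kappa>) * R"
            using True \<kappa> by (intro mult_mono amgm) (auto simp: R_def)
          thus ?thesis using True by (simp add: norm_mult tail_def algebra_simps)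
        next
          case False
          have "norm (D t) * norm (h t) \<le> K * norm (h t)" using elim by (intro mult_right_mono) auto
          moreover have "R * \<kappa> \<ge> 0" "R / \<kappa> * (norm (D t))\<^sup>2 \<ge> 0" using R \<kappa> by simp_all
          ultimately show ?thesis using False by (simp add: norm_mult tail_def)
        qed
      qed
    qed
    also have "\<dots> = K * integral\<^sup>L ?L (tail n) + R * \<kappa> * measure ?L {a..b} + R / \<kappa> * integral\<^sup>L ?L (\<lambda>t. (norm (D t))\<^sup>2)"
      using ti D2i ci by (simp add: Bochner_Integration.integral_add)
    also have "\<dots> < \<epsilon> / 3 + \<epsilon> / 3 + \<epsilon> / 3"
    proof (rule add_less_le_mono[OF add_le_less_mono])
      have "K * integral\<^sup>L ?L (tail n) \<le> K * (\<epsilon> / (3 * (K + 1)))" using K n by (intro mult_left_mono) auto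
      also have "\<dots> \<le> \<epsilon> / 3" using K \<epsilon> by (simp add: field_simps)
      finally show "K * integral\<^sup>L ?L (tail n) \<le> \<epsilon> / 3" .
      have "R * \<kappa> * measure ?L {a..b} < R * \<kappa> * m" using R \<kappa> by (intro mult_strict_left_mono) (auto simp: m_def)
      also have "\<dots> = \<epsilon> / 3" using R m by (simp add: \<kappa>_def)
      finally show "R * \<kappa> * measure ?L {a..b} < \<epsilon> / 3" .
      have "R / \<kappa> * integral\<^sup>L ?L (\<lambda>t. (norm (D t))\<^sup>2) \<le> R / \<kappa> * \<delta>" using R \<kappa> D2 by (intro mult_left_mono) auto
      also have "\<dots> = \<epsilon> / 3" using R \<kappa> by (simp add: \<delta>_def)
      finally show "R / \<kappa> * integral\<^sup>L ?L (\<lambda>t. (norm (D t))\<^sup>2) \<le> \<epsilon> / 3" .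
    qed
    finally show "norm (integral\<^sup>L ?L (\<lambda>t. D t * h t)) < \<epsilon>" by simp
  qed
qed

lemma bounded_L2_small_imp_weak_small_finite:
  fixes H :: "(real \<Rightarrow> complex) set"
  assumes H: "finite H" "\<And>h. h \<in> H \<Longrightarrow> integrable (lebesgue_on {a..b}) h" and K: "K \<ge> 0" and \<epsilon>: "\<epsilon> > 0"
  shows "\<exists>\<delta>>0. \<forall>h\<in>H. \<forall>D. D \<in> borel_measurable (lebesgue_on {a..b}) \<longrightarrow>
    (AE t in lebesgue_on {a..b}. norm (D t) \<le> K) \<longrightarrow>
    integral\<^sup>L (lebesgue_on {a..b}) (\<lambda>t. (norm (D t))\<^sup>2) \<le> \<delta> \<longrightarrow>
    norm (integral\<^sup>L (lebesgue_on {a..b}) (\<lambda>t. D t * h t)) < (\<epsilon>::real)"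
  using H
proof (induction H)
  case empty
  show ?case by (rule exI[of _ 1]) auto
next
  case (insert h H)
  let ?P = "\<lambda>h \<delta>. \<forall>D. D \<in> borel_measurable (lebesgue_on {a..b}) \<longrightarrow>
    (AE t in lebesgue_on {a..b}. norm (D t) \<le> K) \<longrightarrow>
    integral\<^sup>L (lebesgue_on {a..b}) (\<lambda>t. (norm (D t))\<^sup>2) \<le> \<delta> \<longrightarrow>
    norm (integral\<^sup>L (lebesgue_on {a..b}) (\<lambda>t. D t * h t)) < \<epsilon>"
  have mono: "?P h \<delta>'" if "?P h \<delta>" "\<delta>' \<le> \<delta>" for h \<delta> \<delta>' using that order_trans by blast
  obtain \<delta>1 where \<delta>1: "\<delta>1 > 0" "\<forall>h\<in>H. ?P h \<delta>1" using insert.IH insert.prems by blast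
  obtain \<delta>2 where \<delta>2: "\<delta>2 > 0" "?P h \<delta>2"
  proof (rule bounded_L2_small_imp_weak_small[OF _ K \<epsilon>, of a b h])
    show "integrable (lebesgue_on {a..b}) h" using insert.prems by simp
    fix \<delta> :: real assume "\<delta> > 0" "\<And>D. D \<in> borel_measurable (lebesgue_on {a..b}) \<Longrightarrow>
      AE t in lebesgue_on {a..b}. norm (D t) \<le> K \<Longrightarrow>
      integral\<^sup>L (lebesgue_on {a..b}) (\<lambda>t. (norm (D t))\<^sup>2) \<le> \<delta> \<Longrightarrow>
      norm (integral\<^sup>L (lebesgue_on {a..b}) (\<lambda>t. D t * h t)) < \<epsilon>"
    thus ?thesis using that by blast
  qed
  have "?P h (min \<delta>1 \<delta>2)" by (rule mono[OF \<delta>2(2)]) simp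
  moreover have "\<forall>h\<in>H. ?P h (min \<delta>1 \<delta>2)" by (intro ballI, rule mono[OF bspec[OF \<delta>1(2)]], assumption, simp)
  moreover have "min \<delta>1 \<delta>2 > 0" using \<delta>1 \<delta>2 by simp
  ultimately show ?case by blast
qed

section \<open>Weak-star density\<close>

text \<open>The set \<open>W\<close> of weak-star approximable functions is shown to be closed in
  the sense of \<open>approx_closed\<close>: \<open>f\<close> is first replaced by some
  \<open>a\<close> in \<open>W\<close>, with pairings controlled by the L^2 distance, and then
  \<open>a\<close> by an exponential sum for the same finite set \<open>H\<close>.\<close>

theorem exp_span_weak_star_dense:
  assumes \<phi>: "\<phi> holomorphic_on ball 0 1" "\<phi> ` ball 0 1 \<subseteq> strip"
  shows "weak_star_dense \<phi> strip exp_span"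
proof -
  let ?L = "lebesgue_on {0..2*pi}"
  define W where "W = {f \<in> Hinf strip. \<forall>H :: (real \<Rightarrow> complex) set. finite H \<longrightarrow> (\<forall>h\<in>H. integrable ?L h) \<longrightarrow>
     (\<forall>\<epsilon>>0. \<exists>v\<in>exp_span. \<forall>h\<in>H. norm (integral\<^sup>L ?L (\<lambda>t. (bdry (f \<circ> \<phi>) t - bdry (v \<circ> \<phi>) t) * h t)) < \<epsilon>)}"
  have \<phi>s: "\<phi> w \<in> strip" if "norm w < 1" for w using \<phi>(2) that by auto
  have comp: "(f \<circ> \<phi>) holomorphic_on ball 0 1" if "f holomorphic_on strip" for f
    by (rule holomorphic_on_compose_gen[OF \<phi>(1) that \<phi>(2)])
  define \<rho> where "\<rho> = (\<lambda>n::nat. 1 - 1 / (real n + 2))"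
  have \<rho>: "0 < \<rho> n" "\<rho> n < 1" for n by (auto simp: \<rho>_def field_simps)
  have \<rho>lim: "\<rho> \<longlonglongrightarrow> 1" unfolding \<rho>_def by real_asymp
  \<comment> \<open>Circles are centred at the origin of the disc, which \<open>\<phi>\<close> sends
    to a point possibly different from 0; Harnack's inequality pays for the change of base
    point.\<close>
  obtain \<kappa> where \<kappa>: "\<kappa> > 0" "\<And>h. h holomorphic_on strip \<Longrightarrow> (\<And>z. z \<in> strip \<Longrightarrow> Re (h z) \<ge> 0) \<Longrightarrow> Re (h (\<phi> 0)) \<le> \<kappa> * Re (h 0)"
  proof (rule harnack_strip[OF \<phi>s[of 0]])
    fix K :: real assume "K > 0" "\<And>h. h holomorphic_on strip \<Longrightarrow> (\<And>z. z \<in> strip \<Longrightarrow> Re (h z) \<ge> 0) \<Longrightarrow> Re (h (\<phi> 0)) \<le> K * Re (h 0)"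
    thus ?thesis by (rule that)
  qed simp
  have WD: "\<exists>v\<in>exp_span. \<forall>h\<in>H. norm (integral\<^sup>L ?L (\<lambda>t. (bdry (f \<circ> \<phi>) t - bdry (v \<circ> \<phi>) t) * h t)) < \<epsilon>"
    if "f \<in> W" "finite H" "\<forall>h\<in>H. integrable ?L h" "\<epsilon> > 0" for f H \<epsilon>
    using that by (simp add: W_def)
  have sub: "exp_span \<subseteq> W"
  proof
    fix e assume e: "e \<in> exp_span"
    hence "e \<in> Hinf strip" using exp_span_subset_Hinf by blast
    thus "e \<in> W" unfolding W_def using e by (intro CollectI conjI allI impI bexI[of _ e]) auto
  qed
  have closed: "approx_closed W"
    unfolding approx_closed_def
  proof (intro ballI impI)
    fix f assume f: "f \<in> Hinf strip"
    assume "\<exists>C. \<forall>\<eta>>0. \<exists>a\<in>W \<inter> Hinf strip. \<exists>h. h holomorphic_on strip \<and>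
      (\<forall>z\<in>strip. norm (a z) \<le> C \<and> (norm (f z - a z))\<^sup>2 \<le> Re (h z)) \<and> Re (h 0) \<le> \<eta>"
    then obtain C where C: "\<And>\<eta>. \<eta> > 0 \<Longrightarrow> \<exists>a\<in>W \<inter> Hinf strip. \<exists>h. h holomorphic_on strip \<and>
      (\<forall>z\<in>strip. norm (a z) \<le> C \<and> (norm (f z - a z))\<^sup>2 \<le> Re (h z)) \<and> Re (h 0) \<le> \<eta>" by blast
    obtain M where fh: "f holomorphic_on strip" and M: "\<And>z. z \<in> strip \<Longrightarrow> norm (f z) \<le> M"
      using f by (auto simp: Hinf_def bounded_iff)
    have M0: "M \<ge> 0" using order_trans[OF norm_ge_zero M[OF zero_in_strip]] .
    have C0: "C \<ge> 0"
    proof -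
      obtain a :: "complex \<Rightarrow> complex" where "\<forall>z\<in>strip. norm (a z) \<le> C" using C[OF zero_less_one] by blast
      thus ?thesis using zero_in_strip norm_ge_zero order_trans by blast
    qed
    have fM: "(f \<circ> \<phi>) ` ball 0 1 \<subseteq> cball 0 M" using M[OF \<phi>s] by auto
    note bf = bdry_AE_limit[OF comp[OF fh] fM \<rho> \<rho>lim]
    have "\<exists>v\<in>exp_span. \<forall>h\<in>H. norm (integral\<^sup>L ?L (\<lambda>t. (bdry (f \<circ> \<phi>) t - bdry (v \<circ> \<phi>) t) * h t)) < \<epsilon>"
      if H: "finite H" "\<forall>h\<in>H. integrable ?L h" and \<epsilon>: "\<epsilon> > 0" for H :: "(real \<Rightarrow> complex) set" and \<epsilon> :: real
    proof -
      have \<epsilon>2: "\<epsilon> / 2 > 0" using \<epsilon> by simp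
      obtain \<delta> where \<delta>: "\<delta> > 0" "\<And>h D. h \<in> H \<Longrightarrow> D \<in> borel_measurable ?L \<Longrightarrow>
          AE t in ?L. norm (D t) \<le> M + C \<Longrightarrow>
          integral\<^sup>L ?L (\<lambda>t. (norm (D t))\<^sup>2) \<le> \<delta> \<Longrightarrow> norm (integral\<^sup>L ?L (\<lambda>t. D t * h t)) < \<epsilon> / 2"
        using bounded_L2_small_imp_weak_small_finite[OF H(1) _ add_nonneg_nonneg[OF M0 C0] \<epsilon>2, of 0 "2*pi"] H(2) by blast
      \<comment> \<open>Harnack multiplies the value at 0 by \<open>\<kappa>\<close>, and passing
        from a mean to an integral multiplies by \<open>2 * pi\<close>.\<close>
      have "\<delta> / (2 * pi * \<kappa>) > 0" using \<delta> \<kappa> by simp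
      from C[OF this] obtain a h0 where a: "a \<in> W" "a \<in> Hinf strip" "h0 holomorphic_on strip"
        "\<And>z. z \<in> strip \<Longrightarrow> norm (a z) \<le> C" "\<And>z. z \<in> strip \<Longrightarrow> (norm (f z - a z))\<^sup>2 \<le> Re (h0 z)"
        "Re (h0 0) \<le> \<delta> / (2 * pi * \<kappa>)" by blast
      have ah: "a holomorphic_on strip" using a(2) by (simp add: Hinf_def)
      have aC: "(a \<circ> \<phi>) ` ball 0 1 \<subseteq> cball 0 C" using a(4)[OF \<phi>s] by auto
      note ba = bdry_AE_limit[OF comp[OF ah] aC \<rho> \<rho>lim]
      obtain v where v: "v \<in> exp_span" "\<And>h. h \<in> H \<Longrightarrow> norm (integral\<^sup>L ?L (\<lambda>t. (bdry (a \<circ> \<phi>) t - bdry (v \<circ> \<phi>) t) * h t)) < \<epsilon> / 2"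
        using WD[OF a(1) H \<epsilon>2] by blast
      have "v \<in> Hinf strip" using v(1) exp_span_subset_Hinf by blast
      then obtain B where vh: "v holomorphic_on strip" and B: "\<And>z. z \<in> strip \<Longrightarrow> norm (v z) \<le> B"
        by (auto simp: Hinf_def bounded_iff)
      have vB: "(v \<circ> \<phi>) ` ball 0 1 \<subseteq> cball 0 B" using B[OF \<phi>s] by auto
      note bv = bdry_AE_limit[OF comp[OF vh] vB \<rho> \<rho>lim]
      have Re0: "Re (h0 z) \<ge> 0" if "z \<in> strip" for z using a(5)[OF that] zero_le_power2 order_trans by blast
      have mean: "circle_mean r (\<lambda>w. norm ((f \<circ> \<phi>) w - (a \<circ> \<phi>) w) powr 2) \<le> \<kappa> * (\<delta> / (2 * pi * \<kappa>))" if r: "0 < r" "r < 1" for r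
      proof -
        have "circle_mean r (\<lambda>w. norm ((f \<circ> \<phi>) w - (a \<circ> \<phi>) w) powr 2) \<le> Re ((h0 \<circ> \<phi>) 0)"
        proof (rule circle_mean_le_majorant)
          show "(\<lambda>w. (f \<circ> \<phi>) w - (a \<circ> \<phi>) w) holomorphic_on ball 0 1" by (intro holomorphic_intros comp fh ah)
          show "(h0 \<circ> \<phi>) holomorphic_on ball 0 1" by (intro comp a)
          fix w :: complex assume "norm w < 1"
          from a(5)[OF \<phi>s[OF this]] show "norm ((f \<circ> \<phi>) w - (a \<circ> \<phi>) w) powr 2 \<le> Re ((h0 \<circ> \<phi>) w)"
            by (simp add: powr_numeral)
        qed (use r in auto)
        also have "\<dots> \<le> \<kappa> * Re (h0 0)" using \<kappa>(2)[OF a(3) Re0] by simp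
        also have "\<dots> \<le> \<kappa> * (\<delta> / (2 * pi * \<kappa>))" using a(6) \<kappa>(1) by (intro mult_left_mono) auto
        finally show ?thesis .
      qed
      define D where "D = (\<lambda>t. bdry (f \<circ> \<phi>) t - bdry (a \<circ> \<phi>) t)"
      have "integral\<^sup>L ?L (\<lambda>t. (norm (D t))\<^sup>2) \<le> 2 * pi * (\<kappa> * (\<delta> / (2 * pi * \<kappa>)))"
        unfolding D_def by (rule bdry_difference_L2[OF comp[OF fh] fM comp[OF ah] aC mean])
      hence D2: "integral\<^sup>L ?L (\<lambda>t. (norm (D t))\<^sup>2) \<le> \<delta>" using \<kappa>(1) by simp
      have Dm: "D \<in> borel_measurable ?L" unfolding D_def by (intro borel_measurable_diff bf(2) ba(2))
      have DK: "AE t in ?L. norm (D t) \<le> M + C"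
        using bf(3) ba(3) by eventually_elim (auto simp: D_def intro: order_trans[OF norm_triangle_ineq4 add_mono])
      have bound_int: "integrable ?L (\<lambda>t. E t * h t)"
        if "E \<in> borel_measurable ?L" "AE t in ?L. norm (E t) \<le> c" "h \<in> H" for E c h
      proof -
        have hi: "integrable ?L h" using H(2) that(3) by blast
        have "AE t in ?L. norm (E t * h t) \<le> norm (c * norm (h t))"
          using that(2) by eventually_elim (auto simp: norm_mult abs_mult intro!: mult_right_mono)
        thus ?thesis
          using that(1) hi by (intro Bochner_Integration.integrable_bound[OF integrable_mult_right[OF integrable_norm[OF hi], of c]]) auto
      qed
      show ?thesis
      proof (rule bexI[OF _ v(1)], intro ballI)
        fix h assume h: "h \<in> H"
        define E where "E = (\<lambda>t. bdry (a \<circ> \<phi>) t - bdry (v \<circ> \<phi>) t)"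
        have Em: "E \<in> borel_measurable ?L" unfolding E_def by (intro borel_measurable_diff ba(2) bv(2))
        have EK: "AE t in ?L. norm (E t) \<le> C + B"
          using ba(3) bv(3) by eventually_elim (auto simp: E_def intro: order_trans[OF norm_triangle_ineq4 add_mono])
        have "(\<lambda>t. (bdry (f \<circ> \<phi>) t - bdry (v \<circ> \<phi>) t) * h t) = (\<lambda>t. D t * h t + E t * h t)"
          by (simp add: D_def E_def algebra_simps)
        hence "integral\<^sup>L ?L (\<lambda>t. (bdry (f \<circ> \<phi>) t - bdry (v \<circ> \<phi>) t) * h t) = integral\<^sup>L ?L (\<lambda>t. D t * h t) + integral\<^sup>L ?L (\<lambda>t. E t * h t)"
          using Bochner_Integration.integral_add[OF bound_int[OF Dm DK h] bound_int[OF Em EK h]] by simp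
        also have "norm \<dots> < \<epsilon> / 2 + \<epsilon> / 2"
          using \<delta>(2)[OF h Dm DK D2] v(2)[OF h] unfolding E_def by (intro norm_add_less)
        finally show "norm (integral\<^sup>L ?L (\<lambda>t. (bdry (f \<circ> \<phi>) t - bdry (v \<circ> \<phi>) t) * h t)) < \<epsilon>" by simp
      qed
    qed
    thus "f \<in> W" using f by (simp add: W_def)
  qed
  have "Hinf strip \<subseteq> W" by (rule approx_closed_Hinf[OF sub closed])
  thus ?thesis unfolding weak_star_dense_def using WD by (intro ballI allI impI) (meson subsetD)
qed

section \<open>Density in the Hardy spaces\<close>

lemma norm_powr_add_le:
  fixes x y :: complex
  assumes "p \<ge> 0" shows "norm (x + y) powr p \<le> 2 powr p * (norm x powr p + norm y powr p)"
proof -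
  let ?m = "max (norm x) (norm y)"
  have "norm (x + y) \<le> 2 * ?m" using norm_triangle_ineq[of x y] by linarith
  hence "norm (x + y) powr p \<le> (2 * ?m) powr p" using assms by (intro powr_mono2) auto
  also have "\<dots> = 2 powr p * ?m powr p" by (simp add: powr_mult)
  also have "?m powr p \<le> norm x powr p + norm y powr p" by (simp add: max_def)
  finally show ?thesis by simp
qed

text \<open>Turns quadratic error control under a uniform bound into control of p-th powers, for
  \<open>p\<close> on either side of 2. Below the threshold \<open>s = \<kappa> powr (1/p)\<close>
  the power is at most \<open>\<kappa>\<close>; above it \<open>x^2 / s^2 \<ge> 1\<close> and the
  power is at most \<open>K powr p\<close>.\<close>

lemma powr_le_const_add_square:
  fixes \<kappa> :: real
  assumes "p > 0" "\<kappa> > 0" "K \<ge> 0"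
  obtains c where "c \<ge> 0" "\<And>x. 0 \<le> x \<Longrightarrow> x \<le> K \<Longrightarrow> x powr p \<le> \<kappa> + c * x\<^sup>2"
proof -
  define s where "s = \<kappa> powr (1/p)"
  have s: "s > 0" "s powr p = \<kappa>" using assms by (simp_all add: s_def powr_powr)
  show ?thesis
  proof (rule that[of "K powr p / s\<^sup>2"])
    fix x :: real assume x: "0 \<le> x" "x \<le> K"
    show "x powr p \<le> \<kappa> + K powr p / s\<^sup>2 * x\<^sup>2"
    proof (cases "x \<le> s")
      case True
      hence "x powr p \<le> s powr p" using x assms by (intro powr_mono2) auto
      moreover have "0 \<le> K powr p / s\<^sup>2 * x\<^sup>2" by simp
      ultimately show ?thesis unfolding s(2) by linarith
    next
      case False
      have "s\<^sup>2 \<le> x\<^sup>2" using False s by (intro power_mono) auto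
      hence "1 \<le> x\<^sup>2 / s\<^sup>2" using s by simp
      hence "K powr p * 1 \<le> K powr p * (x\<^sup>2 / s\<^sup>2)" by (intro mult_left_mono) auto
      moreover have "x powr p \<le> K powr p" using x assms by (intro powr_mono2) auto
      ultimately show ?thesis using assms by simp
    qed
  qed simp
qed

lemma Hinf_exp_span_Hp_approximation:
  assumes p: "p \<ge> 1" and f: "f \<in> Hinf strip" and \<eta>: "\<eta> > 0"
  obtains g h where "g \<in> exp_span" "h holomorphic_on strip"
    "\<And>z. z \<in> strip \<Longrightarrow> norm (f z - g z) powr p \<le> Re (h z)" "Re (h 0) \<le> \<eta>"
proof -
  define P where "P = {f \<in> Hinf strip. \<forall>\<eta>>0. \<exists>g\<in>exp_span. \<exists>h. h holomorphic_on strip \<and>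
     (\<forall>z\<in>strip. norm (f z - g z) powr p \<le> Re (h z)) \<and> Re (h 0) \<le> \<eta>}"
  have sub: "exp_span \<subseteq> P"
  proof
    fix e assume e: "e \<in> exp_span"
    have "e \<in> Hinf strip" using e exp_span_subset_Hinf by blast
    moreover have "(\<lambda>_. 0) holomorphic_on strip" by (rule holomorphic_on_const)
    ultimately show "e \<in> P" unfolding P_def using e
      by (intro CollectI conjI allI impI bexI[of _ e] exI[of _ "\<lambda>_. 0"]) auto
  qed
  have closed: "approx_closed P"
    unfolding approx_closed_def
  proof (intro ballI impI)
    fix f assume f: "f \<in> Hinf strip"
    assume "\<exists>C. \<forall>\<eta>>0. \<exists>a\<in>P \<inter> Hinf strip. \<exists>h. h holomorphic_on strip \<and>
      (\<forall>z\<in>strip. norm (a z) \<le> C \<and> (norm (f z - a z))\<^sup>2 \<le> Re (h z)) \<and> Re (h 0) \<le> \<eta>"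
    then obtain C where C: "\<And>\<eta>. \<eta> > 0 \<Longrightarrow> \<exists>a\<in>P \<inter> Hinf strip. \<exists>h. h holomorphic_on strip \<and>
      (\<forall>z\<in>strip. norm (a z) \<le> C \<and> (norm (f z - a z))\<^sup>2 \<le> Re (h z)) \<and> Re (h 0) \<le> \<eta>" by blast
    obtain M where M: "\<And>z. z \<in> strip \<Longrightarrow> norm (f z) \<le> M"
      using f by (auto simp: Hinf_def bounded_iff)
    have "\<exists>g\<in>exp_span. \<exists>h. h holomorphic_on strip \<and>
     (\<forall>z\<in>strip. norm (f z - g z) powr p \<le> Re (h z)) \<and> Re (h 0) \<le> \<eta>" if \<eta>: "\<eta> > 0" for \<eta>
    proof -
      \<comment> \<open>The final majorant at 0 is \<open>2 powr p\<close> times three terms of size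
        at most \<open>\<kappa>\<close>.\<close>
      define \<kappa> where "\<kappa> = \<eta> / (3 * 2 powr p)"
      have \<kappa>: "\<kappa> > 0" using \<eta> by (simp add: \<kappa>_def)
      have p0: "p > 0" using p by simp
      obtain c where c: "c \<ge> 0" "\<And>x. 0 \<le> x \<Longrightarrow> x \<le> max 0 (M + C) \<Longrightarrow> x powr p \<le> \<kappa> + c * x\<^sup>2"
        using powr_le_const_add_square[OF p0 \<kappa>, of "max 0 (M + C)"] by auto
      \<comment> \<open>Here \<open>c + 1\<close> instead of \<open>c\<close> avoids division by 0,
        and still \<open>c * (\<kappa> / (c + 1)) \<le> \<kappa>\<close>.\<close>
      have "\<kappa> / (c + 1) > 0" using \<kappa> c by simp
      from C[OF this] obtain a ha where a: "a \<in> P" "ha holomorphic_on strip"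
        "\<And>z. z \<in> strip \<Longrightarrow> norm (a z) \<le> C" "\<And>z. z \<in> strip \<Longrightarrow> (norm (f z - a z))\<^sup>2 \<le> Re (ha z)"
        "Re (ha 0) \<le> \<kappa> / (c + 1)" by blast
      obtain g hg where g: "g \<in> exp_span" "hg holomorphic_on strip"
        "\<And>z. z \<in> strip \<Longrightarrow> norm (a z - g z) powr p \<le> Re (hg z)" "Re (hg 0) \<le> \<kappa>"
        using a(1) \<kappa> unfolding P_def by blast
      define h where "h = (\<lambda>z. of_real (2 powr p) * (of_real \<kappa> + of_real c * ha z + hg z))"
      have Reh: "Re (h z) = 2 powr p * (\<kappa> + c * Re (ha z) + Re (hg z))" for z by (simp add: h_def)
      have hh: "h holomorphic_on strip" unfolding h_def by (intro holomorphic_intros a g)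
      have "norm (f z - g z) powr p \<le> Re (h z)" if z: "z \<in> strip" for z
      proof -
        have "norm (f z - a z) \<le> max 0 (M + C)"
          using norm_triangle_ineq4[of "f z" "a z"] M[OF z] a(3)[OF z] by linarith
        hence "norm (f z - a z) powr p \<le> \<kappa> + c * (norm (f z - a z))\<^sup>2" by (intro c) auto
        also have "\<dots> \<le> \<kappa> + c * Re (ha z)" by (intro add_left_mono mult_left_mono a z c)
        finally have 1: "norm (f z - a z) powr p \<le> \<kappa> + c * Re (ha z)" .
        have "norm (f z - g z) powr p = norm ((f z - a z) + (a z - g z)) powr p" by simp
        also have "\<dots> \<le> 2 powr p * (norm (f z - a z) powr p + norm (a z - g z) powr p)"
          using p by (intro norm_powr_add_le) auto
        also have "\<dots> \<le> 2 powr p * (\<kappa> + c * Re (ha z) + Re (hg z))"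
          by (intro mult_left_mono add_mono 1 g z) auto
        finally show ?thesis unfolding Reh .
      qed
      moreover have "Re (h 0) \<le> \<eta>"
      proof -
        have "c * Re (ha 0) \<le> c * (\<kappa> / (c + 1))" by (intro mult_left_mono a c)
        also have "\<dots> \<le> \<kappa>" using c \<kappa> by (simp add: field_simps)
        finally have "Re (h 0) \<le> 2 powr p * (\<kappa> + \<kappa> + \<kappa>)" unfolding Reh using g(4) by (intro mult_left_mono add_mono) auto
        also have "\<dots> = \<eta>" by (simp add: \<kappa>_def)
        finally show ?thesis .
      qed
      ultimately show ?thesis using g(1) hh by blast
    qed
    thus "f \<in> P" unfolding P_def using f by blast
  qed
  have "f \<in> P" using approx_closed_Hinf[OF sub closed] f by blast
  thus ?thesis unfolding P_def using \<eta> that by blast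
qed

theorem exp_span_Hardy_dense:
  assumes p: "1 \<le> p" shows "Hardy_dense p strip 0 exp_span"
  unfolding Hardy_dense_def
proof (intro ballI allI impI)
  fix f \<epsilon> assume f: "f \<in> Hardy p strip" and \<epsilon>: "(0::real) < \<epsilon>"
  obtain u where fh: "f holomorphic_on strip" and u: "harmonic_majorant strip p f u"
    using f by (auto simp: Hardy_def)
  obtain V where V: "V holomorphic_on strip" "\<And>z. z \<in> strip \<Longrightarrow> u z = Re (V z)"
    using harmonic_on_convex_imp_Re[of strip u] u convex_strip by (auto simp: harmonic_majorant_def)
  \<comment> \<open>Two errors of size \<open>\<eta>\<close>, each multiplied by
    \<open>2 powr p\<close>, add up to half of \<open>\<epsilon> powr p\<close>, which leaves the
    strict inequality.\<close>
  define \<eta> where "\<eta> = (\<epsilon> powr p / 2) / (2 powr p * 2)"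
  have \<eta>: "\<eta> > 0" using \<epsilon> by (simp add: \<eta>_def)
  have maj: "norm (f (from_disc w)) powr p \<le> Re (V (from_disc w))" if "norm w < 1" for w
    using u from_disc_in_strip[OF that] by (simp add: harmonic_majorant_def V(2)[symmetric])
  obtain F1 h B where F1: "F1 holomorphic_on ball 0 1" "\<And>w. norm w < 1 \<Longrightarrow> norm (F1 w) \<le> B"
    and h: "h holomorphic_on ball 0 1" "\<And>w. norm w < 1 \<Longrightarrow> norm (f (from_disc w) - F1 w) powr p \<le> Re (h w)" "Re (h 0) \<le> \<eta>"
  proof (rule bounded_approximation_Hp[OF holomorphic_from_disc_compose[OF fh] holomorphic_from_disc_compose[OF V(1)] p maj \<eta>])
    fix F1 h B assume "F1 holomorphic_on ball 0 1" "\<And>w. norm w < 1 \<Longrightarrow> norm (F1 w) \<le> B"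
      "h holomorphic_on ball 0 1" "\<And>w. norm w < 1 \<Longrightarrow> norm (f (from_disc w) - F1 w) powr p \<le> Re (h w)" "Re (h 0) \<le> \<eta>"
    thus ?thesis by (rule that)
  qed
  define f1 where "f1 = (\<lambda>z. F1 (to_disc z))"
  have "f1 holomorphic_on strip" unfolding f1_def by (rule holomorphic_to_disc_compose[OF F1(1)])
  moreover have "norm (f1 z) \<le> B" if "z \<in> strip" for z unfolding f1_def by (intro F1 to_disc_in_ball that)
  ultimately have f1: "f1 \<in> Hinf strip" by (auto simp: Hinf_def bounded_iff)
  obtain g h2 where g: "g \<in> exp_span" "h2 holomorphic_on strip"
    "\<And>z. z \<in> strip \<Longrightarrow> norm (f1 z - g z) powr p \<le> Re (h2 z)" "Re (h2 0) \<le> \<eta>"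
  proof (rule Hinf_exp_span_Hp_approximation[OF p f1 \<eta>])
    fix g h2 assume "g \<in> exp_span" "h2 holomorphic_on strip"
      "\<And>z. z \<in> strip \<Longrightarrow> norm (f1 z - g z) powr p \<le> Re (h2 z)" "Re (h2 0) \<le> \<eta>"
    thus ?thesis by (rule that)
  qed
  define U where "U = (\<lambda>z. of_real (2 powr p) * (h (to_disc z) + h2 z))"
  have Uh: "U holomorphic_on strip" unfolding U_def by (intro holomorphic_intros holomorphic_to_disc_compose h g)
  have ReU: "Re (U z) = 2 powr p * (Re (h (to_disc z)) + Re (h2 z))" for z by (simp add: U_def)
  \<comment> \<open>Besides giving the estimate, this majorant shows that the infimum in
    \<open>Hardy_norm\<close> runs over a nonempty set, so its value is not an arbitrary
    default.\<close>
  have mem: "harmonic_majorant strip p (\<lambda>z. f z - g z) (\<lambda>z. Re (U z))"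
    unfolding harmonic_majorant_def
  proof (intro conjI ballI harmonic_on_Re open_strip Uh)
    fix z assume z: "z \<in> strip"
    have "norm (f z - g z) powr p = norm ((f z - f1 z) + (f1 z - g z)) powr p" by simp
    also have "\<dots> \<le> 2 powr p * (norm (f z - f1 z) powr p + norm (f1 z - g z) powr p)"
      using p by (intro norm_powr_add_le) auto
    also have "\<dots> \<le> Re (U z)" unfolding ReU
      using h(2)[OF to_disc_in_ball(1)[OF z]] g(3)[OF z]
      by (intro mult_left_mono add_mono) (auto simp: f1_def from_disc_to_disc z)
    finally show "norm (f z - g z) powr p \<le> Re (U z)" .
  qed
  let ?A = "{u. harmonic_majorant strip p (\<lambda>z. f z - g z) u}"
  have nonneg: "0 \<le> u 0" if "u \<in> ?A" for u
  proof -
    have "norm (f 0 - g 0) powr p \<le> u 0" using that zero_in_strip by (auto simp: harmonic_majorant_def)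
    thus ?thesis by (rule order_trans[OF powr_ge_zero])
  qed
  have "(INF u\<in>?A. u 0) \<le> Re (U 0)"
  proof (rule order_trans[OF cINF_lower])
    show "bdd_below ((\<lambda>u. u 0) ` ?A)" by (rule bdd_belowI2[of _ 0]) (rule nonneg)
  qed (use mem in auto)
  moreover have "Re (U 0) \<le> 2 powr p * (\<eta> + \<eta>)" unfolding ReU using h(3) g(4)
    by (intro mult_left_mono add_mono) (auto simp: to_disc_0)
  moreover have "2 powr p * (\<eta> + \<eta>) = \<epsilon> powr p / 2" by (simp add: \<eta>_def)
  moreover have "\<epsilon> powr p > 0" using \<epsilon> by simp
  ultimately have "(INF u\<in>?A. u 0) < \<epsilon> powr p" by linarith
  moreover have "(INF u\<in>?A. u 0) \<ge> 0" by (rule cINF_greatest) (use mem nonneg in auto)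
  ultimately have "(INF u\<in>?A. u 0) powr (1/p) < (\<epsilon> powr p) powr (1/p)" using p by (intro powr_less_mono2) auto
  also have "\<dots> = \<epsilon>" using p \<epsilon> by (simp add: powr_powr)
  finally show "\<exists>g\<in>exp_span. Hardy_norm p strip 0 (\<lambda>z. f z - g z) < \<epsilon>"
    unfolding Hardy_norm_def using g(1) by blast
qed

text \<open>The inclusion in \<open>Hinf strip\<close> belongs to the claim because
  \<open>weak_star_dense\<close> itself speaks only of approximation by elements of the given
  set.\<close>

theorem theorem4p3:
  shows "exp_span \<subseteq> Hinf strip
         \<and> (\<forall>\<phi>. riemann_map \<phi> strip \<longrightarrow> weak_star_dense \<phi> strip exp_span)
         \<and> (\<forall>p::real. 1 \<le> p \<longrightarrow> Hardy_dense p strip 0 exp_span)"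
proof (intro conjI allI impI)
  fix \<phi> assume "riemann_map \<phi> strip"
  hence "\<phi> holomorphic_on ball 0 1" "\<phi> ` ball 0 1 \<subseteq> strip"
    by (auto simp: riemann_map_def bij_betw_def)
  thus "weak_star_dense \<phi> strip exp_span" by (rule exp_span_weak_star_dense)
qed (use exp_span_subset_Hinf exp_span_Hardy_dense in auto)

end
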